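(* Let $\{X(t)\}_{t\ge0}$ be the minimal PDMP with characteristics $(\pi,\varphi,\mathcal J)$, $t_\infty$ its explosion time, and $\{P(t)\}_{t\ge0}$ the minimal semigroup on $L^1$ corresponding to $(\pi,\varphi,\mathcal J)$. The semigroup $\{P(t)\}_{t\ge0}$ is stochastic if and only if $$m\{x\in E:\mathbb P_x(t_\infty<\infty)>0\}=0.$$ In that case, if the distribution of $X(0)$ has a density $u_0\in\mathcal D(A)$ then $X(t)$ has the density $P(t)u_0$ for all $t>0$.
   Context: Process. $E$ is a Borel subset of a Polish space with Borel $\sigma$-algebra $\mathcal B(E)$. The characteristics are: (i) a semidynamical system $\pi\colon\mathbb R_+\times E\to E$: $\pi_0x=x$, $\pi_{t+s}x=\pi_t(\pi_sx)$, and $(t,x)\mapsto\pi_tx$ is continuous; (ii) a Borel measurable jump rate function $\varphi\colon E\to\mathbb R_+$ such that for every $x\in E$, $t>0$ the function $s\mapsto\varphi(\pi_sx)$ is integrable on $[0,t)$, and $\lim_{t\to\infty}\int_0^t\varphi(\pi_sx)ds=+\infty$ for all $x\in E$; (iii) a stochastic transition kernel $\mathcal J\colon E\times\mathcal B(E)\to[0,1]$ ($\mathcal J(x,\cdot)$ a probability measure, $x\mapsto\mathcal J(x,B)$ measurable) with $\mathcal J(x,\{x\})=0$ for all $x\in E$. Put $\phi_x(t)=\int_0^t\varphi(\pi_sx)ds$, $\phi_x^{\leftarrow}(q)=\inf\{t:\phi_x(t)\ge q\}$, and let $\kappa\colon[0,1]\times E\to E$ be measurable with $\mathcal J(x,B)$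 equal to the Lebesgue measure of $\{q\in[0,1]:\kappa(q,x)\in B\}$ for all $x,B$. Let $\varepsilon_n,\vartheta_n$, $n\ge1$, be independent, $\varepsilon_n$ exponential with mean $1$, $\vartheta_n$ uniform on $(0,1)$. Starting from $\xi_0$ (a point $x\in E$, or an $E$-valued random variable independent of all $\varepsilon_n,\vartheta_n$), define $\Delta t_n=\phi_{\xi_{n-1}}^{\leftarrow}(\varepsilon_n)$, $\xi_n=\kappa(\vartheta_n,\pi_{\Delta t_n}\xi_{n-1})$ for $n\ge1$, jump times $t_0=0$, $t_n=\sum_{l=1}^n\Delta t_l$, and explosion time $t_\infty=\lim_n t_n$. The minimal PDMP is $X(t)=\pi_{t-t_n}(\xi_n)$ for $t_n\le t<t_{n+1}$, $n\ge0$, and $X(t)=\Delta$ (a cemetery state $\Delta\notin E$) for $t\ge t_\infty$; $X(0)=\xi_0$. $\mathbb P_x$ denotes probability when $\xi_0=x$. Semigroup. $m$ is a $\sigma$-finite measure on $\mathcal B(E)$, $L^1=L^1(E,\mathcal B(E),m)$, $L^1_+$ its nonnegative cone, $\mathcal D(A)_+=\mathcal D(A)\cap L^1_+$. Densities are elements of $L^1_+$ of norm 1 (densities of distributions are taken with respect to $m$); a stochastic operator on $L^1$ is a linear operator mapping densities to densities; a stochastic operator $T$ is the transition operator corresponding to a stochastic kernel $\mathcal N$ if $\int_E\mathcal N(x,B)u(x)m(dx)=\int_BTu(x)m(dx)$ for all $B\in\mathcal B(E)$ and all densities $u$. A substochastic (resp. stochastic) semigroup is a strongly continuous semigroup of positive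 contractions (resp. stochastic operators) on $L^1$. $L^1_\varphi=\{u\in L^1:\int_E\varphi|u|\,dm<\infty\}$. Assumptions: there is a stochastic operator $P$ on $L^1$ which is the transition operator corresponding to $\mathcal J$; and there is a substochastic semigroup $\{S(t)\}_{t\ge0}$ on $L^1$ with generator $(A,\mathcal D(A))$ such that $\mathcal D(A)\subseteq L^1_\varphi$, $\int_EAu\,dm=-\int_E\varphi u\,dm$ for $u\in\mathcal D(A)_+$, and $$\int_Ee^{-\int_0^t\varphi(\pi_rx)dr}1_B(\pi_tx)u(x)\,m(dx)=\int_BS(t)u(x)\,m(dx)\quad (t\ge0,\ u\in L^1_+,\ B\in\mathcal B(E)).$$ The minimal semigroup $\{P(t)\}_{t\ge0}$ corresponding to $(\pi,\varphi,\mathcal J)$ is the smallest substochastic semigroup on $L^1$ whose generator is an extension of the operator $u\mapsto Au+P(\varphi u)$, $u\in\mathcal D(A)$ (it exists by the Kato--Voigt perturbation theorem; smallest means $P(t)u\le\widetilde P(t)u$ for $t\ge0$, $u\in L^1_+$ and any other such semigroup $\widetilde P$); its generator $C$ satisfies $(\lambda-C)^{-1}u=\lim_{N\to\infty}R(\lambda,A)\sum_{n=0}^N(P(\varphi R(\lambda,A)))^nu$ for $\lambda>0$, $u\in L^1$, where $R(\lambda,A)=(\lambda-A)^{-1}$ and $P(\varphi R(\lambda,A))$ is the operator $u\mapsto P(\varphi R(\lambda,A)u)$. *)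

theory Defs
  imports "HOL-Probability.Probability"
begin

section \<open>Characteristics of a piecewise deterministic Markov process\<close>

text \<open>The state space is a Borel set \<open>E\<close> in a Polish space; functions on \<open>E\<close> are functions on the
  ambient type, and only their values on \<open>E\<close> matter.\<close>

abbreviation borel_on :: "'a::topological_space set \<Rightarrow> 'a measure" where
  "borel_on E \<equiv> restrict_space borel E"

definition semidynamical_system :: "'a::polish_space set \<Rightarrow> (real \<Rightarrow> 'a \<Rightarrow> 'a) \<Rightarrow> bool" where
  "semidynamical_system E \<pi> \<longleftrightarrow>
     (\<forall>t\<ge>0. \<forall>x\<in>E. \<pi> t x \<in> E) \<and>
     (\<forall>x\<in>E. \<pi> 0 x = x) \<and>
     (\<forall>t\<ge>0. \<forall>s\<ge>0. \<forall>x\<in>E. \<pi> (t + s) x = \<pi> t (\<pi> s x)) \<and>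
     continuous_on ({0..} \<times> E) (\<lambda>(t, x). \<pi> t x)"

definition cumulative_rate :: "(real \<Rightarrow> 'a \<Rightarrow> 'a) \<Rightarrow> ('a \<Rightarrow> real) \<Rightarrow> 'a \<Rightarrow> real \<Rightarrow> real" where
  "cumulative_rate \<pi> \<phi> x t = (LINT s:{0..t}|lborel. \<phi> (\<pi> s x))"

definition cumulative_rate_inverse :: "(real \<Rightarrow> 'a \<Rightarrow> 'a) \<Rightarrow> ('a \<Rightarrow> real) \<Rightarrow> 'a \<Rightarrow> real \<Rightarrow> real" where
  "cumulative_rate_inverse \<pi> \<phi> x q = Inf {t. 0 \<le> t \<and> q \<le> cumulative_rate \<pi> \<phi> x t}"

definition jump_rate :: "'a::polish_space set \<Rightarrow> (real \<Rightarrow> 'a \<Rightarrow> 'a) \<Rightarrow> ('a \<Rightarrow> real) \<Rightarrow> bool" where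
  "jump_rate E \<pi> \<phi> \<longleftrightarrow>
     \<phi> \<in> borel_measurable (borel_on E) \<and>
     (\<forall>x\<in>E. 0 \<le> \<phi> x) \<and>
     (\<forall>x\<in>E. \<forall>t>0. set_integrable lborel {0..<t} (\<lambda>s. \<phi> (\<pi> s x))) \<and>
     (\<forall>x\<in>E. filterlim (cumulative_rate \<pi> \<phi> x) at_top at_top)"

definition jump_kernel :: "'a::polish_space set \<Rightarrow> ('a \<Rightarrow> 'a measure) \<Rightarrow> bool" where
  "jump_kernel E J \<longleftrightarrow>
     J \<in> borel_on E \<rightarrow>\<^sub>M prob_algebra (borel_on E) \<and> (\<forall>x\<in>E. emeasure (J x) {x} = 0)"

definition kernel_representation ::
    "'a::polish_space set \<Rightarrow> ('a \<Rightarrow> 'a measure) \<Rightarrow> (real \<Rightarrow> 'a \<Rightarrow> 'a) \<Rightarrow> bool" where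
  "kernel_representation E J \<kappa> \<longleftrightarrow>
     (\<lambda>(q, x). \<kappa> q x) \<in> borel_on {0..1} \<Otimes>\<^sub>M borel_on E \<rightarrow>\<^sub>M borel_on E \<and>
     (\<forall>x\<in>E. \<forall>B\<in>sets (borel_on E). emeasure (J x) B = emeasure lborel {q\<in>{0..1}. \<kappa> q x \<in> B})"

section \<open>The minimal process\<close>

text \<open>The construction is pathwise: \<open>x\<close> is the starting point, \<open>e n\<close> and \<open>q n\<close> (\<open>n \<ge> 1\<close>) are the values
  of the exponential and of the uniform variables.\<close>

primrec post_jump_state ::
    "(real \<Rightarrow> 'a \<Rightarrow> 'a) \<Rightarrow> ('a \<Rightarrow> real) \<Rightarrow> (real \<Rightarrow> 'a \<Rightarrow> 'a) \<Rightarrow> 'a \<Rightarrow> (nat \<Rightarrow> real) \<Rightarrow> (nat \<Rightarrow> real) \<Rightarrow> nat \<Rightarrow> 'a"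
  where
    "post_jump_state \<pi> \<phi> \<kappa> x e q 0 = x"
  | "post_jump_state \<pi> \<phi> \<kappa> x e q (Suc n) =
       (let y = post_jump_state \<pi> \<phi> \<kappa> x e q n
        in \<kappa> (q (Suc n)) (\<pi> (cumulative_rate_inverse \<pi> \<phi> y (e (Suc n))) y))"

definition holding_time ::
    "(real \<Rightarrow> 'a \<Rightarrow> 'a) \<Rightarrow> ('a \<Rightarrow> real) \<Rightarrow> (real \<Rightarrow> 'a \<Rightarrow> 'a) \<Rightarrow> 'a \<Rightarrow> (nat \<Rightarrow> real) \<Rightarrow> (nat \<Rightarrow> real) \<Rightarrow> nat \<Rightarrow> real"
  where
    "holding_time \<pi> \<phi> \<kappa> x e q n =
       cumulative_rate_inverse \<pi> \<phi> (post_jump_state \<pi> \<phi> \<kappa> x e q (n - 1)) (e n)"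

definition jump_time ::
    "(real \<Rightarrow> 'a \<Rightarrow> 'a) \<Rightarrow> ('a \<Rightarrow> real) \<Rightarrow> (real \<Rightarrow> 'a \<Rightarrow> 'a) \<Rightarrow> 'a \<Rightarrow> (nat \<Rightarrow> real) \<Rightarrow> (nat \<Rightarrow> real) \<Rightarrow> nat \<Rightarrow> real"
  where
    "jump_time \<pi> \<phi> \<kappa> x e q n = (\<Sum>l=1..n. holding_time \<pi> \<phi> \<kappa> x e q l)"

definition explosion_time ::
    "(real \<Rightarrow> 'a \<Rightarrow> 'a) \<Rightarrow> ('a \<Rightarrow> real) \<Rightarrow> (real \<Rightarrow> 'a \<Rightarrow> 'a) \<Rightarrow> 'a \<Rightarrow> (nat \<Rightarrow> real) \<Rightarrow> (nat \<Rightarrow> real) \<Rightarrow> ereal"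
  where
    "explosion_time \<pi> \<phi> \<kappa> x e q = lim (\<lambda>n. ereal (jump_time \<pi> \<phi> \<kappa> x e q n))"

text \<open>The cemetery state is \<^const>\<open>None\<close>.\<close>

definition minimal_pdmp ::
    "(real \<Rightarrow> 'a \<Rightarrow> 'a) \<Rightarrow> ('a \<Rightarrow> real) \<Rightarrow> (real \<Rightarrow> 'a \<Rightarrow> 'a) \<Rightarrow> 'a \<Rightarrow> (nat \<Rightarrow> real) \<Rightarrow> (nat \<Rightarrow> real) \<Rightarrow> real \<Rightarrow> 'a option"
  where
    "minimal_pdmp \<pi> \<phi> \<kappa> x e q t =
       (if ereal t < explosion_time \<pi> \<phi> \<kappa> x e q
        then let n = (THE n. jump_time \<pi> \<phi> \<kappa> x e q n \<le> t \<and> t < jump_time \<pi> \<phi> \<kappa> x e q (Suc n))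
             in Some (\<pi> (t - jump_time \<pi> \<phi> \<kappa> x e q n) (post_jump_state \<pi> \<phi> \<kappa> x e q n))
        else None)"

text \<open>The uniform variables are required to take values in \<open>[0,1]\<close> everywhere, since \<open>\<kappa>\<close> is only
  defined there. Only indices \<open>n \<ge> 1\<close> are used.\<close>

definition driving_noise :: "'w measure \<Rightarrow> (nat \<Rightarrow> 'w \<Rightarrow> real) \<Rightarrow> (nat \<Rightarrow> 'w \<Rightarrow> real) \<Rightarrow> bool" where
  "driving_noise M \<epsilon> \<theta> \<longleftrightarrow>
     prob_space M \<and>
     prob_space.indep_vars M (\<lambda>_. borel) (case_sum \<epsilon> \<theta>) ({1..} <+> {1..}) \<and>
     (\<forall>n\<ge>1. distributed M lborel (\<epsilon> n) (exponential_density 1)) \<and>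
     (\<forall>n\<ge>1. distr M borel (\<theta> n) = uniform_measure lborel {0<..<1}) \<and>
     (\<forall>n\<ge>1. \<forall>\<omega>\<in>space M. \<theta> n \<omega> \<in> {0..1})"

text \<open>\<^const>\<open>prob_space.indep_var\<close> needs variables of equal type, so independence of \<open>\<xi>\<close> from the whole
  noise is stated for the generated \<open>\<sigma>\<close>-algebras.\<close>

definition independent_of_noise ::
    "'w measure \<Rightarrow> 'a measure \<Rightarrow> ('w \<Rightarrow> 'a) \<Rightarrow> (nat \<Rightarrow> 'w \<Rightarrow> real) \<Rightarrow> (nat \<Rightarrow> 'w \<Rightarrow> real) \<Rightarrow> bool" where
  "independent_of_noise M N \<xi> \<epsilon> \<theta> \<longleftrightarrow>
     prob_space.indep_set M
       (sets (vimage_algebra (space M) \<xi> N))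
       (sets (vimage_algebra (space M) (\<lambda>\<omega>. \<lambda>i\<in>{1..} <+> {1..}. case_sum \<epsilon> \<theta> i \<omega>)
                (\<Pi>\<^sub>M i\<in>{1..} <+> {1..}. borel)))"

section \<open>Operators and semigroups on \<open>L\<^sup>1\<close>\<close>

text \<open>Elements of \<open>L\<^sup>1(m)\<close> are given by integrable representatives; equality in \<open>L\<^sup>1(m)\<close> is equality
  almost everywhere, which all operators respect.\<close>

definition L1_operator :: "'a measure \<Rightarrow> (('a \<Rightarrow> real) \<Rightarrow> ('a \<Rightarrow> real)) \<Rightarrow> bool" where
  "L1_operator m T \<longleftrightarrow>
     (\<forall>u. integrable m u \<longrightarrow> integrable m (T u)) \<and>
     (\<forall>u v. integrable m u \<longrightarrow> integrable m v \<longrightarrow> (AE x in m. u x = v x) \<longrightarrow> (AE x in m. T u x = T v x)) \<and>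
     (\<forall>u v. integrable m u \<longrightarrow> integrable m v \<longrightarrow> (AE x in m. T (\<lambda>y. u y + v y) x = T u x + T v x)) \<and>
     (\<forall>c u. integrable m u \<longrightarrow> (AE x in m. T (\<lambda>y. c * u y) x = c * T u x))"

definition L1_norm :: "'a measure \<Rightarrow> ('a \<Rightarrow> real) \<Rightarrow> real" where
  "L1_norm m u = (\<integral>x. \<bar>u x\<bar> \<partial>m)"

definition L1_nonneg :: "'a measure \<Rightarrow> ('a \<Rightarrow> real) \<Rightarrow> bool" where
  "L1_nonneg m u \<longleftrightarrow> integrable m u \<and> (AE x in m. 0 \<le> u x)"

definition L1_density :: "'a measure \<Rightarrow> ('a \<Rightarrow> real) \<Rightarrow> bool" where
  "L1_density m u \<longleftrightarrow> L1_nonneg m u \<and> L1_norm m u = 1"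

definition stochastic_operator :: "'a measure \<Rightarrow> (('a \<Rightarrow> real) \<Rightarrow> ('a \<Rightarrow> real)) \<Rightarrow> bool" where
  "stochastic_operator m T \<longleftrightarrow>
     L1_operator m T \<and> (\<forall>u. L1_density m u \<longrightarrow> L1_density m (T u))"

definition positive_contraction :: "'a measure \<Rightarrow> (('a \<Rightarrow> real) \<Rightarrow> ('a \<Rightarrow> real)) \<Rightarrow> bool" where
  "positive_contraction m T \<longleftrightarrow>
     L1_operator m T \<and>
     (\<forall>u. L1_nonneg m u \<longrightarrow> L1_nonneg m (T u)) \<and>
     (\<forall>u. integrable m u \<longrightarrow> L1_norm m (T u) \<le> L1_norm m u)"

definition transition_operator ::
    "'a measure \<Rightarrow> ('a \<Rightarrow> 'a measure) \<Rightarrow> (('a \<Rightarrow> real) \<Rightarrow> ('a \<Rightarrow> real)) \<Rightarrow> bool" where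
  "transition_operator m N T \<longleftrightarrow>
     (\<forall>B\<in>sets m. \<forall>u. L1_density m u \<longrightarrow>
        (\<integral>x. measure (N x) B * u x \<partial>m) = (LINT x:B|m. T u x))"

definition strongly_continuous_semigroup ::
    "'a measure \<Rightarrow> (real \<Rightarrow> ('a \<Rightarrow> real) \<Rightarrow> ('a \<Rightarrow> real)) \<Rightarrow> bool" where
  "strongly_continuous_semigroup m S \<longleftrightarrow>
     (\<forall>u. integrable m u \<longrightarrow> (AE x in m. S 0 u x = u x)) \<and>
     (\<forall>s\<ge>0. \<forall>t\<ge>0. \<forall>u. integrable m u \<longrightarrow> (AE x in m. S (s + t) u x = S s (S t u) x)) \<and>
     (\<forall>u. integrable m u \<longrightarrow> ((\<lambda>t. L1_norm m (\<lambda>x. S t u x - u x)) \<longlongrightarrow> 0) (at_right 0))"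

definition substochastic_semigroup ::
    "'a measure \<Rightarrow> (real \<Rightarrow> ('a \<Rightarrow> real) \<Rightarrow> ('a \<Rightarrow> real)) \<Rightarrow> bool" where
  "substochastic_semigroup m S \<longleftrightarrow>
     strongly_continuous_semigroup m S \<and> (\<forall>t\<ge>0. positive_contraction m (S t))"

definition stochastic_semigroup ::
    "'a measure \<Rightarrow> (real \<Rightarrow> ('a \<Rightarrow> real) \<Rightarrow> ('a \<Rightarrow> real)) \<Rightarrow> bool" where
  "stochastic_semigroup m S \<longleftrightarrow>
     strongly_continuous_semigroup m S \<and> (\<forall>t\<ge>0. stochastic_operator m (S t))"

text \<open>The generator, as a graph: its domain is \<^term>\<open>Domain (generator m S)\<close>, and the second component
  is determined by the first almost everywhere.\<close>

definition generator ::
    "'a measure \<Rightarrow> (real \<Rightarrow> ('a \<Rightarrow> real) \<Rightarrow> ('a \<Rightarrow> real)) \<Rightarrow> (('a \<Rightarrow> real) \<times> ('a \<Rightarrow> real)) set" where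
  "generator m S =
     {(u, v). integrable m u \<and> integrable m v \<and>
        ((\<lambda>t. L1_norm m (\<lambda>x. (S t u x - u x) / t - v x)) \<longlongrightarrow> 0) (at_right 0)}"

definition L1_weighted :: "'a measure \<Rightarrow> ('a \<Rightarrow> real) \<Rightarrow> ('a \<Rightarrow> real) set" where
  "L1_weighted m \<phi> = {u. integrable m u \<and> integrable m (\<lambda>x. \<phi> x * \<bar>u x\<bar>)}"

text \<open>\<open>S\<close> is the semigroup of the flow \<open>\<pi>\<close> killed at rate \<open>\<phi>\<close>.\<close>

definition killed_flow_semigroup ::
    "'a measure \<Rightarrow> (real \<Rightarrow> 'a \<Rightarrow> 'a) \<Rightarrow> ('a \<Rightarrow> real) \<Rightarrow> (real \<Rightarrow> ('a \<Rightarrow> real) \<Rightarrow> ('a \<Rightarrow> real)) \<Rightarrow> bool" where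
  "killed_flow_semigroup m \<pi> \<phi> S \<longleftrightarrow>
     substochastic_semigroup m S \<and>
     Domain (generator m S) \<subseteq> L1_weighted m \<phi> \<and>
     (\<forall>(u, v)\<in>generator m S. L1_nonneg m u \<longrightarrow> (\<integral>x. v x \<partial>m) = - (\<integral>x. \<phi> x * u x \<partial>m)) \<and>
     (\<forall>t\<ge>0. \<forall>u. L1_nonneg m u \<longrightarrow> (\<forall>B\<in>sets m.
        (\<integral>x. exp (- cumulative_rate \<pi> \<phi> x t) * indicator B (\<pi> t x) * u x \<partial>m) = (LINT x:B|m. S t u x)))"

definition generator_extends_perturbation ::
    "'a measure \<Rightarrow> ('a \<Rightarrow> real) \<Rightarrow> (('a \<Rightarrow> real) \<Rightarrow> ('a \<Rightarrow> real)) \<Rightarrow>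
     (real \<Rightarrow> ('a \<Rightarrow> real) \<Rightarrow> ('a \<Rightarrow> real)) \<Rightarrow> (real \<Rightarrow> ('a \<Rightarrow> real) \<Rightarrow> ('a \<Rightarrow> real)) \<Rightarrow> bool" where
  "generator_extends_perturbation m \<phi> P S T \<longleftrightarrow>
     (\<forall>(u, v)\<in>generator m S. (u, \<lambda>x. v x + P (\<lambda>y. \<phi> y * u y) x) \<in> generator m T)"

definition minimal_semigroup ::
    "'a measure \<Rightarrow> ('a \<Rightarrow> real) \<Rightarrow> (('a \<Rightarrow> real) \<Rightarrow> ('a \<Rightarrow> real)) \<Rightarrow>
     (real \<Rightarrow> ('a \<Rightarrow> real) \<Rightarrow> ('a \<Rightarrow> real)) \<Rightarrow> (real \<Rightarrow> ('a \<Rightarrow> real) \<Rightarrow> ('a \<Rightarrow> real)) \<Rightarrow> bool" where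
  "minimal_semigroup m \<phi> P S T \<longleftrightarrow>
     substochastic_semigroup m T \<and> generator_extends_perturbation m \<phi> P S T \<and>
     (\<forall>T'. substochastic_semigroup m T' \<and> generator_extends_perturbation m \<phi> P S T' \<longrightarrow>
        (\<forall>t\<ge>0. \<forall>u. L1_nonneg m u \<longrightarrow> (AE x in m. T t u x \<le> T' t u x)))"

text \<open>A variable with values in \<open>E\<close> and the cemetery state has a density with respect to \<open>m\<close>; since a
  density has norm 1, the cemetery state then has probability 0.\<close>

definition has_density ::
    "'w measure \<Rightarrow> 'a measure \<Rightarrow> ('w \<Rightarrow> 'a option) \<Rightarrow> ('a \<Rightarrow> real) \<Rightarrow> bool" where
  "has_density M m Y u \<longleftrightarrow>
     L1_density m u \<and>
     (\<forall>B\<in>sets m. {\<omega>\<in>space M. Y \<omega> \<in> Some ` B} \<in> sets M \<and>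
        measure M {\<omega>\<in>space M. Y \<omega> \<in> Some ` B} = (LINT x:B|m. u x))"

end

theory Submission
  imports Defs
begin

text \<open>The idea is to describe the process by the operators \<open>V(t)\<close> that act on functions
  by \<open>V(t) f(x) = \<bbbE>\<^sub>x f(X(t))\<close>, with \<open>f = 0\<close> at the
  cemetery, and to show that the minimal semigroup is the pre-adjoint of \<open>V\<close>, that is,
  \<open>\<integral> f P(t)u dm = \<integral> (V(t) f) u dm\<close>. Both claims then
  follow. The mass of \<open>P(t)u\<close> is \<open>\<integral> (V(t) 1) u dm\<close> and
  \<open>V(t) 1(x)\<close> is the probability that the process started at \<open>x\<close> has not
  exploded by time \<open>t\<close>; so mass is preserved for all \<open>u\<close> and
  \<open>t\<close> exactly when explosion has probability zero from almost every \<open>x\<close>.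
  And integrating \<open>V(t) 1\<^sub>B\<close> against the law \<open>u\<^sub>0 m\<close> of the
  starting point gives the law of \<open>X(t)\<close>.

  The operator \<open>V(t)\<close> is the sum over \<open>n\<close> of the contributions of the
  paths with exactly \<open>n\<close> jumps up to time \<open>t\<close>. These satisfy a recursion
  over the first jump, which is the dual of the Dyson-Phillips series: with \<open>U\<close> the
  flow killed at rate \<open>\<phi>\<close>, the next term is
  \<open>\<integral> U(r) \<phi> J (previous term at t - r) dr\<close>. From the recursion
  one reads off that \<open>V\<close> is a sub-Markov semigroup (\<open>transition_le_1\<close>,
  \<open>transition_add\<close>). That it is the law of the process (\<open>after_jumps_law\<close>)
  is proved by following the Markov chain of jump times and post-jump states forward in time. Since
  the killed flow and \<open>J\<close> come from operators on \<open>L\<^sup>1\<close>, every term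
  maps null functions to null functions, so Radon-Nikodym provides a pre-adjoint semigroup
  \<open>T\<close> on \<open>L\<^sup>1\<close>.

  It remains to see that \<open>T\<close> is the minimal semigroup. Generators are handled through
  scalar Laplace transforms: a pair \<open>(u, v)\<close> of integrable functions belongs to the
  generator of a substochastic semigroup \<open>Z\<close> if and only if
  \<open>\<integral>\<^sub>0\<^sup>\<infinity> e\<^sup>-\<^sup>t \<langle>f, Z(t)(u - v)\<rangle> dt
  = \<langle>f, u\<rangle>\<close> for all weights \<open>0 \<le> f \<le> 1\<close>
  (\<open>generator_imp_resolvent\<close> and, when \<open>Z\<close> has an adjoint,
  \<open>resolvent_imp_generator\<close>). Let \<open>R\<close> and \<open>G\<close> be the Laplace
  transforms at \<open>1\<close> of \<open>U\<close> and \<open>V\<close>. Then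
  \<open>G f = R f + R (\<phi> J G f)\<close>, and this equation says that the generator
  of \<open>T\<close> extends \<open>A + P \<phi>\<close>; by minimality
  \<open>P(t) \<le> T(t)\<close>. Conversely, if the generator of some substochastic semigroup
  \<open>Z\<close> extends \<open>A + P \<phi>\<close>, then iterating the resolvent identity of
  \<open>Z\<close> shows that the Laplace transform of
  \<open>t \<mapsto> \<parallel>Z(t)g\<parallel>\<close>, \<open>g \<ge> 0\<close>, dominates
  every partial sum of the series for \<open>\<integral> (G 1) g dm\<close>, which is the
  Laplace transform of \<open>t \<mapsto> \<parallel>T(t)g\<parallel>\<close>
  (\<open>mass_lower_bound\<close>). For the minimal semigroup the two norms are ordered and
  continuous in \<open>t\<close>, hence equal, and therefore \<open>P(t)g = T(t)g\<close>
  (\<open>minimal_semigroup_eq\<close>).\<close>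

section \<open>Testing integrable functions against measurable weights in the unit interval\<close>

text \<open>Weights with values in \<open>[0,1]\<close>, rather than all bounded functions, serve as
  tests: sub-Markov operators preserve them, and they still determine an integrable function and
  control its norm.\<close>

definition unit_test :: "'a measure \<Rightarrow> ('a \<Rightarrow> real) \<Rightarrow> bool" where
  "unit_test m f \<longleftrightarrow> f \<in> borel_measurable m \<and> (\<forall>x. 0 \<le> f x \<and> f x \<le> 1)"

lemma unit_test_indicator: "B \<in> sets m \<Longrightarrow> unit_test m (indicator B)"
  by (auto simp: unit_test_def indicator_def)

lemma unit_test_one: "unit_test m (\<lambda>_. 1)"
  by (simp add: unit_test_def)

lemma unit_test_mult_bound: "unit_test m f \<Longrightarrow> \<bar>f x * (u::real)\<bar> \<le> \<bar>u\<bar>"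
  unfolding unit_test_def abs_mult by (simp add: mult_left_le_one_le)

lemma unit_test_integrable:
  assumes "unit_test m f" "integrable m u"
  shows "integrable m (\<lambda>x. f x * u x)"
proof (rule Bochner_Integration.integrable_bound[OF assms(2)])
  show "(\<lambda>x. f x * u x) \<in> borel_measurable m"
    using assms by (auto simp: unit_test_def)
  show "AE x in m. norm (f x * u x) \<le> norm (u x)"
    using unit_test_mult_bound[OF assms(1)] by simp
qed

lemma unit_test_integral_bound:
  assumes "unit_test m f" "integrable m u"
  shows "\<bar>\<integral>x. f x * u x \<partial>m\<bar> \<le> L1_norm m u"
proof -
  have "\<bar>\<integral>x. f x * u x \<partial>m\<bar> \<le> (\<integral>x. \<bar>f x * u x\<bar> \<partial>m)"
    by (rule integral_abs_bound)
  also have "\<dots> \<le> L1_norm m u"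
    unfolding L1_norm_def using assms unit_test_mult_bound[OF assms(1)]
    by (intro integral_mono unit_test_integrable integrable_abs)
  finally show ?thesis .
qed

lemma L1_norm_nonneg: "0 \<le> L1_norm m u"
  by (simp add: L1_norm_def)

lemma L1_norm_cong_AE:
  assumes "integrable m u" "integrable m v" "AE x in m. u x = v x"
  shows "L1_norm m u = L1_norm m v"
  unfolding L1_norm_def using assms by (intro integral_cong_AE) auto

text \<open>Test against the indicators of the sets where \<open>z\<close> is positive and where it is
  negative.\<close>

lemma L1_norm_le_by_tests:
  assumes z: "integrable m z" and C: "\<And>f. unit_test m f \<Longrightarrow> \<bar>\<integral>x. f x * z x \<partial>m\<bar> \<le> C"
  shows "L1_norm m z \<le> 2 * C"
proof -
  let ?p = "indicator {x\<in>space m. 0 < z x} :: 'a \<Rightarrow> real"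
  let ?n = "indicator {x\<in>space m. z x < 0} :: 'a \<Rightarrow> real"
  have [measurable]: "z \<in> borel_measurable m" using z by auto
  have t: "unit_test m ?p" "unit_test m ?n"
    by (auto intro!: unit_test_indicator)
  have "L1_norm m z = (\<integral>x. ?p x * z x - ?n x * z x \<partial>m)"
    unfolding L1_norm_def by (intro Bochner_Integration.integral_cong) (auto simp: indicator_def)
  also have "\<dots> = (\<integral>x. ?p x * z x \<partial>m) - (\<integral>x. ?n x * z x \<partial>m)"
    using t z by (intro Bochner_Integration.integral_diff unit_test_integrable)
  also have "\<dots> \<le> C + C"
    using C[OF t(1)] C[OF t(2)] by linarith
  finally show ?thesis by simp
qed

lemma L1_norm_nonneg_eq: "L1_nonneg m u \<Longrightarrow> L1_norm m u = (\<integral>x. u x \<partial>m)"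
  unfolding L1_norm_def L1_nonneg_def by (intro integral_cong_AE) auto

lemma AE_eq_by_tests:
  assumes "integrable m u" "integrable m v"
    and "\<And>f. unit_test m f \<Longrightarrow> (\<integral>x. f x * u x \<partial>m) = (\<integral>x. f x * v x \<partial>m)"
  shows "AE x in m. u x = v x"
  using assms(1,2) by (rule density_unique_real)
    (use assms(3)[OF unit_test_indicator] in \<open>simp add: set_lebesgue_integral_def\<close>)

lemma L1_norm_triangle:
  assumes "integrable m u" "integrable m v"
  shows "L1_norm m (\<lambda>x. u x + v x) \<le> L1_norm m u + L1_norm m v"
proof -
  have "L1_norm m (\<lambda>x. u x + v x) \<le> (\<integral>x. \<bar>u x\<bar> + \<bar>v x\<bar> \<partial>m)"
    unfolding L1_norm_def using assms by (intro integral_mono) auto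
  then show ?thesis using assms by (simp add: L1_norm_def)
qed

section \<open>Damped integrals of bounded continuous functions on the half-line\<close>

text \<open>For \<open>I = {0..}\<close> this is the Laplace transform at \<open>1\<close>. One point
  suffices: the transform at \<open>1\<close> characterises generators, and orbits are compared only
  when one lies below the other. Initial pieces \<open>I = {0..h}\<close> occur in difference
  quotients.\<close>

definition damped_integral :: "real set \<Rightarrow> (real \<Rightarrow> real) \<Rightarrow> real" where
  "damped_integral I c = (LINT t:I|lborel. exp (- t) * c t)"

lemma exp_tail: "(\<integral>\<^sup>+q. ennreal (exp (- q)) * indicator {a<..} q \<partial>lborel) = ennreal (exp (- a))"
proof -
  have "(\<integral>\<^sup>+q. ennreal (exp (- q)) * indicator {a<..} q \<partial>lborel)
      = (\<integral>\<^sup>+q. ennreal (exp (- q)) * indicator {a..} q \<partial>lborel)"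
    using AE_lborel_singleton[of a]
    by (intro nn_integral_cong_AE) (auto elim!: eventually_mono simp: indicator_def)
  also have "\<dots> = ennreal (0 - (- exp (- a)))"
  proof (rule nn_integral_FTC_atLeast)
    show "((\<lambda>x::real. - exp (- x)) \<longlongrightarrow> 0) at_top" by real_asymp
  qed (auto intro!: derivative_eq_intros)
  finally show ?thesis by simp
qed

lemma exp_tail_mean: "(\<integral>\<^sup>+q. ennreal (exp (- q)) * ennreal (q - a) \<partial>lborel) = ennreal (exp (- a))"
proof -
  have "(\<integral>\<^sup>+q. ennreal (exp (- q)) * ennreal (q - a) \<partial>lborel)
      = (\<integral>\<^sup>+q. ennreal (exp (- q) * (q - a)) * indicator {a..} q \<partial>lborel)"
    by (intro nn_integral_cong) (auto simp: indicator_def ennreal_mult ennreal_neg)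
  also have "\<dots> = ennreal (0 - (- (a - a + 1) * exp (- a)))"
  proof (rule nn_integral_FTC_atLeast[where F="\<lambda>q. - (q - a + 1) * exp (- q)"])
    show "((\<lambda>q. - (q - a + 1) * exp (- q)) \<longlongrightarrow> 0) at_top" by real_asymp
    show "DERIV (\<lambda>q. - (q - a + 1) * exp (- q)) x :> exp (- x) * (x - a)" for x
      by (auto intro!: derivative_eq_intros simp: algebra_simps)
  qed auto
  finally show ?thesis by simp
qed

lemma exp_neg_nn_integral: "(\<integral>\<^sup>+t. ennreal (exp (- t)) * indicator {0::real..} t \<partial>lborel) = 1"
proof -
  have "(\<integral>\<^sup>+t. ennreal (exp (- t)) * indicator {0::real..} t \<partial>lborel)
      = (\<integral>\<^sup>+t. ennreal (exp (- t)) * indicator {0::real<..} t \<partial>lborel)"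
    using AE_lborel_singleton[of "0::real"]
    by (intro nn_integral_cong_AE) (auto elim!: eventually_mono simp: indicator_def)
  then show ?thesis using exp_tail[of 0] by simp
qed

lemma exp_neg_integrable: "set_integrable lborel {0::real..} (\<lambda>t. exp (- t))"
  and exp_neg_integral: "(LINT t:{0::real..}|lborel. exp (- t)) = 1"
proof -
  have "(\<integral>\<^sup>+t. ennreal (indicator {0..} t *\<^sub>R exp (- t)) \<partial>lborel)
      = (\<integral>\<^sup>+t. ennreal (exp (- t)) * indicator {0::real..} t \<partial>lborel)"
    by (intro nn_integral_cong) (auto simp: indicator_def)
  then have n: "(\<integral>\<^sup>+t. ennreal (indicator {0..} t *\<^sub>R exp (- t)) \<partial>lborel) = ennreal 1"
    by (simp only: exp_neg_nn_integral ennreal_1)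
  show "set_integrable lborel {0::real..} (\<lambda>t. exp (- t))"
    unfolding set_integrable_def
    by (rule integrableI_nn_integral_finite[OF _ _ n]) auto
  show "(LINT t:{0::real..}|lborel. exp (- t)) = 1"
    unfolding set_lebesgue_integral_def
    using n by (subst integral_eq_nn_integral) auto
qed

lemma damped_integrable:
  fixes c :: "real \<Rightarrow> real"
  assumes c: "continuous_on {0..} c" and b: "\<And>t. 0 \<le> t \<Longrightarrow> \<bar>c t\<bar> \<le> B"
    and I: "I \<subseteq> {0..}" "I \<in> sets borel"
  shows "set_integrable lborel I (\<lambda>t. exp (- t) * c t)"
proof -
  have m: "set_borel_measurable borel {0..} (\<lambda>t. exp (- t) * c t)"
    unfolding set_borel_measurable_def
    using c by (intro borel_measurable_continuous_on_indicator continuous_on_mult)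
      (auto intro!: continuous_intros)
  have "set_integrable lborel {0..} (\<lambda>t. exp (- t) * c t)"
  proof (rule set_integrable_bound)
    show "set_integrable lborel {0..} (\<lambda>t. B * exp (- t))"
      by (intro set_integrable_mult_right exp_neg_integrable)
    show "set_borel_measurable lborel {0..} (\<lambda>t. exp (- t) * c t)"
      using m by (simp add: set_borel_measurable_def)
    show "AE x in lborel. x \<in> {0..} \<longrightarrow> norm (exp (- x) * c x) \<le> norm (B * exp (- x))"
      using b by (intro AE_I2) (force simp: abs_mult mult.commute)
  qed
  then show ?thesis
    by (rule set_integrable_subset) (use I in auto)
qed

lemma damped_integral_bound:
  assumes c: "continuous_on {0..} c" and b: "\<And>t. 0 \<le> t \<Longrightarrow> \<bar>c t\<bar> \<le> B"
  shows "\<bar>damped_integral {0..} c\<bar> \<le> B"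
proof -
  have "\<bar>damped_integral {0..} c\<bar> \<le> (LINT t:{0..}|lborel. B * exp (- t))"
    unfolding damped_integral_def set_lebesgue_integral_def
  proof (rule order_trans[OF integral_abs_bound integral_mono])
    show "integrable lborel (\<lambda>x. \<bar>indicat_real {0..} x *\<^sub>R (exp (- x) * c x)\<bar>)"
      using damped_integrable[OF c b, of "{0..}"] unfolding set_integrable_def
      by (intro integrable_abs) auto
    show "integrable lborel (\<lambda>x. indicat_real {0..} x *\<^sub>R (B * exp (- x)))"
      using set_integrable_mult_right[OF exp_neg_integrable, of B] by (simp add: set_integrable_def)
    show "\<bar>indicat_real {0..} x *\<^sub>R (exp (- x) * c x)\<bar> \<le> indicat_real {0..} x *\<^sub>R (B * exp (- x))" for x
      using b[of x] by (simp add: indicator_def abs_mult)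
  qed
  also have "\<dots> = B" using exp_neg_integral by simp
  finally show ?thesis .
qed

text \<open>This relation between the transform of a function and that of its translate is what turns
  difference quotients of a semigroup into resolvent identities.\<close>

lemma damped_integral_shift:
  assumes c: "continuous_on {0..} c" and b: "\<And>t. 0 \<le> t \<Longrightarrow> \<bar>c t\<bar> \<le> B" and h: "0 < h"
  shows "damped_integral {0..} (\<lambda>t. c (t + h)) =
    exp h * (damped_integral {0..} c - damped_integral {0..h} c)"
proof -
  have split: "damped_integral {0..} c = damped_integral {0..h} c + damped_integral {h<..} c"
  proof -
    have "{0..} = {0..h} \<union> {h<..}" using h by auto
    then show ?thesis unfolding damped_integral_def
      using h damped_integrable[OF c b, of "{0..h}"] damped_integrable[OF c b, of "{h<..}"]
      by (simp only:) (rule set_integral_Un, auto)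
  qed
  have "damped_integral {h<..} c = (LINT t:{h..}|lborel. exp (- t) * c t)"
    unfolding damped_integral_def set_lebesgue_integral_def
  proof (rule integral_cong_AE)
    show "(\<lambda>x. indicat_real {h<..} x *\<^sub>R (exp (- x) * c x)) \<in> borel_measurable lborel"
      using damped_integrable[OF c b, of "{h<..}"] h
      by (intro borel_measurable_integrable) (auto simp: set_integrable_def subset_eq)
    show "(\<lambda>x. indicat_real {h..} x *\<^sub>R (exp (- x) * c x)) \<in> borel_measurable lborel"
      using damped_integrable[OF c b, of "{h..}"] h
      by (intro borel_measurable_integrable) (auto simp: set_integrable_def subset_eq)
    show "AE x in lborel. indicat_real {h<..} x *\<^sub>R (exp (- x) * c x)
        = indicat_real {h..} x *\<^sub>R (exp (- x) * c x)"
      using AE_lborel_singleton[of h] by eventually_elim (auto simp: indicator_def)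
  qed
  also have "\<dots> = (\<integral>t. indicator {h..} (h + 1 * t) *\<^sub>R (exp (- (h + 1 * t)) * c (h + 1 * t)) \<partial>lborel)"
    unfolding set_lebesgue_integral_def by (subst lborel_integral_real_affine[of 1 _ h]) auto
  also have "\<dots> = (\<integral>t. exp (- h) * (indicator {0..} t *\<^sub>R (exp (- t) * c (t + h))) \<partial>lborel)"
    by (intro Bochner_Integration.integral_cong)
      (auto simp: indicator_def exp_add[symmetric] add.commute)
  also have "\<dots> = exp (- h) * damped_integral {0..} (\<lambda>t. c (t + h))"
    by (simp add: damped_integral_def set_lebesgue_integral_def)
  finally show ?thesis
    using split by (simp add: exp_minus field_simps)
qed

text \<open>An estimate with an explicit error, because it is later used uniformly over all tests.\<close>

lemma damped_integral_near_zero: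
  assumes c: "continuous_on {0..} c" and b: "\<And>t. 0 \<le> t \<Longrightarrow> \<bar>c t\<bar> \<le> B"
    and h: "0 < h" and d: "\<And>t. 0 \<le> t \<Longrightarrow> t \<le> h \<Longrightarrow> \<bar>c t - c 0\<bar> \<le> \<delta>"
  shows "\<bar>damped_integral {0..h} c - c 0 * (1 - exp (- h))\<bar> \<le> h * \<delta>"
proof -
  have e: "(LINT t:{0..h}|lborel. c 0 * exp (- t)) = c 0 * (1 - exp (- h))"
  proof -
    have "(LINT t:{0..h}|lborel. exp (- t)) = (- exp (- h)) - (- exp (- 0))"
      unfolding set_lebesgue_integral_def real_scaleR_def mult.commute[of "indicator _ _"]
      using h by (intro integral_FTC_Icc_real) (auto intro!: derivative_eq_intros)
    then show ?thesis by simp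
  qed
  have i1: "set_integrable lborel {0..h} (\<lambda>t. exp (- t) * c t)"
    using damped_integrable[OF c b, of "{0..h}"] by auto
  have i2: "set_integrable lborel {0..h} (\<lambda>t. c 0 * exp (- t))"
    by (rule set_integrable_mult_right, rule set_integrable_subset[OF exp_neg_integrable]) auto
  have "\<bar>damped_integral {0..h} c - c 0 * (1 - exp (- h))\<bar>
      = \<bar>LINT t:{0..h}|lborel. exp (- t) * c t - c 0 * exp (- t)\<bar>"
    unfolding e[symmetric] damped_integral_def using i1 i2 by (simp add: set_integral_diff)
  also have "\<dots> \<le> (LINT t:{0..h}|lborel. \<delta>)"
    unfolding set_lebesgue_integral_def
  proof (rule order_trans[OF integral_abs_bound integral_mono])
    show "integrable lborel (\<lambda>x. \<bar>indicat_real {0..h} x *\<^sub>R (exp (- x) * c x - c 0 * exp (- x))\<bar>)"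
      using set_integral_diff(1)[OF i1 i2] unfolding set_integrable_def by (rule integrable_abs)
    show "integrable lborel (\<lambda>x. indicat_real {0..h} x *\<^sub>R \<delta>)"
      by (simp add: integrable_real_indicator emeasure_lborel_Icc_eq)
    fix x
    show "\<bar>indicat_real {0..h} x *\<^sub>R (exp (- x) * c x - c 0 * exp (- x))\<bar> \<le> indicat_real {0..h} x *\<^sub>R \<delta>"
    proof (cases "x \<in> {0..h}")
      case True
      have "\<bar>exp (- x) * c x - c 0 * exp (- x)\<bar> = exp (- x) * \<bar>c x - c 0\<bar>"
        unfolding mult.commute[of "c 0"] right_diff_distrib[symmetric] abs_mult by simp
      also have "\<dots> \<le> 1 * \<delta>" using True d[of x] by (intro mult_mono) auto
      finally show ?thesis using True by simp
    qed simp
  qed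
  also have "\<dots> = h * \<delta>" using h by (simp add: set_lebesgue_integral_def)
  finally show ?thesis .
qed

lemma damped_integral_average:
  assumes c: "continuous_on {0..} c" and b: "\<And>t. 0 \<le> t \<Longrightarrow> \<bar>c t\<bar> \<le> B"
  shows "((\<lambda>h. damped_integral {0..h} c / h) \<longlongrightarrow> c 0) (at_right 0)"
proof -
  have "((\<lambda>h. damped_integral {0..h} c / h - c 0 * ((1 - exp (- h)) / h)) \<longlongrightarrow> 0) (at_right 0)"
  proof (rule tendstoI)
    fix e :: real assume e: "0 < e"
    obtain d where d: "0 < d" "\<And>t. 0 \<le> t \<Longrightarrow> dist t 0 < d \<Longrightarrow> dist (c t) (c 0) < e / 2"
      using c e unfolding continuous_on_iff by (force dest: bspec[of _ _ 0] spec[of _ "e/2"])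
    have "\<forall>\<^sub>F h in at_right 0. 0 < h \<and> h < d"
      using d(1) by (auto simp: eventually_at_right_field)
    then show "\<forall>\<^sub>F h in at_right 0.
        dist (damped_integral {0..h} c / h - c 0 * ((1 - exp (- h)) / h)) 0 < e"
    proof eventually_elim
      case (elim h)
      have "\<bar>damped_integral {0..h} c - c 0 * (1 - exp (- h))\<bar> \<le> h * (e / 2)"
        using elim d(2) by (intro damped_integral_near_zero[OF c b]) (force simp: dist_real_def)+
      moreover have "damped_integral {0..h} c / h - c 0 * ((1 - exp (- h)) / h)
          = (damped_integral {0..h} c - c 0 * (1 - exp (- h))) / h"
        unfolding times_divide_eq_right by (rule diff_divide_distrib[symmetric])
      ultimately have "\<bar>damped_integral {0..h} c / h - c 0 * ((1 - exp (- h)) / h)\<bar> \<le> e / 2"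
        using elim by (simp add: abs_divide divide_simps mult.commute)
      then show ?case using e by (simp add: dist_real_def)
    qed
  qed
  moreover have "((\<lambda>h. c 0 * ((1 - exp (- h)) / h)) \<longlongrightarrow> c 0 * 1) (at_right 0)"
    by (intro tendsto_mult tendsto_const) real_asymp
  ultimately show ?thesis
    using tendsto_add by fastforce
qed

text \<open>A nonnegative continuous function with vanishing integral vanishes: positivity at one point
  would give a nondegenerate interval of positivity.\<close>

lemma damped_integral_eq_0:
  assumes c: "continuous_on {0..} c" and b: "\<And>t. 0 \<le> t \<Longrightarrow> \<bar>c t\<bar> \<le> B"
    and nn: "\<And>t. 0 \<le> t \<Longrightarrow> 0 \<le> c t" and le: "damped_integral {0..} c \<le> 0" and t: "0 \<le> t"
  shows "c t = 0"
proof (rule ccontr)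
  assume "c t \<noteq> 0"
  then have pos: "0 < c t" using nn[OF t] by simp
  then obtain d where d: "0 < d" "\<And>s. 0 \<le> s \<Longrightarrow> dist s t < d \<Longrightarrow> dist (c s) (c t) < c t"
    using c t unfolding continuous_on_iff by (metis atLeast_iff)
  let ?g = "\<lambda>s. indicator {0..} s *\<^sub>R (exp (- s) * c s)"
  have i: "integrable lborel ?g"
    using damped_integrable[OF c b, of "{0..}"] by (simp add: set_integrable_def)
  have g0: "0 \<le> ?g s" for s using nn[of s] by (simp add: indicator_def)
  have "integral\<^sup>L lborel ?g = 0"
    using le integral_nonneg_AE[of ?g lborel] g0
    by (intro antisym) (auto simp: damped_integral_def set_lebesgue_integral_def)
  then have "AE s in lborel. ?g s = 0"
    using integral_nonneg_eq_0_iff_AE[OF i] g0 by auto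
  then have "AE s in lborel. s \<notin> {t<..<t + d}"
  proof eventually_elim
    case (elim s)
    show ?case
    proof
      assume s: "s \<in> {t<..<t + d}"
      then have "dist (c s) (c t) < c t" using d(2)[of s] t by (simp add: dist_real_def)
      then have "0 < c s" by (simp add: dist_real_def)
      then show False using elim s t by (simp add: indicator_def)
    qed
  qed
  then have "{t<..<t + d} \<in> null_sets lborel"
    by (subst AE_iff_null_sets) auto
  then show False using d(1) by (auto simp: null_sets_def)
qed

section \<open>Generators and the resolvent at one\<close>

locale L1_semigroup =
  fixes m :: "'a measure" and Z :: "real \<Rightarrow> ('a \<Rightarrow> real) \<Rightarrow> ('a \<Rightarrow> real)"
  assumes substochastic: "substochastic_semigroup m Z"
begin

lemma op: "0 \<le> t \<Longrightarrow> L1_operator m (Z t)"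
  using substochastic by (simp add: substochastic_semigroup_def positive_contraction_def)

lemma integrable: "0 \<le> t \<Longrightarrow> integrable m u \<Longrightarrow> integrable m (Z t u)"
  using op by (auto simp: L1_operator_def)

lemma add_AE:
  "0 \<le> t \<Longrightarrow> integrable m u \<Longrightarrow> integrable m v \<Longrightarrow> AE x in m. Z t (\<lambda>y. u y + v y) x = Z t u x + Z t v x"
  using op by (auto simp: L1_operator_def)

lemma scale_AE: "0 \<le> t \<Longrightarrow> integrable m u \<Longrightarrow> AE x in m. Z t (\<lambda>y. c * u y) x = c * Z t u x"
  using op by (auto simp: L1_operator_def)

lemma diff_AE:
  assumes "0 \<le> t" "integrable m u" "integrable m v"
  shows "AE x in m. Z t (\<lambda>y. u y - v y) x = Z t u x - Z t v x"
  using add_AE[OF assms(1,2), of "\<lambda>y. - 1 * v y"] scale_AE[OF assms(1,3), of "-1"] assms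
  by auto

lemma contraction: "0 \<le> t \<Longrightarrow> integrable m u \<Longrightarrow> L1_norm m (Z t u) \<le> L1_norm m u"
  using substochastic by (simp add: substochastic_semigroup_def positive_contraction_def)

lemma nonneg: "0 \<le> t \<Longrightarrow> L1_nonneg m u \<Longrightarrow> L1_nonneg m (Z t u)"
  using substochastic by (simp add: substochastic_semigroup_def positive_contraction_def)

lemma start: "integrable m u \<Longrightarrow> AE x in m. Z 0 u x = u x"
  using substochastic by (simp add: substochastic_semigroup_def strongly_continuous_semigroup_def)

lemma semigroup:
  "0 \<le> s \<Longrightarrow> 0 \<le> t \<Longrightarrow> integrable m u \<Longrightarrow> AE x in m. Z (s + t) u x = Z s (Z t u) x"
  using substochastic by (simp add: substochastic_semigroup_def strongly_continuous_semigroup_def)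

lemma strong_continuity:
  "integrable m u \<Longrightarrow> ((\<lambda>t. L1_norm m (\<lambda>x. Z t u x - u x)) \<longlongrightarrow> 0) (at_right 0)"
  using substochastic by (simp add: substochastic_semigroup_def strongly_continuous_semigroup_def)

text \<open>Strong continuity at \<open>0\<close> propagates to every time, from the left as well as from
  the right, because the operators are contractions.\<close>

lemma increment_bound:
  assumes "0 \<le> s" "0 \<le> h" "integrable m u"
  shows "L1_norm m (\<lambda>x. Z (s + h) u x - Z s u x) \<le> L1_norm m (\<lambda>x. Z h u x - u x)"
proof -
  have i: "integrable m (\<lambda>x. Z h u x - u x)" using assms integrable by simp
  have "L1_norm m (\<lambda>x. Z (s + h) u x - Z s u x) = L1_norm m (Z s (\<lambda>x. Z h u x - u x))"
    using semigroup[OF assms] diff_AE[OF assms(1) integrable[OF assms(2,3)] assms(3)] assms i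
    by (intro L1_norm_cong_AE) (auto intro!: integrable)
  also have "\<dots> \<le> L1_norm m (\<lambda>x. Z h u x - u x)"
    using i assms by (intro contraction)
  finally show ?thesis .
qed

definition orbit :: "('a \<Rightarrow> real) \<Rightarrow> ('a \<Rightarrow> real) \<Rightarrow> real \<Rightarrow> real" where
  "orbit f u t = (\<integral>x. f x * Z t u x \<partial>m)"

lemma orbit_bound:
  "unit_test m f \<Longrightarrow> integrable m u \<Longrightarrow> 0 \<le> t \<Longrightarrow> \<bar>orbit f u t\<bar> \<le> L1_norm m u"
  unfolding orbit_def
  by (rule order_trans[OF unit_test_integral_bound contraction]) (auto intro: integrable)

lemma orbit_increment:
  assumes f: "unit_test m f" and u: "integrable m u" and t: "0 \<le> s" "0 \<le> h"
  shows "\<bar>orbit f u (s + h) - orbit f u s\<bar> \<le> L1_norm m (\<lambda>x. Z h u x - u x)"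
proof -
  have i: "integrable m (Z (s + h) u)" "integrable m (Z s u)" using t u integrable by auto
  have "orbit f u (s + h) - orbit f u s = (\<integral>x. f x * (Z (s + h) u x - Z s u x) \<partial>m)"
    unfolding orbit_def right_diff_distrib using i f
    by (simp add: Bochner_Integration.integral_diff unit_test_integrable)
  also have "\<bar>\<dots>\<bar> \<le> L1_norm m (\<lambda>x. Z (s + h) u x - Z s u x)"
    using f i by (intro unit_test_integral_bound) auto
  also have "\<dots> \<le> L1_norm m (\<lambda>x. Z h u x - u x)"
    using t u by (intro increment_bound)
  finally show ?thesis .
qed

lemma orbit_zero: "unit_test m f \<Longrightarrow> integrable m u \<Longrightarrow> orbit f u 0 = (\<integral>x. f x * u x \<partial>m)"
  unfolding orbit_def using start[of u]
  by (intro integral_cong_AE borel_measurable_integrable unit_test_integrable integrable) auto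

lemma orbit_continuous:
  assumes f: "unit_test m f" and u: "integrable m u"
  shows "continuous_on {0..} (orbit f u)"
  unfolding continuous_on_iff
proof (intro ballI allI impI)
  fix s e :: real assume s: "s \<in> {0..}" and e: "0 < e"
  obtain d where d: "0 < d" "\<And>h. 0 < h \<Longrightarrow> h < d \<Longrightarrow> L1_norm m (\<lambda>x. Z h u x - u x) < e"
    using order_tendstoD(2)[OF strong_continuity[OF u] e] by (auto simp: eventually_at_right_field)
  show "\<exists>d>0. \<forall>t\<in>{0..}. dist t s < d \<longrightarrow> dist (orbit f u t) (orbit f u s) < e"
  proof (intro exI conjI ballI impI)
    fix t :: real assume t: "t \<in> {0..}" "dist t s < d"
    consider "t = s" | "s < t" | "t < s" by linarith
    then show "dist (orbit f u t) (orbit f u s) < e"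
    proof cases
      case 2
      then show ?thesis
        using orbit_increment[OF f u, of s "t - s"] d(2)[of "t - s"] s t by (simp add: dist_real_def)
    next
      case 3
      then show ?thesis
        using orbit_increment[OF f u, of t "s - t"] d(2)[of "s - t"] s t
        by (simp add: dist_real_def abs_minus_commute)
    qed (use e in simp)
  qed fact
qed

lemma orbit_diff:
  assumes f: "unit_test m f" and u: "integrable m u" "integrable m v" and t: "0 \<le> t"
  shows "orbit f (\<lambda>x. u x - v x) t = orbit f u t - orbit f v t"
proof -
  have "orbit f (\<lambda>x. u x - v x) t = (\<integral>x. f x * Z t u x - f x * Z t v x \<partial>m)"
    unfolding orbit_def using diff_AE[OF t u] f u t integrable[OF t]
    by (intro integral_cong_AE) (auto simp: unit_test_def right_diff_distrib intro!: borel_measurable_times)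
  then show ?thesis
    unfolding orbit_def using f u t by (simp add: unit_test_integrable integrable)
qed

text \<open>Put the difference quotient of \<open>u\<close> under the Laplace integral. By contractivity
  the error against \<open>v\<close> is at most the \<open>L\<^sup>1\<close> distance of the
  quotient from \<open>v\<close>, which tends to zero. On the other hand the shift formula evaluates
  the transformed quotient, whose limit is the transform of
  \<open>\<langle>f, Z(t)u\<rangle>\<close> minus its initial value. No differentiability of the
  orbit in \<open>t\<close> has to be discussed.\<close>

lemma generator_imp_resolvent:
  assumes g: "(u, v) \<in> generator m Z" and f: "unit_test m f"
  shows "damped_integral {0..} (orbit f (\<lambda>x. u x - v x)) = (\<integral>x. f x * u x \<partial>m)"
proof -
  have u: "integrable m u" and v: "integrable m v"
    and lim: "((\<lambda>t. L1_norm m (\<lambda>x. (Z t u x - u x) / t - v x)) \<longlongrightarrow> 0) (at_right 0)"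
    using g by (auto simp: generator_def)
  let ?a = "orbit f u" and ?b = "orbit f v"
  note ca = orbit_continuous[OF f u] and cb = orbit_continuous[OF f v]
  note ba = orbit_bound[OF f u] and bb = orbit_bound[OF f v]
  let ?L = "\<lambda>h. (exp h * (damped_integral {0..} ?a - damped_integral {0..h} ?a)
      - damped_integral {0..} ?a) / h - damped_integral {0..} ?b"
  have bound: "\<bar>?L h\<bar> \<le> L1_norm m (\<lambda>x. (Z h u x - u x) / h - v x)" if h: "0 < h" for h
  proof -
    let ?z = "\<lambda>x. (Z h u x - u x) / h - v x"
    have iz: "integrable m ?z" using h u v integrable[of h u] by auto
    have cs: "continuous_on {0..} (\<lambda>t. ?a (t + h))"
      using h by (intro continuous_on_compose2[OF ca] continuous_intros) auto
    have eq: "(?a (t + h) - ?a t) / h - ?b t = orbit f ?z t" if t: "0 \<le> t" for t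
    proof -
      have zh: "integrable m (Z h u)" using u h integrable by simp
      have "orbit f ?z t = orbit f (\<lambda>x. (1/h) * (Z h u x - u x)) t - ?b t"
        using orbit_diff[OF f _ v t, of "\<lambda>x. (1/h) * (Z h u x - u x)"] zh u by simp
      also have "orbit f (\<lambda>x. (1/h) * (Z h u x - u x)) t = (1/h) * orbit f (\<lambda>x. Z h u x - u x) t"
      proof -
        have "orbit f (\<lambda>x. (1/h) * (Z h u x - u x)) t = (\<integral>x. (1/h) * (f x * Z t (\<lambda>x. Z h u x - u x) x) \<partial>m)"
          unfolding orbit_def
          using scale_AE[OF t, of "\<lambda>x. Z h u x - u x" "1/h"] f zh u t integrable[OF t]
          by (intro integral_cong_AE) (auto simp: unit_test_def)
        then show ?thesis by (simp add: orbit_def)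
      qed
      also have "orbit f (\<lambda>x. Z h u x - u x) t = orbit f (Z h u) t - ?a t"
        using orbit_diff[OF f zh u t] .
      also have "orbit f (Z h u) t = ?a (t + h)"
        unfolding orbit_def using semigroup[OF t _ u, of h] h f zh t u
        by (intro integral_cong_AE borel_measurable_integrable unit_test_integrable integrable) auto
      finally show ?thesis by simp
    qed
    have "damped_integral {0..} (orbit f ?z)
        = damped_integral {0..} (\<lambda>t. (?a (t + h) - ?a t) / h - ?b t)"
      unfolding damped_integral_def
      by (intro set_lebesgue_integral_cong) (auto simp: eq)
    also have "\<dots> = (damped_integral {0..} (\<lambda>t. ?a (t + h)) - damped_integral {0..} ?a) / h
        - damped_integral {0..} ?b"
    proof -
      have i: "set_integrable lborel {0..} (\<lambda>t. exp (- t) * ?a (t + h))"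
        "set_integrable lborel {0..} (\<lambda>t. exp (- t) * ?a t)"
        "set_integrable lborel {0..} (\<lambda>t. exp (- t) * ?b t)"
        using damped_integrable[OF cs, of "L1_norm m u" "{0..}"]
          damped_integrable[OF ca ba, of "{0..}"] damped_integrable[OF cb bb, of "{0..}"] ba h by auto
      have "damped_integral {0..} (\<lambda>t. (?a (t + h) - ?a t) / h - ?b t)
          = (LINT t:{0..}|lborel. (exp (- t) * ?a (t + h) - exp (- t) * ?a t) / h - exp (- t) * ?b t)"
        unfolding damped_integral_def by (simp add: algebra_simps diff_divide_distrib)
      then show ?thesis
        unfolding damped_integral_def using i
        by (simp add: set_integral_diff)
    qed
    also have "\<dots> = ?L h"
      using damped_integral_shift[OF ca ba h] by simp
    finally have "\<bar>?L h\<bar> = \<bar>damped_integral {0..} (orbit f ?z)\<bar>" by simp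
    also have "\<dots> \<le> L1_norm m ?z"
      by (rule damped_integral_bound[OF orbit_continuous[OF f iz] orbit_bound[OF f iz]])
    finally show ?thesis .
  qed
  have "(?L \<longlongrightarrow> 0) (at_right 0)"
  proof (rule Lim_null_comparison[OF _ lim])
    show "\<forall>\<^sub>F h in at_right 0. norm (?L h) \<le> L1_norm m (\<lambda>x. (Z h u x - u x) / h - v x)"
      using bound by (auto simp: eventually_at_right_field intro!: exI[of _ 1])
  qed
  moreover have "(?L \<longlongrightarrow> damped_integral {0..} ?a - ?a 0 - damped_integral {0..} ?b) (at_right 0)"
  proof -
    let ?A = "damped_integral {0..} ?a"
    have "((\<lambda>h. ?A * ((exp h - 1) / h) - exp h * (damped_integral {0..h} ?a / h)
        - damped_integral {0..} ?b)
        \<longlongrightarrow> ?A * 1 - 1 * ?a 0 - damped_integral {0..} ?b) (at_right 0)"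
    proof (intro tendsto_intros damped_integral_average[OF ca ba])
      show "((\<lambda>h::real. (exp h - 1) / h) \<longlongrightarrow> 1) (at_right 0)" by real_asymp
      show "((\<lambda>h::real. exp h) \<longlongrightarrow> 1) (at_right 0)" by real_asymp
    qed
    moreover have "?L = (\<lambda>h. ?A * ((exp h - 1) / h) - exp h * (damped_integral {0..h} ?a / h)
        - damped_integral {0..} ?b)"
      by (rule ext) (simp add: algebra_simps diff_divide_distrib add_divide_distrib)
    ultimately show ?thesis by simp
  qed
  ultimately have "damped_integral {0..} ?a - ?a 0 - damped_integral {0..} ?b = 0"
    using tendsto_unique trivial_limit_at_right_real by blast
  moreover have "damped_integral {0..} (orbit f (\<lambda>x. u x - v x))
      = damped_integral {0..} ?a - damped_integral {0..} ?b"
  proof -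
    have "damped_integral {0..} (orbit f (\<lambda>x. u x - v x))
        = (LINT t:{0..}|lborel. exp (- t) * ?a t - exp (- t) * ?b t)"
      unfolding damped_integral_def
      by (intro set_lebesgue_integral_cong) (auto simp: orbit_diff[OF f u v] algebra_simps)
    then show ?thesis
      unfolding damped_integral_def
      using damped_integrable[OF ca ba, of "{0..}"] damped_integrable[OF cb bb, of "{0..}"]
      by (simp add: set_integral_diff)
  qed
  ultimately show ?thesis
    using orbit_zero[OF f u] by simp
qed

text \<open>The hypothesis says in weak form that \<open>u\<close> is the resolvent at \<open>1\<close> of
  \<open>g\<close>. With an adjoint of \<open>Z(h)\<close> the identity can be applied to the
  adjoint image of \<open>f\<close>, which expresses \<open>\<langle>f, Z(h)u\<rangle>\<close>
  through the orbit of \<open>g\<close> on \<open>[0,h]\<close>. The resulting bound on the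
  difference quotient is uniform in \<open>f\<close> and so becomes a bound in norm.\<close>

lemma resolvent_imp_generator:
  assumes u: "integrable m u" and g: "integrable m g"
    and adjoint: "\<And>h f. 0 \<le> h \<Longrightarrow> unit_test m f \<Longrightarrow>
      \<exists>f'. unit_test m f' \<and> (\<forall>w. integrable m w \<longrightarrow> (\<integral>x. f x * Z h w x \<partial>m) = (\<integral>x. f' x * w x \<partial>m))"
    and resolvent: "\<And>f. unit_test m f \<Longrightarrow> damped_integral {0..} (orbit f g) = (\<integral>x. f x * u x \<partial>m)"
  shows "(u, \<lambda>x. u x - g x) \<in> generator m Z"
proof -
  let ?z = "\<lambda>h x. (Z h u x - u x) / h - (u x - g x)"
  let ?r = "\<lambda>h::real. \<bar>(exp h - 1) / h - 1\<bar>"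
  let ?K = "L1_norm m u + L1_norm m g"
  have Zu: "(\<integral>x. f x * Z h u x \<partial>m) = exp h * ((\<integral>x. f x * u x \<partial>m) - damped_integral {0..h} (orbit f g))"
    if h: "0 < h" and f: "unit_test m f" for h f
  proof -
    obtain f' where f': "unit_test m f'"
      "\<And>w. integrable m w \<Longrightarrow> (\<integral>x. f x * Z h w x \<partial>m) = (\<integral>x. f' x * w x \<partial>m)"
      using adjoint[of h f] h f by auto
    have "(\<integral>x. f x * Z h u x \<partial>m) = damped_integral {0..} (orbit f' g)"
      using f'(2)[OF u] resolvent[OF f'(1)] by simp
    also have "\<dots> = damped_integral {0..} (\<lambda>t. orbit f g (t + h))"
    proof -
      have "orbit f' g t = orbit f g (t + h)" if t: "0 \<le> t" for t
      proof -
        have "orbit f' g t = (\<integral>x. f x * Z h (Z t g) x \<partial>m)"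
          unfolding orbit_def using f'(2)[OF integrable[OF t g]] by simp
        also have "\<dots> = orbit f g (t + h)"
          unfolding orbit_def using semigroup[of h t g] t h g f
          by (intro integral_cong_AE borel_measurable_integrable unit_test_integrable integrable)
            (auto simp: add.commute)
        finally show ?thesis .
      qed
      then show ?thesis
        unfolding damped_integral_def by (intro set_lebesgue_integral_cong) auto
    qed
    also have "\<dots> = exp h * (damped_integral {0..} (orbit f g) - damped_integral {0..h} (orbit f g))"
      by (rule damped_integral_shift[OF orbit_continuous[OF f g] orbit_bound[OF f g] h])
    finally show ?thesis using resolvent[OF f] by simp
  qed
  have main: "L1_norm m (?z h) \<le> 2 * (?r h * ?K + exp h * \<delta>)"
    if h: "0 < h" and \<delta>: "\<And>t. 0 < t \<Longrightarrow> t \<le> h \<Longrightarrow> L1_norm m (\<lambda>x. Z t g x - g x) \<le> \<delta>" for h \<delta>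
  proof (rule L1_norm_le_by_tests)
    have Zi: "integrable m (Z h u)" using h u integrable by simp
    show "integrable m (?z h)" using h u g Zi by auto
    fix f assume f: "unit_test m f"
    define p q I where "p = (\<integral>x. f x * u x \<partial>m)" and "q = (\<integral>x. f x * g x \<partial>m)"
      and "I = damped_integral {0..h} (orbit f g)"
    have \<delta>0: "0 \<le> \<delta>" using order_trans[OF L1_norm_nonneg \<delta>[of h]] h by simp
    have "\<bar>I - q * (1 - exp (- h))\<bar> \<le> h * \<delta>"
      unfolding I_def q_def orbit_zero[OF f g, symmetric]
    proof (rule damped_integral_near_zero[OF orbit_continuous[OF f g] orbit_bound[OF f g] h])
      fix t assume t: "0 \<le> t" "t \<le> h"
      show "\<bar>orbit f g t - orbit f g 0\<bar> \<le> \<delta>"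
      proof (cases "t = 0")
        case False
        then show ?thesis using orbit_increment[OF f g, of 0 t] \<delta>[of t] t by simp
      qed (use \<delta>0 in simp)
    qed
    then have I: "exp h / h * \<bar>I - q * (1 - exp (- h))\<bar> \<le> exp h * \<delta>"
      using h by (simp add: field_simps)
    have "(\<integral>x. f x * ?z h x \<partial>m) = (\<integral>x. (f x * Z h u x - f x * u x) / h - (f x * u x - f x * g x) \<partial>m)"
      by (intro Bochner_Integration.integral_cong) (auto simp: algebra_simps diff_divide_distrib)
    also have "\<dots> = ((\<integral>x. f x * Z h u x \<partial>m) - p) / h - (p - q)"
      unfolding p_def q_def using f u g Zi by (simp add: unit_test_integrable)
    also have "\<dots> = (exp h * (p - I) - p) / h - (p - q)"
      unfolding Zu[OF h f] p_def I_def ..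
    \<comment> \<open>the comparison value \<open>q (1 - exp (- h))\<close> of \<open>I\<close> is the integral with the orbit frozen at time \<open>0\<close>\<close>
    also have "\<dots> = (p - q) * ((exp h - 1) / h - 1) - exp h / h * (I - q * (1 - exp (- h)))"
      using h by (simp add: field_simps exp_minus)
    also have "\<bar>\<dots>\<bar> \<le> \<bar>p - q\<bar> * ?r h + exp h / h * \<bar>I - q * (1 - exp (- h))\<bar>"
      using h by (intro order_trans[OF abs_triangle_ineq4]) (simp add: abs_mult)
    also have "\<dots> \<le> ?K * ?r h + exp h * \<delta>"
    proof (intro add_mono I mult_right_mono)
      have "\<bar>p\<bar> \<le> L1_norm m u" "\<bar>q\<bar> \<le> L1_norm m g"
        unfolding p_def q_def using f u g by (auto intro: unit_test_integral_bound)
      then show "\<bar>p - q\<bar> \<le> ?K" by linarith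
    qed simp
    finally show "\<bar>\<integral>x. f x * ?z h x \<partial>m\<bar> \<le> ?r h * ?K + exp h * \<delta>"
      by (simp add: mult.commute)
  qed
  have "((\<lambda>h. L1_norm m (?z h)) \<longlongrightarrow> 0) (at_right 0)"
  proof (rule tendstoI)
    fix e :: real assume e: "0 < e"
    have r: "((\<lambda>h. ?r h * ?K) \<longlongrightarrow> 0 * ?K) (at_right 0)"
      by (intro tendsto_mult tendsto_const) real_asymp
    have e1: "\<forall>\<^sub>F h in at_right 0. ?r h * ?K < e / 8"
      by (rule order_tendstoD(2)[OF r]) (use e in simp)
    have "((\<lambda>h::real. exp h) \<longlongrightarrow> 1) (at_right 0)" by real_asymp
    then have e2: "\<forall>\<^sub>F h::real in at_right 0. exp h < 2"
      by (rule order_tendstoD) simp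
    obtain d where d: "0 < d" "\<And>t. 0 < t \<Longrightarrow> t < d \<Longrightarrow> L1_norm m (\<lambda>x. Z t g x - g x) < e / 8"
      using order_tendstoD(2)[OF strong_continuity[OF g], of "e/8"] e
      by (auto simp: eventually_at_right_field)
    have e3: "\<forall>\<^sub>F h in at_right 0. 0 < h \<and> h < d"
      using d(1) by (auto simp: eventually_at_right_field)
    from e1 e2 e3 show "\<forall>\<^sub>F h in at_right 0. dist (L1_norm m (?z h)) 0 < e"
    proof eventually_elim
      case (elim h)
      have "L1_norm m (?z h) \<le> 2 * (?r h * ?K + exp h * (e / 8))"
        using elim d(2) by (intro main) (auto intro!: less_imp_le)
      moreover have "exp h * (e / 8) \<le> 2 * (e / 8)"
        using elim e by (intro mult_right_mono) auto
      moreover have "2 * (X + Y) < e" if "X < e / 8" "Y \<le> 2 * (e / 8)" for X Y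
        using that e by simp
      ultimately have "L1_norm m (?z h) < e"
        using elim by (meson order_le_less_trans)
      then show ?case using L1_norm_nonneg[of m "?z h"] by (simp add: dist_real_def)
    qed
  qed
  then show ?thesis using u g by (simp add: generator_def)
qed

end

section \<open>Kernel operators on nonnegative functions\<close>

text \<open>These are the operators \<open>f \<mapsto> \<integral> f(y) K(x, dy)\<close> of
  measurable kernels, characterised by their action on functions. In this form compositions, sums
  and time integrals of kernels need no construction of measures. The operators may do anything off
  the space of \<open>m\<close>, hence the congruence clause.\<close>

definition kernel_operator :: "'a measure \<Rightarrow> (('a \<Rightarrow> ennreal) \<Rightarrow> 'a \<Rightarrow> ennreal) \<Rightarrow> bool" where
  "kernel_operator m W \<longleftrightarrow>
     (\<forall>f\<in>borel_measurable m. W f \<in> borel_measurable m) \<and>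
     (\<forall>f. (\<forall>i::nat. f i \<in> borel_measurable m) \<longrightarrow>
        (\<forall>x\<in>space m. W (\<lambda>y. \<Sum>i. f i y) x = (\<Sum>i. W (f i) x))) \<and>
     (\<forall>c. \<forall>f\<in>borel_measurable m. \<forall>x\<in>space m. W (\<lambda>y. c * f y) x = c * W f x) \<and>
     (\<forall>f g. (\<forall>x\<in>space m. f x = g x) \<longrightarrow> (\<forall>x\<in>space m. W f x = W g x))"

lemma kernel_operatorI:
  assumes "\<And>f. f \<in> borel_measurable m \<Longrightarrow> W f \<in> borel_measurable m"
    and "\<And>f x. (\<And>i::nat. f i \<in> borel_measurable m) \<Longrightarrow> x \<in> space m \<Longrightarrow> W (\<lambda>y. \<Sum>i. f i y) x = (\<Sum>i. W (f i) x)"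
    and "\<And>c f x. f \<in> borel_measurable m \<Longrightarrow> x \<in> space m \<Longrightarrow> W (\<lambda>y. c * f y) x = c * W f x"
    and "\<And>f g x. (\<And>x. x \<in> space m \<Longrightarrow> f x = g x) \<Longrightarrow> x \<in> space m \<Longrightarrow> W f x = W g x"
  shows "kernel_operator m W"
  using assms unfolding kernel_operator_def by blast

context
  fixes m :: "'a measure" and W
  assumes W: "kernel_operator m W"
begin

lemma kernel_operator_measurable: "f \<in> borel_measurable m \<Longrightarrow> W f \<in> borel_measurable m"
  using W by (auto simp: kernel_operator_def)

lemma kernel_operator_suminf:
  "(\<And>i. f i \<in> borel_measurable m) \<Longrightarrow> x \<in> space m \<Longrightarrow> W (\<lambda>y. \<Sum>i. f i y) x = (\<Sum>i. W (f i) x)"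
  using W unfolding kernel_operator_def by blast

lemma kernel_operator_scale:
  "f \<in> borel_measurable m \<Longrightarrow> x \<in> space m \<Longrightarrow> W (\<lambda>y. c * f y) x = c * W f x"
  using W by (auto simp: kernel_operator_def)

lemma kernel_operator_cong:
  "(\<And>x. x \<in> space m \<Longrightarrow> f x = g x) \<Longrightarrow> x \<in> space m \<Longrightarrow> W f x = W g x"
  using W unfolding kernel_operator_def by blast

lemma kernel_operator_zero: "x \<in> space m \<Longrightarrow> W (\<lambda>y. 0) x = 0"
  using kernel_operator_scale[of "\<lambda>_. 0" x 0] by simp

lemma kernel_operator_sum:
  assumes f: "\<And>i::nat. f i \<in> borel_measurable m" and x: "x \<in> space m"
  shows "W (\<lambda>y. \<Sum>i<n. f i y) x = (\<Sum>i<n. W (f i) x)"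
proof -
  let ?g = "\<lambda>i y. if i < n then f i y else 0"
  have [measurable]: "?g i \<in> borel_measurable m" for i using f by (cases "i < n") auto
  have "W (\<lambda>y. \<Sum>i<n. f i y) x = W (\<lambda>y. \<Sum>i. ?g i y) x"
    by (intro kernel_operator_cong x) (subst suminf_finite[of "{..<n}"], auto)
  also have "\<dots> = (\<Sum>i. W (?g i) x)"
    by (intro kernel_operator_suminf x) measurable
  also have "\<dots> = (\<Sum>i<n. W (?g i) x)"
    by (intro suminf_finite) (auto simp: kernel_operator_zero[OF x])
  finally show ?thesis by (simp cong: if_cong)
qed

lemma kernel_operator_add:
  assumes "f \<in> borel_measurable m" "g \<in> borel_measurable m" "x \<in> space m"
  shows "W (\<lambda>y. f y + g y) x = W f x + W g x"
  using kernel_operator_sum[of "\<lambda>i. if i = 0 then f else g" x 2] assms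
  by (simp add: numeral_2_eq_2 lessThan_Suc add.commute)

lemma kernel_operator_mono:
  assumes [measurable]: "f \<in> borel_measurable m" "g \<in> borel_measurable m" and x: "x \<in> space m"
    and le: "\<And>y. y \<in> space m \<Longrightarrow> f y \<le> g y"
  shows "W f x \<le> W g x"
proof -
  have "W g x = W (\<lambda>y. f y + (g y - f y)) x"
    using le by (intro kernel_operator_cong x) (simp add: add_diff_inverse_ennreal)
  also have "\<dots> = W f x + W (\<lambda>y. g y - f y) x"
    by (intro kernel_operator_add x) measurable
  finally show ?thesis by simp
qed

text \<open>Write the supremum as the sum of the increments \<open>f (Suc j) - f j\<close>. On
  extended nonnegative numbers \<open>a + (b - a) = b\<close> holds for all
  \<open>a \<le> b\<close>, infinite values included.\<close>

lemma kernel_operator_SUP: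
  assumes f [measurable]: "\<And>i::nat. f i \<in> borel_measurable m" and inc: "incseq f" and x: "x \<in> space m"
  shows "W (SUP i. f i) x = (SUP i. W (f i) x)"
proof -
  let ?d = "\<lambda>i y. case i of 0 \<Rightarrow> f 0 y | Suc j \<Rightarrow> f (Suc j) y - f j y"
  have d [measurable]: "?d i \<in> borel_measurable m" for i by (cases i) auto
  have part: "(\<Sum>i<Suc n. ?d i y) = f n y" for n y
  proof (induction n)
    case (Suc n)
    have "f n y \<le> f (Suc n) y" using inc by (auto simp: incseq_def le_fun_def)
    with Suc show ?case by (simp add: add_diff_inverse_ennreal)
  qed simp
  have shift: "(\<Sum>i. a i) = (SUP n. \<Sum>i<Suc n. a i)" for a :: "nat \<Rightarrow> ennreal"
    unfolding suminf_eq_SUP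
  proof (intro antisym SUP_least)
    fix n
    show "(\<Sum>i<n. a i) \<le> (SUP n. \<Sum>i<Suc n. a i)"
      by (rule SUP_upper2[of n]) auto
    show "(\<Sum>i<Suc n. a i) \<le> (SUP n. \<Sum>i<n. a i)"
      by (rule SUP_upper2[of "Suc n"]) auto
  qed
  have "W (SUP i. f i) x = W (\<lambda>y. \<Sum>i. ?d i y) x"
    unfolding shift part by (simp add: SUP_apply[abs_def])
  also have "\<dots> = (SUP n. \<Sum>i<Suc n. W (?d i) x)"
    by (subst kernel_operator_suminf) (auto simp: x shift)
  also have "\<dots> = (SUP n. W (\<lambda>y. \<Sum>i<Suc n. ?d i y) x)"
    by (intro SUP_cong refl kernel_operator_sum[symmetric] x d)
  finally show ?thesis unfolding part by simp
qed

end

lemma kernel_operator_comp: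
  assumes "kernel_operator m V" "kernel_operator m W"
  shows "kernel_operator m (\<lambda>f. V (W f))"
proof (rule kernel_operatorI)
  fix f :: "nat \<Rightarrow> 'a \<Rightarrow> ennreal" and x
  assume f: "\<And>i. f i \<in> borel_measurable m" and x: "x \<in> space m"
  have "V (W (\<lambda>y. \<Sum>i. f i y)) x = V (\<lambda>y. \<Sum>i. W (f i) y) x"
    by (intro kernel_operator_cong[OF assms(1)] kernel_operator_suminf[OF assms(2)] f x)
  also have "\<dots> = (\<Sum>i. V (W (f i)) x)"
    by (intro kernel_operator_suminf[OF assms(1)] kernel_operator_measurable[OF assms(2)] f x)
  finally show "V (W (\<lambda>y. \<Sum>i. f i y)) x = (\<Sum>i. V (W (f i)) x)" .
next
  fix c :: ennreal and f :: "'a \<Rightarrow> ennreal" and x assume f: "f \<in> borel_measurable m" and x: "x \<in> space m"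
  have "V (W (\<lambda>y. c * f y)) x = V (\<lambda>y. c * W f y) x"
    by (intro kernel_operator_cong[OF assms(1)] kernel_operator_scale[OF assms(2)] f x)
  also have "\<dots> = c * V (W f) x"
    by (intro kernel_operator_scale[OF assms(1)] kernel_operator_measurable[OF assms(2)] f x)
  finally show "V (W (\<lambda>y. c * f y)) x = c * V (W f) x" .
qed (auto intro!: kernel_operator_measurable[OF assms(1)] kernel_operator_measurable[OF assms(2)]
      intro: kernel_operator_cong[OF assms(1)] kernel_operator_cong[OF assms(2)])

lemma kernel_operator_weight:
  assumes "kernel_operator m W" and g[measurable]: "g \<in> borel_measurable m"
  shows "kernel_operator m (\<lambda>f x. g x * W f x)"
proof (rule kernel_operatorI)
  fix f :: "'a \<Rightarrow> ennreal" assume "f \<in> borel_measurable m"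
  then have [measurable]: "W f \<in> borel_measurable m" by (rule kernel_operator_measurable[OF assms(1)])
  show "(\<lambda>x. g x * W f x) \<in> borel_measurable m" by measurable
next
  fix f :: "nat \<Rightarrow> 'a \<Rightarrow> ennreal" and x
  assume f: "\<And>i. f i \<in> borel_measurable m" and x: "x \<in> space m"
  show "g x * W (\<lambda>y. \<Sum>i. f i y) x = (\<Sum>i. g x * W (f i) x)"
    by (simp add: kernel_operator_suminf[OF assms(1) f x])
next
  fix c :: ennreal and f :: "'a \<Rightarrow> ennreal" and x assume f: "f \<in> borel_measurable m" and x: "x \<in> space m"
  show "g x * W (\<lambda>y. c * f y) x = c * (g x * W f x)"
    by (simp add: kernel_operator_scale[OF assms(1) f x] ac_simps)
next
  fix f g' :: "'a \<Rightarrow> ennreal" and x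
  assume "\<And>x. x \<in> space m \<Longrightarrow> f x = g' x" "x \<in> space m"
  then show "g x * W f x = g x * W g' x"
    using kernel_operator_cong[OF assms(1), of f g' x] by simp
qed

lemma kernel_operator_integral:
  fixes W :: "'b \<Rightarrow> ('a \<Rightarrow> ennreal) \<Rightarrow> 'a \<Rightarrow> ennreal"
  assumes Q: "sigma_finite_measure Q" and W: "\<And>r. r \<in> space Q \<Longrightarrow> kernel_operator m (W r)"
    and meas: "\<And>f. f \<in> borel_measurable m \<Longrightarrow> (\<lambda>(x, r). W r f x) \<in> borel_measurable (m \<Otimes>\<^sub>M Q)"
  shows "kernel_operator m (\<lambda>f x. \<integral>\<^sup>+r. W r f x \<partial>Q)"
proof -
  interpret sigma_finite_measure Q by fact
  have Wr: "f \<in> borel_measurable m \<Longrightarrow> x \<in> space m \<Longrightarrow> (\<lambda>r. W r f x) \<in> borel_measurable Q" for f x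
    using measurable_Pair2[OF meas, of f x] by simp
  show ?thesis
  proof (rule kernel_operatorI)
    fix f :: "'a \<Rightarrow> ennreal" assume f: "f \<in> borel_measurable m"
    show "(\<lambda>x. \<integral>\<^sup>+r. W r f x \<partial>Q) \<in> borel_measurable m"
      by (rule borel_measurable_nn_integral) (use meas[OF f] in simp)
  next
    fix f :: "nat \<Rightarrow> 'a \<Rightarrow> ennreal" and x
    assume f: "\<And>i. f i \<in> borel_measurable m" and x: "x \<in> space m"
    have "(\<integral>\<^sup>+r. W r (\<lambda>y. \<Sum>i. f i y) x \<partial>Q) = (\<integral>\<^sup>+r. (\<Sum>i. W r (f i) x) \<partial>Q)"
      by (intro nn_integral_cong kernel_operator_suminf[OF W] f x)
    also have "\<dots> = (\<Sum>i. \<integral>\<^sup>+r. W r (f i) x \<partial>Q)"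
      by (intro nn_integral_suminf Wr f x)
    finally show "(\<integral>\<^sup>+r. W r (\<lambda>y. \<Sum>i. f i y) x \<partial>Q) = (\<Sum>i. \<integral>\<^sup>+r. W r (f i) x \<partial>Q)" .
  next
    fix c :: ennreal and f :: "'a \<Rightarrow> ennreal" and x assume f: "f \<in> borel_measurable m" and x: "x \<in> space m"
    have "(\<integral>\<^sup>+r. W r (\<lambda>y. c * f y) x \<partial>Q) = (\<integral>\<^sup>+r. c * W r f x \<partial>Q)"
      by (intro nn_integral_cong kernel_operator_scale[OF W] f x)
    also have "\<dots> = c * (\<integral>\<^sup>+r. W r f x \<partial>Q)"
      by (intro nn_integral_cmult Wr f x)
    finally show "(\<integral>\<^sup>+r. W r (\<lambda>y. c * f y) x \<partial>Q) = c * (\<integral>\<^sup>+r. W r f x \<partial>Q)" .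
  next
    fix f g :: "'a \<Rightarrow> ennreal" and x
    assume "\<And>x. x \<in> space m \<Longrightarrow> f x = g x" "x \<in> space m"
    then show "(\<integral>\<^sup>+r. W r f x \<partial>Q) = (\<integral>\<^sup>+r. W r g x \<partial>Q)"
      by (intro nn_integral_cong kernel_operator_cong[OF W])
  qed
qed

lemma kernel_operator_series:
  assumes W: "\<And>n::nat. kernel_operator m (W n)"
  shows "kernel_operator m (\<lambda>f x. \<Sum>n. W n f x)"
proof -
  have "kernel_operator m (\<lambda>f x. \<integral>\<^sup>+n. W n f x \<partial>count_space UNIV)"
  proof (rule kernel_operator_integral[OF sigma_finite_measure_count_space W])
    fix f :: "'a \<Rightarrow> ennreal" assume "f \<in> borel_measurable m"
    then have [measurable]: "\<And>n. W n f \<in> borel_measurable m"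
      by (rule kernel_operator_measurable[OF W])
    show "(\<lambda>(x, n). W n f x) \<in> borel_measurable (m \<Otimes>\<^sub>M count_space UNIV)"
      by measurable
  qed
  then show ?thesis by (simp add: nn_integral_count_space_nat)
qed

text \<open>Since \<^term>\<open>ennreal (u x)\<close> is \<open>0\<close> for negative
  \<open>u x\<close>, this describes the dual on the positive part of \<open>u\<close>.\<close>

definition dual_density :: "'a measure \<Rightarrow> (('a \<Rightarrow> ennreal) \<Rightarrow> 'a \<Rightarrow> ennreal) \<Rightarrow> ('a \<Rightarrow> real) \<Rightarrow> ('a \<Rightarrow> real) \<Rightarrow> bool"
  where "dual_density m W u w \<longleftrightarrow> integrable m w \<and> (\<forall>x. 0 \<le> w x) \<and>
    (\<forall>f\<in>borel_measurable m. (\<integral>\<^sup>+x. f x * ennreal (w x) \<partial>m) = (\<integral>\<^sup>+x. W f x * ennreal (u x) \<partial>m))"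

lemma kernel_operator_duality_extend:
  assumes W: "kernel_operator m W"
    and [measurable]: "u \<in> borel_measurable m" "w \<in> borel_measurable m"
    and ind: "\<And>B. B \<in> sets m \<Longrightarrow> (\<integral>\<^sup>+x. W (indicator B) x * u x \<partial>m) = (\<integral>\<^sup>+x. indicator B x * w x \<partial>m)"
    and f: "f \<in> borel_measurable m"
  shows "(\<integral>\<^sup>+x. W f x * u x \<partial>m) = (\<integral>\<^sup>+x. f x * w x \<partial>m)"
proof -
  note [measurable] = kernel_operator_measurable[OF W]
  show ?thesis
    using f
  proof (induction rule: borel_measurable_induct)
    case (cong f g)
    have "(\<integral>\<^sup>+x. W f x * u x \<partial>m) = (\<integral>\<^sup>+x. W g x * u x \<partial>m)"
      using cong(3) by (intro nn_integral_cong) (metis kernel_operator_cong[OF W])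
    moreover have "(\<integral>\<^sup>+x. f x * w x \<partial>m) = (\<integral>\<^sup>+x. g x * w x \<partial>m)"
      using cong(3) by (intro nn_integral_cong) simp
    ultimately show ?case using cong(4) by simp
  next
    case (set A)
    then show ?case by (rule ind)
  next
    case (mult f c)
    have f [measurable]: "f \<in> borel_measurable m" by fact
    have "(\<integral>\<^sup>+x. W (\<lambda>x. c * f x) x * u x \<partial>m) = (\<integral>\<^sup>+x. c * (W f x * u x) \<partial>m)"
      by (intro nn_integral_cong) (simp add: kernel_operator_scale[OF W f] ac_simps)
    then show ?case using mult by (simp add: nn_integral_cmult mult.assoc)
  next
    case (add f g)
    have f [measurable]: "f \<in> borel_measurable m" and g [measurable]: "g \<in> borel_measurable m" by fact+
    have "(\<integral>\<^sup>+x. W (\<lambda>x. g x + f x) x * u x \<partial>m) = (\<integral>\<^sup>+x. W g x * u x + W f x * u x \<partial>m)"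
      by (intro nn_integral_cong) (simp add: kernel_operator_add[OF W g f] distrib_right)
    then show ?case using add by (simp add: nn_integral_add distrib_right)
  next
    case (seq F)
    have F [measurable]: "F i \<in> borel_measurable m" for i by fact
    have inc: "incseq F" by fact
    have IH: "(\<integral>\<^sup>+x. W (F i) x * u x \<partial>m) = (\<integral>\<^sup>+x. F i x * w x \<partial>m)" for i by fact
    have mono: "incseq (\<lambda>i x. W (F i) x * indicator (space m) x * u x)"
    proof (intro incseq_SucI le_funI, rule mult_right_mono)
      fix i x
      have "F i \<le> F (Suc i)" using inc by (rule incseq_SucD)
      then show "W (F i) x * indicator (space m) x \<le> W (F (Suc i)) x * indicator (space m) x"
        by (cases "x \<in> space m")
          (auto simp: le_fun_def intro!: kernel_operator_mono[OF W F F])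
    qed simp
    have "(\<integral>\<^sup>+x. W (Sup (range F)) x * u x \<partial>m)
        = (\<integral>\<^sup>+x. (SUP i. W (F i) x * indicator (space m) x * u x) \<partial>m)"
      by (intro nn_integral_cong)
        (auto simp: kernel_operator_SUP[OF W F inc] SUP_mult_right_ennreal)
    also have "\<dots> = (SUP i. \<integral>\<^sup>+x. W (F i) x * indicator (space m) x * u x \<partial>m)"
      by (intro nn_integral_monotone_convergence_SUP mono) measurable
    also have "\<dots> = (SUP i. \<integral>\<^sup>+x. F i x * w x \<partial>m)"
      unfolding IH[symmetric] by (intro SUP_cong refl nn_integral_cong) simp
    also have "\<dots> = (\<integral>\<^sup>+x. (SUP i. F i x * w x) \<partial>m)"
    proof (intro nn_integral_monotone_convergence_SUP[symmetric] incseq_SucI le_funI mult_right_mono)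
      fix i x
      show "F i x \<le> F (Suc i) x" using incseq_SucD[OF inc] by (auto simp: le_fun_def)
    qed simp_all
    also have "\<dots> = (\<integral>\<^sup>+x. Sup (range F) x * w x \<partial>m)"
      by (simp add: SUP_mult_right_ennreal SUP_apply image_image)
    finally show ?case .
  qed
qed

lemma null_set_indicator: "B \<in> null_sets m \<Longrightarrow> AE x in m. indicator B x = (0::ennreal)"
  using AE_not_in by (auto simp: indicator_def elim: eventually_mono)

text \<open>The measure \<open>B \<mapsto> \<integral> (W 1\<^sub>B) u dm\<close> is finite and, as
  \<open>W\<close> maps indicators of null sets to null functions, absolutely continuous; its
  Radon-Nikodym density is the required function.\<close>

lemma dual_density_exists:
  assumes m: "sigma_finite_measure m" and W: "kernel_operator m W"
    and sub: "\<And>x. x \<in> space m \<Longrightarrow> W (\<lambda>_. 1) x \<le> 1"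
    and ac: "\<And>B. B \<in> null_sets m \<Longrightarrow> AE x in m. W (indicator B) x = 0"
    and u: "integrable m u"
  shows "\<exists>w. dual_density m W u w"
proof -
  interpret sigma_finite_measure m by fact
  have [measurable]: "u \<in> borel_measurable m" using u by auto
  note [measurable] = kernel_operator_measurable[OF W]
  let ?e = "\<lambda>B. \<integral>\<^sup>+x. W (indicator B) x * ennreal (u x) \<partial>m"
  define \<mu> where "\<mu> = measure_of (space m) (sets m) ?e"
  have sets_\<mu>: "sets \<mu> = sets m" and space_\<mu>: "space \<mu> = space m"
    by (simp_all add: \<mu>_def)
  have em: "emeasure \<mu> B = ?e B" if B: "B \<in> sets m" for B
  proof (rule emeasure_measure_of[OF \<mu>_def])
    show "positive (sets \<mu>) ?e"
      using kernel_operator_zero[OF W]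
      by (auto simp: positive_def indicator_def[abs_def] intro!: nn_integral_zero' AE_I2)
    show "countably_additive (sets \<mu>) ?e"
      unfolding countably_additive_def
    proof (intro allI impI)
      fix A :: "nat \<Rightarrow> 'a set" assume A: "range A \<subseteq> sets \<mu>" "disjoint_family A"
      have [measurable]: "A i \<in> sets m" for i using A sets_\<mu> by auto
      have "?e (\<Union>i. A i) = (\<integral>\<^sup>+x. (\<Sum>i. W (indicator (A i)) x * ennreal (u x)) \<partial>m)"
      proof (intro nn_integral_cong)
        fix x assume x: "x \<in> space m"
        have "W (indicator (\<Union>i. A i)) x = W (\<lambda>y. \<Sum>i. indicator (A i) y) x"
          using suminf_indicator[OF A(2)] by (intro kernel_operator_cong[OF W] x) simp
        also have "\<dots> = (\<Sum>i. W (indicator (A i)) x)"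
          by (intro kernel_operator_suminf[OF W] x) measurable
        finally show "W (indicator (\<Union>i. A i)) x * ennreal (u x)
            = (\<Sum>i. W (indicator (A i)) x * ennreal (u x))" by simp
      qed
      also have "\<dots> = (\<Sum>i. ?e (A i))"
        by (intro nn_integral_suminf) measurable
      finally show "(\<Sum>i. ?e (A i)) = ?e (\<Union>i. A i)" ..
    qed
  qed (use B sets.sets_into_space in \<open>auto simp: sets_\<mu>\<close>)
  have "absolutely_continuous m \<mu>"
    unfolding absolutely_continuous_def
  proof
    fix B assume B: "B \<in> null_sets m"
    have "?e B = (\<integral>\<^sup>+x. 0 \<partial>m)"
      using ac[OF B] by (intro nn_integral_cong_AE) auto
    with B show "B \<in> null_sets \<mu>" by (auto simp: null_sets_def em sets_\<mu>)
  qed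
  from Radon_Nikodym[OF this sets_\<mu>] obtain w
    where [measurable]: "w \<in> borel_measurable m" and w: "density m w = \<mu>" by auto
  have ind: "(\<integral>\<^sup>+x. W (indicator B) x * ennreal (u x) \<partial>m) = (\<integral>\<^sup>+x. indicator B x * w x \<partial>m)"
    if "B \<in> sets m" for B
    using em[OF that] that unfolding w[symmetric] by (simp add: emeasure_density mult.commute)
  have "(\<integral>\<^sup>+x. w x \<partial>m) = ?e (space m)"
    using ind[OF sets.top] by (simp cong: nn_integral_cong)
  also have "\<dots> \<le> (\<integral>\<^sup>+x. 1 * ennreal (u x) \<partial>m)"
  proof (intro nn_integral_mono mult_right_mono)
    fix x assume x: "x \<in> space m"
    have "W (indicator (space m)) x = W (\<lambda>_. 1) x"
      by (intro kernel_operator_cong[OF W] x) simp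
    then show "W (indicator (space m)) x \<le> 1" using sub[OF x] by simp
  qed simp
  also have "\<dots> \<le> (\<integral>\<^sup>+x. ennreal \<bar>u x\<bar> \<partial>m)"
    by (intro nn_integral_mono) (auto intro: ennreal_leI)
  also have "\<dots> < \<infinity>" using u by (simp add: integrable_iff_bounded)
  finally have fin: "(\<integral>\<^sup>+x. w x \<partial>m) < \<infinity>" .
  then have AEfin: "AE x in m. w x \<noteq> \<infinity>" by (intro nn_integral_PInf_AE) auto
  let ?w = "\<lambda>x. enn2real (w x)"
  have eq: "AE x in m. ennreal (?w x) = w x"
    using AEfin by eventually_elim (simp add: top.not_eq_extremum)
  have "(\<integral>\<^sup>+x. ennreal (?w x) \<partial>m) < \<infinity>"
    using fin nn_integral_cong_AE[OF eq] by simp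
  then have "integrable m ?w" by (intro integrableI_nonneg) auto
  moreover have "(\<integral>\<^sup>+x. f x * ennreal (?w x) \<partial>m) = (\<integral>\<^sup>+x. W f x * ennreal (u x) \<partial>m)"
    if f: "f \<in> borel_measurable m" for f
  proof -
    have "(\<integral>\<^sup>+x. f x * ennreal (?w x) \<partial>m) = (\<integral>\<^sup>+x. f x * w x \<partial>m)"
      using eq by (intro nn_integral_cong_AE) auto
    also have "\<dots> = (\<integral>\<^sup>+x. W f x * ennreal (u x) \<partial>m)"
      using ind by (intro kernel_operator_duality_extend[OF W _ _ _ f, symmetric]) auto
    finally show ?thesis .
  qed
  ultimately show ?thesis unfolding dual_density_def by (intro exI[of _ ?w]) auto
qed

section \<open>Cumulative rates along the flow\<close>

text \<open>The flow is taken to be measurable on all of \<open>\<real> \<times> E\<close>, although its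
  semigroup property concerns nonnegative times only; this spares restrictions of the time axis in
  every measurability argument.\<close>

locale pdmp_flow =
  fixes m :: "'a measure" and \<pi> :: "real \<Rightarrow> 'a \<Rightarrow> 'a" and \<phi> :: "'a \<Rightarrow> real" and J :: "'a \<Rightarrow> 'a measure"
  assumes flow_measurable: "(\<lambda>(t, x). \<pi> t x) \<in> borel \<Otimes>\<^sub>M m \<rightarrow>\<^sub>M m"
    and flow_zero: "x \<in> space m \<Longrightarrow> \<pi> 0 x = x"
    and flow_add: "0 \<le> s \<Longrightarrow> 0 \<le> t \<Longrightarrow> x \<in> space m \<Longrightarrow> \<pi> (s + t) x = \<pi> t (\<pi> s x)"
    and rate_measurable [measurable]: "\<phi> \<in> borel_measurable m"
    and rate_nonneg: "x \<in> space m \<Longrightarrow> 0 \<le> \<phi> x"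
    and rate_integrable: "x \<in> space m \<Longrightarrow> set_integrable lborel {0..t} (\<lambda>s. \<phi> (\<pi> s x))"
    and rate_divergent: "x \<in> space m \<Longrightarrow> filterlim (cumulative_rate \<pi> \<phi> x) at_top at_top"
    and jump_measurable: "J \<in> m \<rightarrow>\<^sub>M prob_algebra m"
begin

abbreviation "\<Phi> \<equiv> cumulative_rate \<pi> \<phi>"
abbreviation "\<tau> \<equiv> cumulative_rate_inverse \<pi> \<phi>"

lemma flow_measurable' [measurable (raw)]:
  "g \<in> borel_measurable P \<Longrightarrow> k \<in> P \<rightarrow>\<^sub>M m \<Longrightarrow> (\<lambda>p. \<pi> (g p) (k p)) \<in> P \<rightarrow>\<^sub>M m"
  using measurable_compose[OF measurable_Pair flow_measurable, of g P k] by simp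

lemma flow_in_space: "x \<in> space m \<Longrightarrow> \<pi> t x \<in> space m"
  by (rule measurable_space[OF flow_measurable'[of "\<lambda>_. t" m "\<lambda>x. x"]]) auto

lemma rate_flow_nonneg: "x \<in> space m \<Longrightarrow> 0 \<le> \<phi> (\<pi> t x)"
  by (intro rate_nonneg flow_in_space)

lemma cumulative_rate_zero: "t \<le> 0 \<Longrightarrow> \<Phi> x t = 0"
proof -
  assume t: "t \<le> 0"
  have "\<Phi> x t = (\<integral>s. indicator {0..t} s *\<^sub>R \<phi> (\<pi> 0 x) \<partial>lborel)"
    unfolding cumulative_rate_def set_lebesgue_integral_def
  proof (intro Bochner_Integration.integral_cong refl)
    fix s
    show "indicat_real {0..t} s *\<^sub>R \<phi> (\<pi> s x) = indicat_real {0..t} s *\<^sub>R \<phi> (\<pi> 0 x)"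
      using t by (cases "s = 0") (auto simp: indicator_def)
  qed
  also have "\<dots> = 0" using t by (cases "t = 0") auto
  finally show ?thesis .
qed

lemma cumulative_rate_nonneg: "x \<in> space m \<Longrightarrow> 0 \<le> \<Phi> x t"
  unfolding cumulative_rate_def set_lebesgue_integral_def
  by (intro integral_nonneg_AE AE_I2) (auto simp: rate_flow_nonneg)

lemma cumulative_rate_add:
  assumes x: "x \<in> space m" and s: "0 \<le> s" and t: "0 \<le> t"
  shows "\<Phi> x (s + t) = \<Phi> x s + \<Phi> (\<pi> s x) t"
proof -
  have [measurable]: "x \<in> space m" by fact
  let ?f = "\<lambda>r. \<phi> (\<pi> r x)"
  have i: "set_integrable lborel {s<..s + t} ?f"
    by (rule set_integrable_subset[OF rate_integrable[OF x, of "s + t"]]) (use s in auto)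
  have "{0..s + t} = {0..s} \<union> {s<..s + t}" using s t by auto
  then have "\<Phi> x (s + t) = \<Phi> x s + (LINT r:{s<..s + t}|lborel. ?f r)"
    unfolding cumulative_rate_def
    by (simp only:) (rule set_integral_Un[OF _ rate_integrable[OF x] i], auto)
  also have "(LINT r:{s<..s + t}|lborel. ?f r) = (LINT r:{s..s + t}|lborel. ?f r)"
    unfolding set_lebesgue_integral_def
    using AE_lborel_singleton[of s]
    by (intro integral_cong_AE) (auto elim!: eventually_mono simp: indicator_def)
  also have "\<dots> = (\<integral>r. indicator {s..s + t} (s + 1 * r) *\<^sub>R ?f (s + 1 * r) \<partial>lborel)"
    unfolding set_lebesgue_integral_def by (subst lborel_integral_real_affine[of 1 _ s]) auto
  also have "\<dots> = \<Phi> (\<pi> s x) t"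
    unfolding cumulative_rate_def set_lebesgue_integral_def
    by (intro Bochner_Integration.integral_cong refl)
      (auto simp: indicator_def flow_add[OF s _ x])
  finally show ?thesis .
qed

lemma cumulative_rate_mono:
  assumes "x \<in> space m" "s \<le> t" shows "\<Phi> x s \<le> \<Phi> x t"
proof (cases "0 \<le> s")
  case True
  then show ?thesis
    using cumulative_rate_add[OF assms(1), of s "t - s"] assms
      cumulative_rate_nonneg[OF flow_in_space[OF assms(1)], of s "t - s"] by simp
qed (use assms in \<open>simp add: cumulative_rate_zero cumulative_rate_nonneg\<close>)

lemma cumulative_rate_continuous:
  assumes "x \<in> space m" shows "continuous_on {0..} (\<Phi> x)"
proof -
  have "continuous_on {0..b} (\<Phi> x)" for b
  proof -
    have "continuous_on {0..b} (\<lambda>t. integral {0..t} (\<lambda>s. \<phi> (\<pi> s x)))"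
      using set_borel_integral_eq_integral(1)[OF rate_integrable[OF assms]]
      by (rule indefinite_integral_continuous_1)
    then show ?thesis
      using set_borel_integral_eq_integral(2)[OF rate_integrable[OF assms]]
      by (simp add: cumulative_rate_def[abs_def])
  qed
  moreover have "at s within {0..} = at s within {0..s + 1}" for s :: real
    by (rule at_within_nhd[of s "{..<s + 1}"]) auto
  ultimately show ?thesis
    unfolding continuous_on_def by (metis atLeastAtMost_iff atLeast_iff less_add_one less_imp_le)
qed

lemma cumulative_rate_measurable [measurable (raw)]:
  assumes [measurable]: "g \<in> borel_measurable P" "k \<in> P \<rightarrow>\<^sub>M m"
  shows "(\<lambda>p. \<Phi> (k p) (g p)) \<in> borel_measurable P"
proof -
  have "(\<lambda>p. \<integral>s. (if 0 \<le> s \<and> s \<le> g p then 1 else 0) * \<phi> (\<pi> s (k p)) \<partial>lborel) \<in> borel_measurable P"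
    by measurable
  also have "(\<lambda>p. \<integral>s. (if 0 \<le> s \<and> s \<le> g p then 1 else 0) * \<phi> (\<pi> s (k p)) \<partial>lborel)
      = (\<lambda>p. \<Phi> (k p) (g p))"
    unfolding cumulative_rate_def set_lebesgue_integral_def
    by (intro ext Bochner_Integration.integral_cong) (auto simp: indicator_def)
  finally show ?thesis .
qed

text \<open>By continuity and monotonicity of the cumulative rate the infimum defining
  \<open>\<tau>\<close> is attained. The equivalence yields the measurability of
  \<open>\<tau>\<close> and the tail of the holding times.\<close>

lemma inverse_le_iff:
  assumes x: "x \<in> space m"
  shows "\<tau> x q \<le> t \<longleftrightarrow> 0 \<le> t \<and> q \<le> \<Phi> x t"
proof -
  let ?S = "{t. 0 \<le> t \<and> q \<le> \<Phi> x t}"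
  have "closed ({0..} \<inter> \<Phi> x -` {q..})"
    by (intro continuous_closed_preimage cumulative_rate_continuous x) auto
  also have "{0..} \<inter> \<Phi> x -` {q..} = ?S" by auto
  finally have cl: "closed ?S" .
  have ne: "?S \<noteq> {}"
  proof -
    have "\<forall>\<^sub>F t in at_top. q \<le> \<Phi> x t"
      using rate_divergent[OF x] by (simp add: filterlim_at_top)
    then have "\<forall>\<^sub>F t in at_top. q \<le> \<Phi> x t \<and> 0 \<le> t"
      using eventually_ge_at_top[of 0] by eventually_elim simp
    then show ?thesis using eventually_happens'[OF trivial_limit_at_top_linorder] by auto
  qed
  have bdd: "bdd_below ?S" by (intro bdd_belowI[of _ 0]) auto
  have mem: "\<tau> x q \<in> ?S"
    unfolding cumulative_rate_inverse_def by (rule closed_contains_Inf[OF ne bdd cl])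
  show ?thesis
  proof
    assume "\<tau> x q \<le> t"
    with mem cumulative_rate_mono[OF x this] show "0 \<le> t \<and> q \<le> \<Phi> x t" by auto
  next
    assume "0 \<le> t \<and> q \<le> \<Phi> x t"
    then show "\<tau> x q \<le> t"
      unfolding cumulative_rate_inverse_def by (intro cInf_lower bdd) simp
  qed
qed

lemma inverse_nonneg: "x \<in> space m \<Longrightarrow> 0 \<le> \<tau> x q"
  using inverse_le_iff[of x q "\<tau> x q"] by simp

lemma less_inverse_iff: "x \<in> space m \<Longrightarrow> 0 \<le> t \<Longrightarrow> t < \<tau> x q \<longleftrightarrow> \<Phi> x t < q"
  using inverse_le_iff[of x q t] by auto

lemma inverse_measurable [measurable (raw)]:
  assumes [measurable]: "g \<in> borel_measurable P" "k \<in> P \<rightarrow>\<^sub>M m"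
  shows "(\<lambda>p. \<tau> (k p) (g p)) \<in> borel_measurable P"
  unfolding borel_measurable_iff_le
proof
  fix t
  have "{p\<in>space P. \<tau> (k p) (g p) \<le> t} = {p\<in>space P. 0 \<le> t \<and> g p \<le> \<Phi> (k p) t}"
    using inverse_le_iff measurable_space[OF assms(2)] by auto
  also have "\<dots> \<in> sets P" by measurable
  finally show "{p\<in>space P. \<tau> (k p) (g p) \<le> t} \<in> sets P" .
qed

lemma cumulative_rate_inverse_eq:
  assumes x: "x \<in> space m" and q: "0 \<le> q"
  shows "\<Phi> x (\<tau> x q) = q"
proof (rule antisym)
  show "q \<le> \<Phi> x (\<tau> x q)" using inverse_le_iff[OF x, of q "\<tau> x q"] by simp
  have "\<exists>t\<ge>0. t \<le> \<tau> x q \<and> \<Phi> x t = q"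
    using \<open>q \<le> \<Phi> x (\<tau> x q)\<close> q cumulative_rate_zero[of 0 x] inverse_nonneg[OF x, of q]
      continuous_on_subset[OF cumulative_rate_continuous[OF x], of "{0..\<tau> x q}"]
    by (intro IVT') auto
  then obtain t where t: "0 \<le> t" "\<Phi> x t = q" by auto
  then have "\<tau> x q \<le> t" using inverse_le_iff[OF x] by simp
  then show "\<Phi> x (\<tau> x q) \<le> q" using cumulative_rate_mono[OF x] t by metis
qed

lemma rate_integral:
  assumes x: "x \<in> space m" and t: "0 \<le> t" "t \<le> u"
  shows "(\<integral>\<^sup>+r. ennreal (\<phi> (\<pi> r x)) * indicator {t..<u} r \<partial>lborel) = ennreal (\<Phi> x u - \<Phi> x t)"
proof -
  have [measurable]: "x \<in> space m" by fact
  have [measurable]: "\<pi> t x \<in> space m" by (rule flow_in_space[OF x])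
  have "(\<integral>\<^sup>+r. ennreal (\<phi> (\<pi> r x)) * indicator {t..<u} r \<partial>lborel)
      = (\<integral>\<^sup>+r. ennreal (\<phi> (\<pi> r x)) * indicator {t..u} r \<partial>lborel)"
    using AE_lborel_singleton[of u]
    by (intro nn_integral_cong_AE) (auto elim!: eventually_mono simp: indicator_def)
  also have "\<dots> = (\<integral>\<^sup>+r. ennreal (\<phi> (\<pi> (t + 1 * r) x)) * indicator {t..u} (t + 1 * r) \<partial>lborel)"
    by (subst nn_integral_real_affine[of _ 1 t]) auto
  also have "\<dots> = (\<integral>\<^sup>+r. ennreal (indicator {0..u - t} r *\<^sub>R \<phi> (\<pi> r (\<pi> t x))) \<partial>lborel)"
    by (intro nn_integral_cong) (auto simp: indicator_def flow_add[OF t(1) _ x])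
  also have "\<dots> = ennreal (\<Phi> (\<pi> t x) (u - t))"
    unfolding cumulative_rate_def set_lebesgue_integral_def
    using rate_integrable[OF flow_in_space[OF x], of "u - t" t] rate_flow_nonneg[OF flow_in_space[OF x]]
    by (intro nn_integral_eq_integral) (auto simp: set_integrable_def)
  also have "\<Phi> (\<pi> t x) (u - t) = \<Phi> x u - \<Phi> x t"
    using cumulative_rate_add[OF x t(1), of "u - t"] t by simp
  finally show ?thesis .
qed

text \<open>The function \<open>r \<mapsto> exp (- \<Phi> x r)\<close> is only absolutely
  continuous, so the fundamental theorem of calculus for continuous integrands does not apply.
  Instead write \<open>exp (- \<Phi> x r)\<close> as the integral of \<open>exp (- q)\<close>
  over \<open>q > \<Phi> x r\<close> and exchange the integrals: the condition on
  \<open>r\<close> becomes \<open>r < \<tau> x q\<close>, and the rate integrates to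
  \<open>\<Phi> x (\<tau> x q) - \<Phi> x t = q - \<Phi> x t\<close>.\<close>

lemma hazard_tail:
  assumes x: "x \<in> space m" and t: "0 \<le> t"
  shows "(\<integral>\<^sup>+r. ennreal (exp (- \<Phi> x r)) * ennreal (\<phi> (\<pi> r x)) * indicator {t..} r \<partial>lborel)
    = ennreal (exp (- \<Phi> x t))"
proof -
  have [measurable]: "x \<in> space m" by fact
  let ?h = "\<lambda>r q. ennreal (exp (- q)) * (ennreal (\<phi> (\<pi> r x)) * (if t \<le> r \<and> \<Phi> x r < q then 1 else 0))"
  have "(\<integral>\<^sup>+r. ennreal (exp (- \<Phi> x r)) * ennreal (\<phi> (\<pi> r x)) * indicator {t..} r \<partial>lborel)
      = (\<integral>\<^sup>+r. (\<integral>\<^sup>+q. ?h r q \<partial>lborel) \<partial>lborel)"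
  proof (intro nn_integral_cong)
    fix r
    have "(\<integral>\<^sup>+q. ?h r q \<partial>lborel)
        = (\<integral>\<^sup>+q. ennreal (exp (- q)) * indicator {\<Phi> x r<..} q * (ennreal (\<phi> (\<pi> r x)) * indicator {t..} r) \<partial>lborel)"
      by (intro nn_integral_cong) (auto simp: indicator_def)
    also have "\<dots> = ennreal (exp (- \<Phi> x r)) * (ennreal (\<phi> (\<pi> r x)) * indicator {t..} r)"
      by (subst nn_integral_multc) (auto simp: exp_tail)
    finally show "ennreal (exp (- \<Phi> x r)) * ennreal (\<phi> (\<pi> r x)) * indicator {t..} r
        = (\<integral>\<^sup>+q. ?h r q \<partial>lborel)" by (simp add: mult.assoc)
  qed
  also have "\<dots> = (\<integral>\<^sup>+q. (\<integral>\<^sup>+r. ?h r q \<partial>lborel) \<partial>lborel)"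
    by (rule lborel_pair.Fubini') measurable
  also have "\<dots> = (\<integral>\<^sup>+q. ennreal (exp (- q)) * ennreal (q - \<Phi> x t) \<partial>lborel)"
  proof (intro nn_integral_cong)
    fix q
    have "(\<integral>\<^sup>+r. ?h r q \<partial>lborel)
        = ennreal (exp (- q)) * (\<integral>\<^sup>+r. ennreal (\<phi> (\<pi> r x)) * indicator {t..<\<tau> x q} r \<partial>lborel)"
      using t less_inverse_iff[OF x]
      by (subst nn_integral_cmult[symmetric]) (auto intro!: nn_integral_cong simp: indicator_def)
    also have "(\<integral>\<^sup>+r. ennreal (\<phi> (\<pi> r x)) * indicator {t..<\<tau> x q} r \<partial>lborel) = ennreal (q - \<Phi> x t)"
    proof (cases "t < \<tau> x q")
      case True
      then have "\<Phi> x t < q" using less_inverse_iff[OF x t] by simp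
      then have "0 \<le> q" using cumulative_rate_nonneg[OF x, of t] by simp
      then show ?thesis using rate_integral[OF x t, of "\<tau> x q"] True by (simp add: cumulative_rate_inverse_eq[OF x])
    next
      case False
      then have "q \<le> \<Phi> x t" using less_inverse_iff[OF x t] by simp
      with False show ?thesis by (simp add: ennreal_neg)
    qed
    finally show "(\<integral>\<^sup>+r. ?h r q \<partial>lborel) = ennreal (exp (- q)) * ennreal (q - \<Phi> x t)" .
  qed
  also have "\<dots> = ennreal (exp (- \<Phi> x t))"
    by (rule exp_tail_mean)
  finally show ?thesis .
qed

section \<open>The expansion of the minimal process by the number of jumps\<close>

text \<open>The indicator lets the operator vanish at negative times. Convolutions over
  \<open>[0,t]\<close>, as in \<open>after_jumps\<close> below, can then be written as integrals
  over the whole line.\<close>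

definition killed :: "real \<Rightarrow> ('a \<Rightarrow> ennreal) \<Rightarrow> 'a \<Rightarrow> ennreal" where
  "killed t f x = indicator {0..} t * ennreal (exp (- \<Phi> x t)) * f (\<pi> t x)"

text \<open>The jump rate is included, so this is the adjoint of
  \<open>u \<mapsto> P (\<phi> u)\<close>.\<close>

definition jump :: "('a \<Rightarrow> ennreal) \<Rightarrow> 'a \<Rightarrow> ennreal" where
  "jump f x = ennreal (\<phi> x) * (\<integral>\<^sup>+y. f y \<partial>J x)"

text \<open>The contribution to \<open>\<bbbE>\<^sub>x f(X(t))\<close> of the paths with exactly
  \<open>n\<close> jumps up to time \<open>t\<close>, by recursion over the first jump time
  \<open>r\<close>: the dual of the \<open>n\<close>-th term of the Dyson-Phillips series.\<close>

primrec after_jumps :: "nat \<Rightarrow> real \<Rightarrow> ('a \<Rightarrow> ennreal) \<Rightarrow> 'a \<Rightarrow> ennreal" where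
  "after_jumps 0 = killed"
| "after_jumps (Suc n) = (\<lambda>t f x. \<integral>\<^sup>+r. killed r (jump (after_jumps n (t - r) f)) x \<partial>lborel)"

definition transition :: "real \<Rightarrow> ('a \<Rightarrow> ennreal) \<Rightarrow> 'a \<Rightarrow> ennreal" where
  "transition t f x = (\<Sum>n. after_jumps n t f x)"

lemma jump_subprob [measurable]: "J \<in> m \<rightarrow>\<^sub>M subprob_algebra m"
  using jump_measurable by (rule measurable_prob_algebraD)

lemma sets_jump: "x \<in> space m \<Longrightarrow> sets (J x) = sets m"
  using measurable_space[OF jump_measurable] by (auto simp: space_prob_algebra)

lemma space_jump: "x \<in> space m \<Longrightarrow> space (J x) = space m"
  by (rule sets_eq_imp_space_eq[OF sets_jump])

lemma prob_space_jump: "x \<in> space m \<Longrightarrow> prob_space (J x)"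
  using measurable_space[OF jump_measurable] by (auto simp: space_prob_algebra)

lemma killed_measurable:
  assumes F: "(\<lambda>(p, y). F p y) \<in> borel_measurable (P \<Otimes>\<^sub>M m)"
    and [measurable]: "g \<in> borel_measurable P" "k \<in> P \<rightarrow>\<^sub>M m"
  shows "(\<lambda>p. killed (g p) (F p) (k p)) \<in> borel_measurable P"
proof -
  have [measurable]: "(\<lambda>p. F p (\<pi> (g p) (k p))) \<in> borel_measurable P"
    using measurable_compose[OF measurable_Pair F, of "\<lambda>p. p" P "\<lambda>p. \<pi> (g p) (k p)"] by simp
  have "(\<lambda>p. (if 0 \<le> g p then 1 else 0) * ennreal (exp (- \<Phi> (k p) (g p))) * F p (\<pi> (g p) (k p)))
      \<in> borel_measurable P"
    by measurable
  then show ?thesis by (simp add: killed_def[abs_def] indicator_def)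
qed

lemma killed_fixed_measurable [measurable (raw)]:
  assumes [measurable]: "f \<in> borel_measurable m" "g \<in> borel_measurable P" "k \<in> P \<rightarrow>\<^sub>M m"
  shows "(\<lambda>p. killed (g p) f (k p)) \<in> borel_measurable P"
  by (rule killed_measurable) measurable

lemma jump_op_measurable:
  assumes F: "(\<lambda>(p, y). F p y) \<in> borel_measurable (P \<Otimes>\<^sub>M m)" and [measurable]: "k \<in> P \<rightarrow>\<^sub>M m"
  shows "(\<lambda>p. jump (F p) (k p)) \<in> borel_measurable P"
  unfolding jump_def
  by (intro borel_measurable_times_ennreal nn_integral_measurable_subprob_algebra2[OF F]
      measurable_compose[OF assms(2) jump_subprob]) measurable

lemma after_jumps_measurable [measurable (raw)]:
  assumes f[measurable]: "f \<in> borel_measurable m"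
    and g: "g \<in> borel_measurable P" and k: "k \<in> P \<rightarrow>\<^sub>M m"
  shows "(\<lambda>p. after_jumps n (g p) f (k p)) \<in> borel_measurable P"
proof -
  have "(\<lambda>p. after_jumps n (fst p) f (snd p)) \<in> borel_measurable (borel \<Otimes>\<^sub>M m)"
  proof (induction n)
    case 0
    then show ?case by simp
  next
    case (Suc n)
    \<comment> \<open>the induction hypothesis is transported through \<open>J\<close>, then through the killed flow, and finally integrated over \<open>r\<close>\<close>
    let ?P = "(borel \<Otimes>\<^sub>M m) \<Otimes>\<^sub>M lborel"
    have "(\<lambda>q. after_jumps n (fst (fst (fst (fst q))) - snd (fst (fst q))) f (snd q))
        \<in> borel_measurable ((?P \<Otimes>\<^sub>M m) \<Otimes>\<^sub>M m)"
      using measurable_compose[OF measurable_Pair Suc,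
          of "\<lambda>q. fst (fst (fst (fst q))) - snd (fst (fst q))" "(?P \<Otimes>\<^sub>M m) \<Otimes>\<^sub>M m" snd] by simp
    then have "(\<lambda>q. jump (after_jumps n (fst (fst (fst q)) - snd (fst q)) f) (snd q))
        \<in> borel_measurable (?P \<Otimes>\<^sub>M m)"
      by (intro jump_op_measurable) (simp_all add: split_beta')
    then have "(\<lambda>p. killed (snd p) (jump (after_jumps n (fst (fst p) - snd p) f)) (snd (fst p)))
        \<in> borel_measurable ?P"
      by (intro killed_measurable) (simp_all add: split_beta')
    then show ?case
      by (auto simp: split_beta' intro!: lborel.borel_measurable_nn_integral)
  qed
  from measurable_compose[OF measurable_Pair this, OF g k] show ?thesis by simp
qed

end

lemma ennreal_suminf_swap:
  fixes a :: "nat \<Rightarrow> nat \<Rightarrow> ennreal"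
  shows "(\<Sum>n. \<Sum>k. a n k) = (\<Sum>k. \<Sum>n. a n k)"
  using nn_integral_suminf[of "\<lambda>k n. a n k" "count_space UNIV"]
  by (simp add: nn_integral_count_space_nat)

text \<open>Sum the array \<open>a k (n - k)\<close>, extended by zero to \<open>n < k\<close>, in
  the other order.\<close>

lemma ennreal_Cauchy_product:
  fixes a :: "nat \<Rightarrow> nat \<Rightarrow> ennreal"
  shows "(\<Sum>n. \<Sum>k\<le>n. a k (n - k)) = (\<Sum>k. \<Sum>j. a k j)"
proof -
  have "(\<Sum>n. \<Sum>k\<le>n. a k (n - k)) = (\<Sum>n. \<Sum>k. if k \<le> n then a k (n - k) else 0)"
  proof (rule suminf_cong)
    fix n
    have "(\<Sum>k. if k \<le> n then a k (n - k) else 0) = (\<Sum>k\<le>n. if k \<le> n then a k (n - k) else 0)"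
      by (intro suminf_finite) auto
    then show "(\<Sum>k\<le>n. a k (n - k)) = (\<Sum>k. if k \<le> n then a k (n - k) else 0)" by simp
  qed
  also have "\<dots> = (\<Sum>k. \<Sum>n. if k \<le> n then a k (n - k) else 0)"
    by (rule ennreal_suminf_swap)
  also have "\<dots> = (\<Sum>k. \<Sum>j. a k j)"
  proof (rule suminf_cong)
    fix k
    show "(\<Sum>n. if k \<le> n then a k (n - k) else 0) = (\<Sum>j. a k j)"
      using suminf_offset[OF summableI, of "\<lambda>n. if k \<le> n then a k (n - k) else 0" k] by simp
  qed
  finally show ?thesis .
qed

context pdmp_flow
begin

lemma jump_after_measurable [measurable (raw)]:
  assumes [measurable]: "f \<in> borel_measurable m" "h \<in> borel_measurable P" "k \<in> P \<rightarrow>\<^sub>M m"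
  shows "(\<lambda>p. jump (after_jumps n (h p) f) (k p)) \<in> borel_measurable P"
proof (rule jump_op_measurable[OF _ assms(3)])
  show "(\<lambda>(p, y). after_jumps n (h p) f y) \<in> borel_measurable (P \<Otimes>\<^sub>M m)"
    unfolding split_beta' by (rule after_jumps_measurable) measurable
qed

lemma killed_jump_after_measurable [measurable (raw)]:
  assumes [measurable]: "f \<in> borel_measurable m" "g \<in> borel_measurable P" "h \<in> borel_measurable P" "k \<in> P \<rightarrow>\<^sub>M m"
  shows "(\<lambda>p. killed (g p) (jump (after_jumps n (h p) f)) (k p)) \<in> borel_measurable P"
proof (rule killed_measurable[OF _ assms(2,4)])
  show "(\<lambda>(p, y). jump (after_jumps n (h p) f) y) \<in> borel_measurable (P \<Otimes>\<^sub>M m)"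
    unfolding split_beta' by (rule jump_after_measurable) measurable
qed

lemma killed_neg: "t < 0 \<Longrightarrow> killed t f x = 0"
  by (simp add: killed_def)

lemma kernel_operator_killed: "kernel_operator m (killed t)"
proof (rule kernel_operatorI)
  fix f :: "'a \<Rightarrow> ennreal" assume [measurable]: "f \<in> borel_measurable m"
  show "killed t f \<in> borel_measurable m"
    using killed_fixed_measurable[of f "\<lambda>_. t" m "\<lambda>x. x"] by simp
qed (auto simp: killed_def flow_in_space ac_simps)

lemma measurable_jump: "x \<in> space m \<Longrightarrow> f \<in> measurable m L \<Longrightarrow> f \<in> measurable (J x) L"
  using measurable_cong_sets[OF sets_jump refl] by blast

lemma kernel_operator_average: "kernel_operator m (\<lambda>f x. \<integral>\<^sup>+y. f y \<partial>J x)"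
proof (rule kernel_operatorI)
  fix f :: "'a \<Rightarrow> ennreal" assume [measurable]: "f \<in> borel_measurable m"
  have "(\<lambda>(x, y). f y) \<in> borel_measurable (m \<Otimes>\<^sub>M m)" by measurable
  from nn_integral_measurable_subprob_algebra2[OF this jump_subprob]
  show "(\<lambda>x. \<integral>\<^sup>+y. f y \<partial>J x) \<in> borel_measurable m" .
next
  fix f :: "nat \<Rightarrow> 'a \<Rightarrow> ennreal" and x
  assume "\<And>i. f i \<in> borel_measurable m" and "x \<in> space m"
  then show "(\<integral>\<^sup>+y. (\<Sum>i. f i y) \<partial>J x) = (\<Sum>i. \<integral>\<^sup>+y. f i y \<partial>J x)"
    by (subst nn_integral_suminf) (auto simp: measurable_jump)
next
  fix c :: ennreal and f :: "'a \<Rightarrow> ennreal" and x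
  assume "f \<in> borel_measurable m" and "x \<in> space m"
  then show "(\<integral>\<^sup>+y. c * f y \<partial>J x) = c * (\<integral>\<^sup>+y. f y \<partial>J x)"
    by (subst nn_integral_cmult) (auto simp: measurable_jump)
next
  fix f g :: "'a \<Rightarrow> ennreal" and x
  assume "\<And>x. x \<in> space m \<Longrightarrow> f x = g x" "x \<in> space m"
  then show "(\<integral>\<^sup>+y. f y \<partial>J x) = (\<integral>\<^sup>+y. g y \<partial>J x)"
    by (intro nn_integral_cong) (simp add: space_jump)
qed

lemma kernel_operator_jump: "kernel_operator m jump"
  using kernel_operator_weight[OF kernel_operator_average, of "\<lambda>x. ennreal (\<phi> x)"]
  by (simp add: jump_def[abs_def])

lemma kernel_operator_killed_jump: "kernel_operator m (\<lambda>f. killed r (jump f))"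
  by (rule kernel_operator_comp[OF kernel_operator_killed kernel_operator_jump])

lemma kernel_operator_after_jumps: "kernel_operator m (after_jumps n t)"
proof (induction n arbitrary: t)
  case 0
  show ?case by (simp add: kernel_operator_killed)
next
  case (Suc n)
  show ?case unfolding after_jumps.simps
  proof (rule kernel_operator_integral[OF lborel.sigma_finite_measure_axioms])
    fix r
    show "kernel_operator m (\<lambda>f. killed r (jump (after_jumps n (t - r) f)))"
      by (rule kernel_operator_comp[OF kernel_operator_killed_jump Suc])
  next
    fix f :: "'a \<Rightarrow> ennreal" assume [measurable]: "f \<in> borel_measurable m"
    show "(\<lambda>(x, r). killed r (jump (after_jumps n (t - r) f)) x) \<in> borel_measurable (m \<Otimes>\<^sub>M lborel)"
      unfolding split_beta' by (rule killed_jump_after_measurable) measurable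
  qed
qed

lemma kernel_operator_transition: "kernel_operator m (transition t)"
  using kernel_operator_series[OF kernel_operator_after_jumps] by (simp add: transition_def[abs_def])

lemma transition_measurable [measurable (raw)]:
  assumes [measurable]: "f \<in> borel_measurable m" "g \<in> borel_measurable P" "k \<in> P \<rightarrow>\<^sub>M m"
  shows "(\<lambda>p. transition (g p) f (k p)) \<in> borel_measurable P"
  unfolding transition_def by measurable

lemma after_jumps_neg: "t < 0 \<Longrightarrow> x \<in> space m \<Longrightarrow> after_jumps n t f x = 0"
proof (induction n arbitrary: t x)
  case (Suc n)
  have "killed r (jump (after_jumps n (t - r) f)) x = 0" for r
  proof (cases "r < 0")
    case False
    have "killed r (jump (after_jumps n (t - r) f)) x = killed r (jump (\<lambda>_. 0)) x"
      using False Suc.prems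
      by (intro kernel_operator_cong[OF kernel_operator_killed_jump]
          Suc.IH) auto
    then show ?thesis by (simp add: killed_def jump_def)
  qed (simp add: killed_neg)
  then show ?case by simp
qed (simp add: killed_neg)

lemma transition_neg: "t < 0 \<Longrightarrow> x \<in> space m \<Longrightarrow> transition t f x = 0"
  by (simp add: transition_def after_jumps_neg)

lemma killed_add:
  "0 \<le> s \<Longrightarrow> 0 \<le> t \<Longrightarrow> x \<in> space m \<Longrightarrow> killed (s + t) f x = killed s (killed t f) x"
  by (simp add: killed_def cumulative_rate_add flow_add exp_add[symmetric] ennreal_mult[symmetric]
      mult.assoc[symmetric])

text \<open>Sort the paths with \<open>n\<close> jumps in \<open>[0, s + t]\<close> by the number
  \<open>k\<close> of jumps up to time \<open>s\<close>. In the induction step the first jump either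
  falls into \<open>[0, s]\<close>, where the hypothesis applies to the remaining time, or after
  \<open>s\<close>, which is the term \<open>k = 0\<close>.\<close>

lemma after_jumps_add:
  assumes "0 \<le> s" "0 \<le> t" "x \<in> space m" and [measurable]: "f \<in> borel_measurable m"
  shows "after_jumps n (s + t) f x = (\<Sum>k\<le>n. after_jumps k s (after_jumps (n - k) t f) x)"
  using assms(1,3)
proof (induction n arbitrary: s x)
  case 0
  then show ?case using assms(2) by (simp add: killed_add)
next
  case (Suc n)
  note s = \<open>0 \<le> s\<close> and x [measurable] = \<open>x \<in> space m\<close>
  let ?W = "\<lambda>r f. killed r (jump f)"
  have W: "kernel_operator m (?W r)" for r
    by (rule kernel_operator_killed_jump)
  let ?H = "\<lambda>r. ?W r (after_jumps n (s + t - r) f) x"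
  have A[measurable]: "after_jumps k t f \<in> borel_measurable m" for k t
    by (rule kernel_operator_measurable[OF kernel_operator_after_jumps]) fact
  have "after_jumps (Suc n) (s + t) f x
      = (\<integral>\<^sup>+r. ?H r * indicator {..s} r + ?H r * indicator {s<..} r \<partial>lborel)"
    by (auto intro!: nn_integral_cong simp: indicator_def)
  also have "\<dots> = (\<integral>\<^sup>+r. ?H r * indicator {..s} r \<partial>lborel) + (\<integral>\<^sup>+r. ?H r * indicator {s<..} r \<partial>lborel)"
    by (intro nn_integral_add) measurable
  also have "(\<integral>\<^sup>+r. ?H r * indicator {..s} r \<partial>lborel)
      = (\<integral>\<^sup>+r. (\<Sum>k\<le>n. ?W r (after_jumps k (s - r) (after_jumps (n - k) t f)) x) \<partial>lborel)"
  proof (intro nn_integral_cong)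
    fix r
    consider "r < 0" | "s < r" | "0 \<le> r" "r \<le> s" by linarith
    then show "?H r * indicator {..s} r
        = (\<Sum>k\<le>n. ?W r (after_jumps k (s - r) (after_jumps (n - k) t f)) x)"
    proof cases
      case 2
      have "?W r (after_jumps k (s - r) (after_jumps (n - k) t f)) x = ?W r (\<lambda>_. 0) x" for k
        using 2 by (intro kernel_operator_cong[OF W _ x] after_jumps_neg) auto
      then show ?thesis using 2 by (simp add: kernel_operator_zero[OF W x])
    next
      case 3
      have "?H r = ?W r (\<lambda>y. \<Sum>k<Suc n. after_jumps k (s - r) (after_jumps (n - k) t f) y) x"
      proof (intro kernel_operator_cong[OF W _ x])
        fix y assume "y \<in> space m"
        then show "after_jumps n (s + t - r) f y
            = (\<Sum>k<Suc n. after_jumps k (s - r) (after_jumps (n - k) t f) y)"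
          using Suc.IH[of "s - r" y] 3 by (simp add: lessThan_Suc_atMost algebra_simps)
      qed
      also have "\<dots> = (\<Sum>k<Suc n. ?W r (after_jumps k (s - r) (after_jumps (n - k) t f)) x)"
        by (intro kernel_operator_sum[OF W _ x] kernel_operator_measurable[OF kernel_operator_after_jumps] A)
      finally show ?thesis using 3 by (simp add: lessThan_Suc_atMost)
    qed (simp add: killed_neg)
  qed
  also have "\<dots> = (\<Sum>k\<le>n. after_jumps (Suc k) s (after_jumps (n - k) t f) x)"
    by (subst nn_integral_sum) auto
  also have "(\<integral>\<^sup>+r. ?H r * indicator {s<..} r \<partial>lborel) = (\<integral>\<^sup>+r. ?H r * indicator {s..} r \<partial>lborel)"
    using AE_lborel_singleton[of s]
    by (intro nn_integral_cong_AE) (auto elim!: eventually_mono simp: indicator_def)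
  also have "\<dots> = (\<integral>\<^sup>+r. ?H (s + 1 * r) * indicator {s..} (s + 1 * r) \<partial>lborel)"
    by (subst nn_integral_real_affine[of _ 1 s]) auto
  also have "\<dots> = (\<integral>\<^sup>+r. killed s (?W r (after_jumps n (t - r) f)) x \<partial>lborel)"
  proof (intro nn_integral_cong)
    fix r
    show "?H (s + 1 * r) * indicator {s..} (s + 1 * r) = killed s (?W r (after_jumps n (t - r) f)) x"
    proof (cases "r < 0")
      case True
      then show ?thesis by (simp add: killed_def)
    next
      case False
      then show ?thesis by (simp add: killed_add[OF s _ x])
    qed
  qed
  also have "\<dots> = after_jumps 0 s (after_jumps (Suc n) t f) x"
    using flow_in_space[OF x, of s] s unfolding after_jumps.simps
    by (simp add: killed_def[of s]) (subst nn_integral_cmult, auto)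
  finally show ?case
    by (subst sum.atMost_Suc_shift) (simp add: add.commute)
qed

lemma transition_add:
  assumes "0 \<le> s" "0 \<le> t" "x \<in> space m" "f \<in> borel_measurable m"
  shows "transition (s + t) f x = transition s (transition t f) x"
proof -
  have "transition s (transition t f) x = (\<Sum>k. \<Sum>j. after_jumps k s (after_jumps j t f) x)"
    unfolding transition_def[of s] transition_def[of t, abs_def]
    by (intro suminf_cong kernel_operator_suminf[OF kernel_operator_after_jumps]
        kernel_operator_measurable[OF kernel_operator_after_jumps] assms)
  also have "\<dots> = transition (s + t) f x"
    unfolding transition_def[of "s + t"] after_jumps_add[OF assms]
    by (rule ennreal_Cauchy_product[symmetric])
  finally show ?thesis ..
qed

lemma jump_one: "x \<in> space m \<Longrightarrow> jump (\<lambda>_. 1) x = ennreal (\<phi> x)"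
  using prob_space.emeasure_space_1[OF prob_space_jump] by (simp add: jump_def)

text \<open>By induction the paths with at least one jump contribute at most the probability
  \<open>1 - exp (- \<Phi> x t)\<close> of a jump in \<open>[0, t]\<close>, which the term
  without jumps complements to \<open>1\<close>.\<close>

lemma after_jumps_sum_le_1:
  "x \<in> space m \<Longrightarrow> (\<Sum>k<n. after_jumps k t (\<lambda>_. 1) x) \<le> 1"
proof (induction n arbitrary: t x)
  case (Suc n)
  note x [measurable] = \<open>x \<in> space m\<close>
  show ?case
  proof (cases "0 \<le> t")
    case t: True
    let ?W = "\<lambda>r f. killed r (jump f)"
    have W: "kernel_operator m (?W r)" for r
      by (rule kernel_operator_killed_jump)
    let ?h = "\<lambda>r. ennreal (exp (- \<Phi> x r)) * ennreal (\<phi> (\<pi> r x))"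
    have A[measurable]: "after_jumps k t (\<lambda>_. 1) \<in> borel_measurable m" for k t
      by (rule kernel_operator_measurable[OF kernel_operator_after_jumps]) simp
    have "(\<Sum>k<n. after_jumps (Suc k) t (\<lambda>_. 1) x)
        = (\<integral>\<^sup>+r. (\<Sum>k<n. ?W r (after_jumps k (t - r) (\<lambda>_. 1)) x) \<partial>lborel)"
      by (subst nn_integral_sum) auto
    also have "\<dots> \<le> (\<integral>\<^sup>+r. ?h r * indicator {0..<t} r \<partial>lborel)"
    proof (intro nn_integral_mono_AE)
      have "(\<Sum>k<n. ?W r (after_jumps k (t - r) (\<lambda>_. 1)) x) \<le> ?h r * indicator {0..<t} r" if r: "r \<noteq> t" for r
      proof -
        consider "r < 0" | "t < r" | "0 \<le> r" "r < t"
          using r linorder_less_linear[of r t] by linarith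
        then show ?thesis
        proof cases
          case 2
          have "?W r (after_jumps k (t - r) (\<lambda>_. 1)) x = ?W r (\<lambda>_. 0) x" for k
            using 2 by (intro kernel_operator_cong[OF W _ x] after_jumps_neg) auto
          then show ?thesis by (simp add: kernel_operator_zero[OF W x])
        next
          case 3
          have "(\<Sum>k<n. ?W r (after_jumps k (t - r) (\<lambda>_. 1)) x)
              = ?W r (\<lambda>y. \<Sum>k<n. after_jumps k (t - r) (\<lambda>_. 1) y) x"
            by (intro kernel_operator_sum[OF W _ x, symmetric] A)
          also have "\<dots> \<le> ?W r (\<lambda>_. 1) x"
            by (intro kernel_operator_mono[OF W _ _ x] Suc.IH) auto
          also have "\<dots> = ?h r * indicator {0..<t} r"
            using 3 by (simp add: killed_def jump_one flow_in_space[OF x])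
          finally show ?thesis .
        qed (simp add: killed_neg)
      qed
      then show "AE r in lborel. (\<Sum>k<n. ?W r (after_jumps k (t - r) (\<lambda>_. 1)) x) \<le> ?h r * indicator {0..<t} r"
        using AE_lborel_singleton[of t] by (auto elim!: eventually_mono)
    qed
    finally have "(\<Sum>k<Suc n. after_jumps k t (\<lambda>_. 1) x)
        \<le> ennreal (exp (- \<Phi> x t)) + (\<integral>\<^sup>+r. ?h r * indicator {0..<t} r \<partial>lborel)"
      unfolding sum.lessThan_Suc_shift using t by (intro add_mono) (auto simp: killed_def)
    also have "\<dots> = (\<integral>\<^sup>+r. ?h r * indicator {t..} r + ?h r * indicator {0..<t} r \<partial>lborel)"
      unfolding hazard_tail[OF x t, symmetric] by (intro nn_integral_add[symmetric]) auto
    also have "\<dots> = (\<integral>\<^sup>+r. ?h r * indicator {0..} r \<partial>lborel)"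
      using t by (intro nn_integral_cong) (auto simp: indicator_def)
    also have "\<dots> = 1"
      using hazard_tail[OF x, of 0] by (simp add: cumulative_rate_zero)
    finally show ?thesis .
  next
    case False
    then show ?thesis using x by (simp add: after_jumps_neg del: sum.lessThan_Suc)
  qed
qed simp

lemma transition_le_1: "x \<in> space m \<Longrightarrow> transition t (\<lambda>_. 1) x \<le> 1"
  unfolding transition_def suminf_eq_SUP by (intro SUP_least after_jumps_sum_le_1)

lemma killed_le_transition: "killed t f x \<le> transition t f x"
proof -
  have "killed t f x = (\<Sum>k<1. after_jumps k t f x)" by simp
  also have "\<dots> \<le> transition t f x"
    unfolding transition_def suminf_eq_SUP by (rule SUP_upper) simp
  finally show ?thesis .
qed

lemma killed_le_1: "x \<in> space m \<Longrightarrow> killed t (\<lambda>_. 1) x \<le> 1"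
  using killed_le_transition transition_le_1 order_trans by blast

section \<open>Resolvents\<close>

definition killed_resolvent :: "('a \<Rightarrow> ennreal) \<Rightarrow> 'a \<Rightarrow> ennreal" where
  "killed_resolvent f x = (\<integral>\<^sup>+t. ennreal (exp (- t)) * killed t f x \<partial>lborel)"

definition after_jumps_resolvent :: "nat \<Rightarrow> ('a \<Rightarrow> ennreal) \<Rightarrow> 'a \<Rightarrow> ennreal" where
  "after_jumps_resolvent n f x = (\<integral>\<^sup>+t. ennreal (exp (- t)) * after_jumps n t f x \<partial>lborel)"

definition resolvent :: "('a \<Rightarrow> ennreal) \<Rightarrow> 'a \<Rightarrow> ennreal" where
  "resolvent f x = (\<integral>\<^sup>+t. ennreal (exp (- t)) * transition t f x \<partial>lborel)"

lemma kernel_operator_killed_resolvent: "kernel_operator m killed_resolvent"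
  unfolding killed_resolvent_def[abs_def]
  by (rule kernel_operator_integral[OF lborel.sigma_finite_measure_axioms])
    (auto intro!: kernel_operator_weight[OF kernel_operator_killed])

lemma kernel_operator_after_jumps_resolvent: "kernel_operator m (after_jumps_resolvent n)"
  unfolding after_jumps_resolvent_def[abs_def]
  by (rule kernel_operator_integral[OF lborel.sigma_finite_measure_axioms])
    (auto intro!: kernel_operator_weight[OF kernel_operator_after_jumps])

lemma kernel_operator_resolvent: "kernel_operator m resolvent"
  unfolding resolvent_def[abs_def]
  by (rule kernel_operator_integral[OF lborel.sigma_finite_measure_axioms])
    (auto intro!: kernel_operator_weight[OF kernel_operator_transition])

lemma resolvent_series:
  assumes [measurable]: "f \<in> borel_measurable m" and x [measurable]: "x \<in> space m"
  shows "resolvent f x = (\<Sum>n. after_jumps_resolvent n f x)"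
  unfolding resolvent_def transition_def after_jumps_resolvent_def
  by (subst nn_integral_suminf[symmetric]) auto

lemma resolvent_le_1:
  assumes x: "x \<in> space m" shows "resolvent (\<lambda>_. 1) x \<le> 1"
proof -
  have "resolvent (\<lambda>_. 1) x \<le> (\<integral>\<^sup>+t. ennreal (exp (- t)) * indicator {0::real..} t \<partial>lborel)"
    unfolding resolvent_def
  proof (intro nn_integral_mono mult_left_mono)
    fix t
    show "transition t (\<lambda>_. 1) x \<le> indicator {0..} t"
      using transition_le_1[OF x, of t] transition_neg[OF _ x, of t] by (cases "t < 0") auto
  qed simp
  then show ?thesis by (simp add: exp_neg_nn_integral)
qed

lemma killed_resolvent_le: "killed_resolvent f x \<le> resolvent f x"
  unfolding killed_resolvent_def resolvent_def
  by (intro nn_integral_mono mult_left_mono killed_le_transition) simp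

text \<open>Tonelli for the kernel \<open>J\<close>.\<close>

lemma killed_jump_integral:
  assumes F: "(\<lambda>(s, y). F s y) \<in> borel_measurable (lborel \<Otimes>\<^sub>M m)" and x: "x \<in> space m"
  shows "killed r (jump (\<lambda>y. \<integral>\<^sup>+s. F s y \<partial>lborel)) x = (\<integral>\<^sup>+s. killed r (jump (F s)) x \<partial>lborel)"
proof -
  have j: "jump (\<lambda>y. \<integral>\<^sup>+s. F s y \<partial>lborel) z = (\<integral>\<^sup>+s. jump (F s) z \<partial>lborel)"
    and jm: "(\<lambda>s. jump (F s) z) \<in> borel_measurable lborel" if z: "z \<in> space m" for z
  proof -
    interpret J: prob_space "J z" by (rule prob_space_jump[OF z])
    interpret pair_sigma_finite lborel "J z" ..
    have F': "(\<lambda>(s, y). F s y) \<in> borel_measurable (lborel \<Otimes>\<^sub>M J z)"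
      using F measurable_cong_sets[OF sets_pair_measure_cong[OF refl sets_jump[OF z]] refl] by blast
    have [measurable]: "(\<lambda>s. \<integral>\<^sup>+y. F s y \<partial>J z) \<in> borel_measurable lborel"
      by (rule J.borel_measurable_nn_integral) (use F' in simp)
    show "(\<lambda>s. jump (F s) z) \<in> borel_measurable lborel"
      unfolding jump_def by measurable
    show "jump (\<lambda>y. \<integral>\<^sup>+s. F s y \<partial>lborel) z = (\<integral>\<^sup>+s. jump (F s) z \<partial>lborel)"
      unfolding jump_def by (subst nn_integral_cmult, measurable) (subst Fubini'[OF F'], simp)
  qed
  show ?thesis
    unfolding killed_def j[OF flow_in_space[OF x]]
    by (intro nn_integral_cmult[symmetric] jm flow_in_space x)
qed

text \<open>The Laplace transform turns the convolution over the first jump time into a composition.\<close>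

lemma after_jumps_resolvent_Suc:
  assumes [measurable]: "f \<in> borel_measurable m" and x [measurable]: "x \<in> space m"
  shows "after_jumps_resolvent (Suc n) f x = killed_resolvent (jump (after_jumps_resolvent n f)) x"
proof -
  let ?W = "\<lambda>r f. killed r (jump f)"
  have W: "kernel_operator m (?W r)" for r
    by (rule kernel_operator_killed_jump)
  have A[measurable]: "after_jumps k t f \<in> borel_measurable m" for k t
    by (rule kernel_operator_measurable[OF kernel_operator_after_jumps]) fact
  have "after_jumps_resolvent (Suc n) f x
      = (\<integral>\<^sup>+t. (\<integral>\<^sup>+r. ennreal (exp (- t)) * ?W r (after_jumps n (t - r) f) x \<partial>lborel) \<partial>lborel)"
    unfolding after_jumps_resolvent_def by (simp add: nn_integral_cmult)
  also have "\<dots> = (\<integral>\<^sup>+r. (\<integral>\<^sup>+t. ennreal (exp (- t)) * ?W r (after_jumps n (t - r) f) x \<partial>lborel) \<partial>lborel)"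
    by (rule lborel_pair.Fubini') measurable
  also have "\<dots> = killed_resolvent (jump (after_jumps_resolvent n f)) x"
    unfolding killed_resolvent_def
  proof (intro nn_integral_cong)
    fix r
    have "(\<integral>\<^sup>+t. ennreal (exp (- t)) * ?W r (after_jumps n (t - r) f) x \<partial>lborel)
        = (\<integral>\<^sup>+s. ennreal (exp (- (r + 1 * s))) * ?W r (after_jumps n (r + 1 * s - r) f) x \<partial>lborel)"
      by (subst nn_integral_real_affine[of _ 1 r]) auto
    also have "\<dots> = (\<integral>\<^sup>+s. ennreal (exp (- r)) * ?W r (\<lambda>y. ennreal (exp (- s)) * after_jumps n s f y) x \<partial>lborel)"
      by (intro nn_integral_cong)
        (simp add: kernel_operator_scale[OF W A x] exp_diff exp_minus ennreal_mult[symmetric] mult.assoc[symmetric] divide_inverse)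
    also have "\<dots> = ennreal (exp (- r)) * ?W r (after_jumps_resolvent n f) x"
    proof -
      have "(\<lambda>(s, y). ennreal (exp (- s)) * after_jumps n s f y) \<in> borel_measurable (lborel \<Otimes>\<^sub>M m)"
        by measurable
      from killed_jump_integral[OF this x] show ?thesis
        unfolding after_jumps_resolvent_def[abs_def]
        by (subst nn_integral_cmult) (auto simp: kernel_operator_scale[OF W A x])
    qed
    finally show "(\<integral>\<^sup>+t. ennreal (exp (- t)) * ?W r (after_jumps n (t - r) f) x \<partial>lborel)
      = ennreal (exp (- r)) * ?W r (after_jumps_resolvent n f) x" .
  qed
  finally show ?thesis .
qed

text \<open>The resolvent equation \<open>G f = R f + R (\<phi> J G f)\<close>; it is the dual
  form of the statement that the generator of the transition semigroup extends
  \<open>A + P \<phi>\<close>.\<close>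

lemma resolvent_fixed_point:
  assumes f: "f \<in> borel_measurable m" and x: "x \<in> space m"
  shows "resolvent f x = killed_resolvent f x + killed_resolvent (jump (resolvent f)) x"
proof -
  let ?W = "\<lambda>f. killed_resolvent (jump f)"
  have W: "kernel_operator m ?W"
    by (rule kernel_operator_comp[OF kernel_operator_killed_resolvent kernel_operator_jump])
  have "resolvent f x = after_jumps_resolvent 0 f x + (\<Sum>n. after_jumps_resolvent (Suc n) f x)"
    unfolding resolvent_series[OF f x] 
    using suminf_offset[OF summableI, of "\<lambda>n. after_jumps_resolvent n f x" 1] by (simp add: add.commute)
  also have "(\<Sum>n. after_jumps_resolvent (Suc n) f x) = ?W (\<lambda>y. \<Sum>n. after_jumps_resolvent n f y) x"
    unfolding after_jumps_resolvent_Suc[OF f x]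
    by (intro kernel_operator_suminf[OF W, symmetric]
        kernel_operator_measurable[OF kernel_operator_after_jumps_resolvent] f x)
  also have "\<dots> = ?W (resolvent f) x"
    by (intro kernel_operator_cong[OF W _ x] resolvent_series[symmetric] f)
  finally show ?thesis by (simp add: after_jumps_resolvent_def killed_resolvent_def)
qed

end

section \<open>Operators on integrable functions given by their adjoints\<close>

text \<open>The indicator makes the image of a unit test a unit test on the whole type.\<close>

definition real_kernel :: "'a measure \<Rightarrow> (('a \<Rightarrow> ennreal) \<Rightarrow> 'a \<Rightarrow> ennreal) \<Rightarrow> ('a \<Rightarrow> real) \<Rightarrow> 'a \<Rightarrow> real" where
  "real_kernel m W f x = indicator (space m) x * enn2real (W (\<lambda>y. ennreal (f y)) x)"

definition adjoint_kernel :: "'a measure \<Rightarrow> (('a \<Rightarrow> ennreal) \<Rightarrow> 'a \<Rightarrow> ennreal) \<Rightarrow> (('a \<Rightarrow> real) \<Rightarrow> 'a \<Rightarrow> real) \<Rightarrow> bool" where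
  "adjoint_kernel m W T \<longleftrightarrow> (\<forall>u. integrable m u \<longrightarrow> integrable m (T u) \<and>
     (\<forall>f. unit_test m f \<longrightarrow> (\<integral>x. f x * T u x \<partial>m) = (\<integral>x. real_kernel m W f x * u x \<partial>m)))"

definition sub_markov :: "'a measure \<Rightarrow> (('a \<Rightarrow> ennreal) \<Rightarrow> 'a \<Rightarrow> ennreal) \<Rightarrow> bool" where
  "sub_markov m W \<longleftrightarrow> kernel_operator m W \<and> (\<forall>x\<in>space m. W (\<lambda>_. 1) x \<le> 1)"

lemma sub_markov_le_1:
  assumes W: "sub_markov m W" and f: "unit_test m f" and x: "x \<in> space m"
  shows "W (\<lambda>y. ennreal (f y)) x \<le> 1"
proof -
  have "W (\<lambda>y. ennreal (f y)) x \<le> W (\<lambda>_. 1) x"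
    using W f x by (intro kernel_operator_mono[of m W]) (auto simp: sub_markov_def unit_test_def)
  also have "\<dots> \<le> 1" using W x by (auto simp: sub_markov_def)
  finally show ?thesis .
qed

lemma ennreal_real_kernel:
  assumes "sub_markov m W" "unit_test m f" "x \<in> space m"
  shows "ennreal (real_kernel m W f x) = W (\<lambda>y. ennreal (f y)) x"
  using sub_markov_le_1[OF assms] assms(3)
  by (auto simp: real_kernel_def intro!: ennreal_enn2real elim: le_less_trans)

lemma unit_test_real_kernel:
  assumes W: "sub_markov m W" and f: "unit_test m f"
  shows "unit_test m (real_kernel m W f)"
  unfolding unit_test_def
proof (intro conjI allI)
  have [measurable]: "W (\<lambda>y. ennreal (f y)) \<in> borel_measurable m"
    using W f by (intro kernel_operator_measurable[of m W]) (auto simp: sub_markov_def unit_test_def)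
  show "real_kernel m W f \<in> borel_measurable m"
    unfolding real_kernel_def[abs_def] by measurable
  fix x
  show "0 \<le> real_kernel m W f x" by (simp add: real_kernel_def)
  show "real_kernel m W f x \<le> 1"
    using enn2real_mono[OF sub_markov_le_1[OF W f, of x]] by (simp add: real_kernel_def indicator_def)
qed

text \<open>All properties of \<open>T\<close> are read off from the integrals
  \<open>\<integral> f (T u) dm\<close>, which determine \<open>T u\<close> almost everywhere
  and depend linearly and positively on \<open>u\<close>. For the norm, test with the indicators of
  the sets where \<open>T u\<close> is positive and negative; their images under the kernel lie in
  \<open>[0,1]\<close>, so they differ by at most \<open>1\<close>.\<close>

lemma positive_contraction_adjoint:
  assumes m: "sigma_finite_measure m" and W: "sub_markov m W" and T: "adjoint_kernel m W T"
  shows "positive_contraction m T"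
proof -
  interpret sigma_finite_measure m by fact
  have int: "integrable m (T u)" if "integrable m u" for u
    using T that by (auto simp: adjoint_kernel_def)
  let ?f = "real_kernel m W"
  have adj: "(\<integral>x. f x * T u x \<partial>m) = (\<integral>x. ?f f x * u x \<partial>m)" if "unit_test m f" "integrable m u" for f u
    using T that by (auto simp: adjoint_kernel_def)
  have ii: "integrable m (\<lambda>x. ?f f x * u x)" if "unit_test m f" "integrable m u" for f u
    using that by (intro unit_test_integrable unit_test_real_kernel[OF W])
  have set: "(LINT x:B|m. T u x) = (\<integral>x. ?f (indicator B) x * u x \<partial>m)"
    if "B \<in> sets m" "integrable m u" for B u
    using adj[OF unit_test_indicator[OF that(1)] that(2)] by (simp add: set_lebesgue_integral_def)
  have op: "L1_operator m T"
    unfolding L1_operator_def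
  proof (intro conjI allI impI int)
    fix u v :: "'a \<Rightarrow> real" assume uv: "integrable m u" "integrable m v"
    show "AE x in m. T (\<lambda>y. u y + v y) x = T u x + T v x"
    proof (rule density_unique_real)
      fix B assume B: "B \<in> sets m"
      note t = unit_test_indicator[OF B]
      have "(LINT x:B|m. T (\<lambda>y. u y + v y) x) = (\<integral>x. ?f (indicator B) x * u x + ?f (indicator B) x * v x \<partial>m)"
        using uv B by (simp add: set distrib_left)
      also have "\<dots> = (LINT x:B|m. T u x) + (LINT x:B|m. T v x)"
        using uv B by (simp add: set ii[OF t])
      also have "\<dots> = (LINT x:B|m. T u x + T v x)"
        using int[OF uv(1)] int[OF uv(2)] B
        by (intro set_integral_add(2)[symmetric]) (auto simp: set_integrable_def intro: integrable_real_mult_indicator integrable_mult_indicator[where f="T u", simplified] integrable_mult_indicator[where f="T v", simplified])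
      finally show "(LINT x:B|m. T (\<lambda>y. u y + v y) x) = (LINT x:B|m. T u x + T v x)" .
    qed (use int uv in auto)
    show "AE x in m. T u x = T v x" if "AE x in m. u x = v x"
    proof (rule density_unique_real)
      fix B assume B: "B \<in> sets m"
      note t = unit_test_indicator[OF B]
      have "(\<integral>x. ?f (indicator B) x * u x \<partial>m) = (\<integral>x. ?f (indicator B) x * v x \<partial>m)"
        using that ii[OF t uv(1)] ii[OF t uv(2)] by (intro integral_cong_AE) auto
      then show "(LINT x:B|m. T u x) = (LINT x:B|m. T v x)" using B uv by (simp add: set)
    qed (use int uv in auto)
  next
    fix c :: real and u :: "'a \<Rightarrow> real" assume u: "integrable m u"
    show "AE x in m. T (\<lambda>y. c * u y) x = c * T u x"
    proof (rule density_unique_real)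
      fix B assume B: "B \<in> sets m"
      have "(LINT x:B|m. T (\<lambda>y. c * u y) x) = (\<integral>x. c * (?f (indicator B) x * u x) \<partial>m)"
        using u B by (simp add: set ac_simps)
      also have "\<dots> = (LINT x:B|m. c * T u x)" using u B by (simp add: set)
      finally show "(LINT x:B|m. T (\<lambda>y. c * u y) x) = (LINT x:B|m. c * T u x)" .
    qed (use int u in auto)
  qed
  have pos: "L1_nonneg m (T u)" if u: "L1_nonneg m u" for u
    unfolding L1_nonneg_def
  proof
    have ui: "integrable m u" using u by (simp add: L1_nonneg_def)
    show "integrable m (T u)" by (rule int[OF ui])
    then show "AE x in m. 0 \<le> T u x"
    proof (rule density_nonneg)
      fix B assume B: "B \<in> sets m"
      note t = unit_test_real_kernel[OF W unit_test_indicator[OF B]]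
      show "0 \<le> (LINT x:B|m. T u x)"
        unfolding set[OF B ui] using u t
        by (intro integral_nonneg_AE) (auto simp: L1_nonneg_def unit_test_def)
    qed
  qed
  have contr: "L1_norm m (T u) \<le> L1_norm m u" if u: "integrable m u" for u
  proof -
    let ?p = "indicator {x\<in>space m. 0 < T u x} :: 'a \<Rightarrow> real"
    let ?n = "indicator {x\<in>space m. T u x < 0} :: 'a \<Rightarrow> real"
    have [measurable]: "T u \<in> borel_measurable m" using int[OF u] by auto
    have t: "unit_test m ?p" "unit_test m ?n"
      by (auto intro!: unit_test_indicator)
    have "L1_norm m (T u) = (\<integral>x. ?p x * T u x - ?n x * T u x \<partial>m)"
      unfolding L1_norm_def by (intro Bochner_Integration.integral_cong) (auto simp: indicator_def)
    also have "\<dots> = (\<integral>x. ?p x * T u x \<partial>m) - (\<integral>x. ?n x * T u x \<partial>m)"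
      using t int[OF u] by (intro Bochner_Integration.integral_diff unit_test_integrable)
    also have "\<dots> = (\<integral>x. ?f ?p x * u x - ?f ?n x * u x \<partial>m)"
      using t u by (simp add: adj ii)
    also have "\<dots> \<le> (\<integral>x. \<bar>u x\<bar> \<partial>m)"
    proof (rule integral_mono)
      fix x
      have "0 \<le> ?f ?p x" "?f ?p x \<le> 1" "0 \<le> ?f ?n x" "?f ?n x \<le> 1"
        using unit_test_real_kernel[OF W t(1)] unit_test_real_kernel[OF W t(2)]
        by (auto simp: unit_test_def)
      then have "\<bar>?f ?p x - ?f ?n x\<bar> \<le> 1" by linarith
      then have "\<bar>(?f ?p x - ?f ?n x) * u x\<bar> \<le> \<bar>u x\<bar>"
        unfolding abs_mult by (simp add: mult_left_le_one_le)
      then show "?f ?p x * u x - ?f ?n x * u x \<le> \<bar>u x\<bar>"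
        by (simp add: left_diff_distrib)
    qed (use u t ii in auto)
    finally show ?thesis by (simp add: L1_norm_def)
  qed
  show ?thesis
    using op pos contr by (simp add: positive_contraction_def)
qed

text \<open>Applied to \<open>u\<close> and to \<open>- u\<close> this covers the positive and the
  negative part, because \<^const>\<open>dual_density\<close> ignores negative values.\<close>

definition positive_part_dual :: "'a measure \<Rightarrow> (('a \<Rightarrow> ennreal) \<Rightarrow> 'a \<Rightarrow> ennreal) \<Rightarrow> ('a \<Rightarrow> real) \<Rightarrow> 'a \<Rightarrow> real" where
  "positive_part_dual m W u = (SOME w. dual_density m W u w)"

definition dual_operator :: "'a measure \<Rightarrow> (('a \<Rightarrow> ennreal) \<Rightarrow> 'a \<Rightarrow> ennreal) \<Rightarrow> ('a \<Rightarrow> real) \<Rightarrow> 'a \<Rightarrow> real" where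
  "dual_operator m W u x = positive_part_dual m W u x - positive_part_dual m W (\<lambda>y. - u y) x"

lemma integral_dual_density:
  assumes W: "sub_markov m W" and f: "unit_test m f" and u: "integrable m u" and w: "dual_density m W u w"
  shows "(\<integral>x. f x * w x \<partial>m) = (\<integral>x. real_kernel m W f x * max 0 (u x) \<partial>m)"
proof -
  have "(\<integral>\<^sup>+x. ennreal (f x * w x) \<partial>m) = (\<integral>\<^sup>+x. ennreal (f x) * ennreal (w x) \<partial>m)"
    using f w by (intro nn_integral_cong) (auto simp: unit_test_def dual_density_def ennreal_mult)
  also have "\<dots> = (\<integral>\<^sup>+x. W (\<lambda>x. ennreal (f x)) x * ennreal (u x) \<partial>m)"
    using w f by (auto simp: dual_density_def unit_test_def)
  also have "\<dots> = (\<integral>\<^sup>+x. ennreal (real_kernel m W f x * max 0 (u x)) \<partial>m)"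
  proof (intro nn_integral_cong)
    fix x assume "x \<in> space m"
    then show "W (\<lambda>x. ennreal (f x)) x * ennreal (u x) = ennreal (real_kernel m W f x * max 0 (u x))"
      using ennreal_real_kernel[OF W f, of x, symmetric]
      by (simp add: ennreal_mult' real_kernel_def)
  qed
  finally have eq: "(\<integral>\<^sup>+x. ennreal (f x * w x) \<partial>m) = (\<integral>\<^sup>+x. ennreal (real_kernel m W f x * max 0 (u x)) \<partial>m)" .
  have t: "unit_test m (real_kernel m W f)" by (rule unit_test_real_kernel[OF W f])
  show ?thesis
    using f w t u eq
    by (subst (1 2) integral_eq_nn_integral)
      (auto simp: unit_test_def dual_density_def intro!: borel_measurable_times AE_I2)
qed

lemma adjoint_dual_operator:
  assumes m: "sigma_finite_measure m" and W: "sub_markov m W"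
    and ac: "\<And>B. B \<in> null_sets m \<Longrightarrow> AE x in m. W (indicator B) x = 0"
  shows "adjoint_kernel m W (dual_operator m W)"
  unfolding adjoint_kernel_def
proof (intro allI impI conjI)
  fix u :: "'a \<Rightarrow> real" assume u: "integrable m u"
  let ?w = "positive_part_dual m W"
  have d: "dual_density m W v (?w v)" if "integrable m v" for v
  proof -
    have "\<exists>w. dual_density m W v w"
    proof (rule dual_density_exists[OF m])
      show "kernel_operator m W" "\<And>x. x \<in> space m \<Longrightarrow> W (\<lambda>_. 1) x \<le> 1"
        using W by (auto simp: sub_markov_def)
    qed (fact ac that)+
    from someI_ex[OF this] show ?thesis by (simp add: positive_part_dual_def)
  qed
  have u': "integrable m (\<lambda>x. - u x)" using u by simp
  have i: "integrable m (?w u)" "integrable m (?w (\<lambda>x. - u x))"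
    using d[OF u] d[OF u'] by (auto simp: dual_density_def)
  then show "integrable m (dual_operator m W u)"
    unfolding dual_operator_def[abs_def] by simp
  fix f :: "'a \<Rightarrow> real" assume f: "unit_test m f"
  have t: "unit_test m (real_kernel m W f)" by (rule unit_test_real_kernel[OF W f])
  have "(\<integral>x. f x * dual_operator m W u x \<partial>m)
      = (\<integral>x. f x * ?w u x \<partial>m) - (\<integral>x. f x * ?w (\<lambda>x. - u x) x \<partial>m)"
    unfolding dual_operator_def right_diff_distrib using i f
    by (intro Bochner_Integration.integral_diff unit_test_integrable)
  also have "\<dots> = (\<integral>x. real_kernel m W f x * max 0 (u x) \<partial>m)
      - (\<integral>x. real_kernel m W f x * max 0 (- u x) \<partial>m)"
    by (simp add: integral_dual_density[OF W f u d[OF u]] integral_dual_density[OF W f u' d[OF u']])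
  also have "\<dots> = (\<integral>x. real_kernel m W f x * max 0 (u x) - real_kernel m W f x * max 0 (- u x) \<partial>m)"
    using u t by (intro Bochner_Integration.integral_diff[symmetric] unit_test_integrable) auto
  also have "\<dots> = (\<integral>x. real_kernel m W f x * u x \<partial>m)"
    by (intro Bochner_Integration.integral_cong) (auto simp: max_def)
  finally show "(\<integral>x. f x * dual_operator m W u x \<partial>m) = (\<integral>x. real_kernel m W f x * u x \<partial>m)" .
qed

text \<open>Nonnegative functions and indicators suffice: tests are reached by monotone limits, and signed
  functions by splitting into positive and negative part.\<close>

lemma adjoint_kernelI:
  assumes W: "sub_markov m W" and T: "L1_operator m T"
    and pos: "\<And>u. L1_nonneg m u \<Longrightarrow> L1_nonneg m (T u)"
    and dual: "\<And>u B. L1_nonneg m u \<Longrightarrow> B \<in> sets m \<Longrightarrow>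
      (\<integral>\<^sup>+x. W (indicator B) x * ennreal (u x) \<partial>m) = (\<integral>\<^sup>+x. indicator B x * ennreal (T u x) \<partial>m)"
  shows "adjoint_kernel m W T"
  unfolding adjoint_kernel_def
proof (intro allI impI conjI)
  fix u :: "'a \<Rightarrow> real" assume u: "integrable m u"
  have Ti: "integrable m v \<Longrightarrow> integrable m (T v)" for v :: "'a \<Rightarrow> real" using T by (auto simp: L1_operator_def)
  then show "integrable m (T u)" using u .
  fix f :: "'a \<Rightarrow> real" assume f: "unit_test m f"
  have t: "unit_test m (real_kernel m W f)" by (rule unit_test_real_kernel[OF W f])
  have nn: "(\<integral>x. f x * T v x \<partial>m) = (\<integral>x. real_kernel m W f x * v x \<partial>m)" if v: "L1_nonneg m v" for v :: "'a \<Rightarrow> real"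
  proof -
    have vi: "integrable m v" using v by (simp add: L1_nonneg_def)
    have Tv: "AE x in m. 0 \<le> T v x" using pos[OF v] by (simp add: L1_nonneg_def)
    have "(\<integral>\<^sup>+x. ennreal (f x * T v x) \<partial>m) = (\<integral>\<^sup>+x. ennreal (f x) * ennreal (T v x) \<partial>m)"
      using f Tv by (intro nn_integral_cong_AE) (auto elim!: eventually_mono simp: unit_test_def ennreal_mult)
    also have "\<dots> = (\<integral>\<^sup>+x. W (\<lambda>x. ennreal (f x)) x * ennreal (v x) \<partial>m)"
    proof (rule kernel_operator_duality_extend[symmetric, of m W])
      show "kernel_operator m W" using W by (simp add: sub_markov_def)
    qed (use f vi Ti[OF vi] dual[OF v] in \<open>auto simp: unit_test_def\<close>)
    also have "\<dots> = (\<integral>\<^sup>+x. ennreal (real_kernel m W f x * v x) \<partial>m)"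
    proof (intro nn_integral_cong)
      fix x assume "x \<in> space m"
      then show "W (\<lambda>x. ennreal (f x)) x * ennreal (v x) = ennreal (real_kernel m W f x * v x)"
        using ennreal_real_kernel[OF W f, of x, symmetric] by (simp add: ennreal_mult' real_kernel_def)
    qed
    finally have eq: "(\<integral>\<^sup>+x. ennreal (f x * T v x) \<partial>m) = (\<integral>\<^sup>+x. ennreal (real_kernel m W f x * v x) \<partial>m)" .
    have 1: "AE x in m. 0 \<le> f x * T v x" "AE x in m. 0 \<le> real_kernel m W f x * v x"
      using Tv v f t by (auto simp: L1_nonneg_def unit_test_def)
    show ?thesis
      using eq 1 unit_test_integrable[OF f Ti[OF vi]] unit_test_integrable[OF t vi]
      by (subst (1 2) integral_eq_nn_integral) auto
  qed
  let ?p = "\<lambda>x. max 0 (u x)" and ?n = "\<lambda>x. max 0 (- u x)"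
  have pn: "L1_nonneg m ?p" "L1_nonneg m ?n" using u by (auto simp: L1_nonneg_def)
  then have pni: "integrable m ?p" "integrable m ?n" by (auto simp: L1_nonneg_def)
  have Tadd: "AE x in m. T (\<lambda>x. a x + b x) x = T a x + T b x"
    if "integrable m a" "integrable m b" for a b :: "'a \<Rightarrow> real"
    using T that by (auto simp: L1_operator_def)
  have Tscale: "AE x in m. T (\<lambda>x. c * a x) x = c * T a x"
    if "integrable m a" for c and a :: "'a \<Rightarrow> real"
    using T that by (auto simp: L1_operator_def)
  have u_eq: "u = (\<lambda>x. ?p x + (- 1) * ?n x)" by (auto simp: max_def)
  have "AE x in m. T (\<lambda>x. ?p x + (- 1) * ?n x) x = T ?p x + T (\<lambda>x. (- 1) * ?n x) x"
    using pni by (intro Tadd) auto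
  moreover have "AE x in m. T (\<lambda>x. (- 1) * ?n x) x = (- 1) * T ?n x"
    using pni by (intro Tscale)
  ultimately have "AE x in m. T u x = T ?p x - T ?n x"
    unfolding u_eq[symmetric] by eventually_elim simp
  then have "(\<integral>x. f x * T u x \<partial>m) = (\<integral>x. f x * T ?p x - f x * T ?n x \<partial>m)"
    using f Ti[OF u] Ti[OF pni(1)] Ti[OF pni(2)]
    by (intro integral_cong_AE) (auto simp: unit_test_def right_diff_distrib)
  also have "\<dots> = (\<integral>x. real_kernel m W f x * ?p x \<partial>m) - (\<integral>x. real_kernel m W f x * ?n x \<partial>m)"
    unfolding nn[OF pn(1), symmetric] nn[OF pn(2), symmetric]
    by (intro Bochner_Integration.integral_diff unit_test_integrable f Ti pni)
  also have "\<dots> = (\<integral>x. real_kernel m W f x * ?p x - real_kernel m W f x * ?n x \<partial>m)"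
    by (intro Bochner_Integration.integral_diff[symmetric] unit_test_integrable t pni)
  also have "\<dots> = (\<integral>x. real_kernel m W f x * u x \<partial>m)"
    by (intro Bochner_Integration.integral_cong) (auto simp: max_def)
  finally show "(\<integral>x. f x * T u x \<partial>m) = (\<integral>x. real_kernel m W f x * u x \<partial>m)" .
qed

text \<open>Unlike the defining identity, this form admits all nonnegative \<open>f\<close>, unbounded
  ones and infinite values included.\<close>

lemma adjoint_kernel_nn_integral:
  assumes m: "sigma_finite_measure m" and W: "sub_markov m W" and T: "adjoint_kernel m W T"
    and u: "L1_nonneg m u"
    and f: "f \<in> borel_measurable m"
  shows "(\<integral>\<^sup>+x. W f x * ennreal (u x) \<partial>m) = (\<integral>\<^sup>+x. f x * ennreal (T u x) \<partial>m)"
proof (rule kernel_operator_duality_extend[OF _ _ _ _ f])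
  have ui: "integrable m u" using u by (simp add: L1_nonneg_def)
  have Tu: "L1_nonneg m (T u)"
    using positive_contraction_adjoint[OF m W T] u by (simp add: positive_contraction_def)
  show "kernel_operator m W" using W by (simp add: sub_markov_def)
  show "(\<lambda>x. ennreal (u x)) \<in> borel_measurable m" "(\<lambda>x. ennreal (T u x)) \<in> borel_measurable m"
    using ui Tu by (auto simp: L1_nonneg_def)
  fix B assume B: "B \<in> sets m"
  note tB = unit_test_indicator[OF B]
  have t: "unit_test m (real_kernel m W (indicator B))" by (rule unit_test_real_kernel[OF W tB])
  have "(\<integral>\<^sup>+x. W (indicator B) x * ennreal (u x) \<partial>m) = (\<integral>\<^sup>+x. ennreal (real_kernel m W (indicator B) x * u x) \<partial>m)"
  proof (intro nn_integral_cong)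
    fix x assume "x \<in> space m"
    then show "W (indicator B) x * ennreal (u x) = ennreal (real_kernel m W (indicator B) x * u x)"
      using ennreal_real_kernel[OF W tB, of x, symmetric]
      by (simp add: ennreal_mult' real_kernel_def ennreal_indicator)
  qed
  also have "\<dots> = ennreal (\<integral>x. real_kernel m W (indicator B) x * u x \<partial>m)"
    using u t by (intro nn_integral_eq_integral unit_test_integrable t ui) (auto simp: L1_nonneg_def unit_test_def)
  also have "\<dots> = ennreal (\<integral>x. indicator B x * T u x \<partial>m)"
    using T ui tB by (simp add: adjoint_kernel_def)
  also have "\<dots> = (\<integral>\<^sup>+x. ennreal (indicator B x * T u x) \<partial>m)"
    using Tu by (intro nn_integral_eq_integral[symmetric] unit_test_integrable tB) (auto simp: L1_nonneg_def)
  also have "\<dots> = (\<integral>\<^sup>+x. indicator B x * ennreal (T u x) \<partial>m)"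
    by (intro nn_integral_cong) (auto simp: indicator_def)
  finally show "(\<integral>\<^sup>+x. W (indicator B) x * ennreal (u x) \<partial>m) = (\<integral>\<^sup>+x. indicator B x * ennreal (T u x) \<partial>m)" .
qed

text \<open>Fubini, with \<open>e\<^sup>-\<^sup>t \<bar>u x\<bar>\<close> as integrable bound: the
  transform of the orbit can be computed by transforming the adjoint kernels pointwise.\<close>

lemma (in L1_semigroup) damped_orbit_eq_resolvent:
  assumes m: "sigma_finite_measure m"
    and W: "\<And>t. sub_markov m (W t)" and adj: "\<And>t. 0 \<le> t \<Longrightarrow> adjoint_kernel m (W t) (Z t)"
    and neg: "\<And>t f x. t < 0 \<Longrightarrow> x \<in> space m \<Longrightarrow> W t f x = 0"
    and meas: "\<And>f. f \<in> borel_measurable m \<Longrightarrow> (\<lambda>(t, x). W t f x) \<in> borel_measurable (borel \<Otimes>\<^sub>M m)"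
    and f: "unit_test m f" and u: "integrable m u"
  shows "damped_integral {0..} (orbit f u)
    = (\<integral>x. real_kernel m (\<lambda>f x. \<integral>\<^sup>+t. ennreal (exp (- t)) * W t f x \<partial>lborel) f x * u x \<partial>m)"
proof -
  interpret sigma_finite_measure m by fact
  interpret pair_sigma_finite lborel m ..
  let ?k = "\<lambda>t x. real_kernel m (W t) f x"
  let ?F = "\<lambda>(t, x). indicator {0..} t * exp (- t) * (?k t x * u x)"
  have t: "unit_test m (?k t)" for t by (rule unit_test_real_kernel[OF W f])
  have fm: "(\<lambda>y. ennreal (f y)) \<in> borel_measurable m" using f by (auto simp: unit_test_def)
  have [measurable]: "u \<in> borel_measurable m" using u by auto
  have [measurable]: "(\<lambda>p. ?k (fst p) (snd p)) \<in> borel_measurable (borel \<Otimes>\<^sub>M m)"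
    unfolding real_kernel_def using meas[OF fm] by (simp add: split_beta')
  have [measurable]: "(\<lambda>p. ?k (fst p) (snd p)) \<in> borel_measurable (lborel \<Otimes>\<^sub>M m)" by simp
  have ie: "integrable lborel (\<lambda>t::real. indicator {0..} t * exp (- t))"
    using exp_neg_integrable by (simp add: set_integrable_def)
  have F: "integrable (lborel \<Otimes>\<^sub>M m) ?F"
  proof (rule Bochner_Integration.integrable_bound)
    show "integrable (lborel \<Otimes>\<^sub>M m) (\<lambda>(t, x). (indicator {0..} t * exp (- t)) * \<bar>u x\<bar>)"
    proof (rule Fubini_integrable)
      show "integrable lborel (\<lambda>t. \<integral>x. norm (case (t, x) of (t, x) \<Rightarrow> indicator {0..} t * exp (- t) * \<bar>u x\<bar>) \<partial>m)"
        using integrable_mult_left[OF ie, of "\<integral>x. \<bar>u x\<bar> \<partial>m"] by (simp add: abs_mult)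
      show "AE t in lborel. integrable m (\<lambda>x. case (t, x) of (t, x) \<Rightarrow> indicator {0..} t * exp (- t) * \<bar>u x\<bar>)"
        using u by (intro AE_I2) auto
    qed (simp add: split_beta')
    show "?F \<in> borel_measurable (lborel \<Otimes>\<^sub>M m)" by (simp add: split_beta')
    show "AE p in lborel \<Otimes>\<^sub>M m. norm (?F p) \<le> norm (case p of (t, x) \<Rightarrow> indicator {0..} t * exp (- t) * \<bar>u x\<bar>)"
      using unit_test_mult_bound[OF t] by (intro AE_I2) (auto simp: abs_mult intro!: mult_left_mono)
  qed
  have "damped_integral {0..} (orbit f u) = (\<integral>t. (\<integral>x. ?F (t, x) \<partial>m) \<partial>lborel)"
    unfolding damped_integral_def set_lebesgue_integral_def
  proof (intro Bochner_Integration.integral_cong refl)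
    fix s :: real
    show "indicator {0..} s *\<^sub>R (exp (- s) * orbit f u s) = (\<integral>x. ?F (s, x) \<partial>m)"
      using adj[of s] f u by (cases "0 \<le> s") (auto simp: orbit_def adjoint_kernel_def)
  qed
  also have "\<dots> = (\<integral>x. (\<integral>t. ?F (t, x) \<partial>lborel) \<partial>m)"
    by (rule Fubini_integral[symmetric]) (use F in \<open>simp add: split_beta'\<close>)
  also have "\<dots> = (\<integral>x. real_kernel m (\<lambda>f x. \<integral>\<^sup>+t. ennreal (exp (- t)) * W t f x \<partial>lborel) f x * u x \<partial>m)"
  proof (intro Bochner_Integration.integral_cong refl)
    fix x assume x: "x \<in> space m"
    have km: "(\<lambda>t. ?k t x) \<in> borel_measurable lborel"
      using measurable_Pair1[OF \<open>(\<lambda>p. ?k (fst p) (snd p)) \<in> borel_measurable (lborel \<Otimes>\<^sub>M m)\<close> x] by simp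
    have "(\<integral>t. indicator {0..} t * exp (- t) * ?k t x \<partial>lborel)
        = enn2real (\<integral>\<^sup>+t. ennreal (indicator {0..} t * exp (- t) * ?k t x) \<partial>lborel)"
      using km t by (intro integral_eq_nn_integral) (auto simp: unit_test_def)
    also have "(\<integral>\<^sup>+t. ennreal (indicator {0..} t * exp (- t) * ?k t x) \<partial>lborel)
        = (\<integral>\<^sup>+t. ennreal (exp (- t)) * W t (\<lambda>y. ennreal (f y)) x \<partial>lborel)"
    proof (intro nn_integral_cong)
      fix s :: real
      show "ennreal (indicator {0..} s * exp (- s) * ?k s x)
          = ennreal (exp (- s)) * W s (\<lambda>y. ennreal (f y)) x"
        using ennreal_real_kernel[OF W f x, of s] neg[OF _ x, of s] t[of s]
        by (cases "s < 0") (auto simp: ennreal_mult unit_test_def)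
    qed
    finally show "(\<integral>t. ?F (t, x) \<partial>lborel)
        = real_kernel m (\<lambda>f x. \<integral>\<^sup>+t. ennreal (exp (- t)) * W t f x \<partial>lborel) f x * u x"
      using x by (simp add: real_kernel_def mult.assoc[symmetric])
  qed
  finally show ?thesis .
qed

section \<open>The transition semigroup of the minimal process on \<open>L\<^sup>1\<close>\<close>

locale pdmp_L1 = pdmp_flow m \<pi> \<phi> J + sigma_finite_measure m
  for m :: "'a measure" and \<pi> :: "real \<Rightarrow> 'a \<Rightarrow> 'a" and \<phi> :: "'a \<Rightarrow> real" and J :: "'a \<Rightarrow> 'a measure" +
  fixes P :: "('a \<Rightarrow> real) \<Rightarrow> ('a \<Rightarrow> real)" and S :: "real \<Rightarrow> ('a \<Rightarrow> real) \<Rightarrow> ('a \<Rightarrow> real)"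
  assumes P_stochastic: "stochastic_operator m P"
    and P_transition: "transition_operator m J P"
    and S_killed: "killed_flow_semigroup m \<pi> \<phi> S"
begin

sublocale S: L1_semigroup m S
  using S_killed by unfold_locales (simp add: killed_flow_semigroup_def)

lemma sub_markov_killed: "sub_markov m (killed t)"
  by (simp add: sub_markov_def kernel_operator_killed killed_le_1)

lemma sub_markov_transition: "sub_markov m (transition t)"
  by (simp add: sub_markov_def kernel_operator_transition transition_le_1)

lemma sub_markov_resolvent: "sub_markov m resolvent"
  by (simp add: sub_markov_def kernel_operator_resolvent resolvent_le_1)

lemma sub_markov_killed_resolvent: "sub_markov m killed_resolvent"
  by (auto simp: sub_markov_def kernel_operator_killed_resolvent
      intro: order_trans[OF killed_resolvent_le resolvent_le_1])

lemma sub_markov_average: "sub_markov m (\<lambda>f x. \<integral>\<^sup>+y. f y \<partial>J x)"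
  using prob_space.emeasure_space_1[OF prob_space_jump]
  by (simp add: sub_markov_def kernel_operator_average)

lemma adjoint_killed:
  assumes t: "0 \<le> t" shows "adjoint_kernel m (killed t) (S t)"
proof (rule adjoint_kernelI[OF sub_markov_killed S.op[OF t] S.nonneg[OF t]])
  fix u B assume u: "L1_nonneg m u" and B: "B \<in> sets m"
  have ui [measurable]: "integrable m u" using u by (simp add: L1_nonneg_def)
  have [measurable]: "B \<in> sets m" by fact
  have Su: "L1_nonneg m (S t u)" by (rule S.nonneg[OF t u])
  have i: "integrable m (\<lambda>x. exp (- \<Phi> x t) * indicator B (\<pi> t x) * u x)"
  proof (rule Bochner_Integration.integrable_bound[OF ui])
    show "(\<lambda>x. exp (- \<Phi> x t) * indicator B (\<pi> t x) * u x) \<in> borel_measurable m" by measurable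
    show "AE x in m. norm (exp (- \<Phi> x t) * indicator B (\<pi> t x) * u x) \<le> norm (u x)"
      using cumulative_rate_nonneg[of _ t]
      by (intro AE_I2) (auto simp: abs_mult indicator_def intro!: mult_left_le_one_le)
  qed
  have "(\<integral>\<^sup>+x. killed t (indicator B) x * ennreal (u x) \<partial>m)
      = (\<integral>\<^sup>+x. ennreal (exp (- \<Phi> x t) * indicator B (\<pi> t x) * u x) \<partial>m)"
    using t by (intro nn_integral_cong) (auto simp: killed_def ennreal_mult' indicator_def)
  also have "\<dots> = ennreal (\<integral>x. exp (- \<Phi> x t) * indicator B (\<pi> t x) * u x \<partial>m)"
    using u by (intro nn_integral_eq_integral i) (auto simp: L1_nonneg_def)
  also have "\<dots> = ennreal (\<integral>x. indicator B x * S t u x \<partial>m)"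
    using S_killed t u B by (auto simp: killed_flow_semigroup_def set_lebesgue_integral_def)
  also have "\<dots> = (\<integral>\<^sup>+x. ennreal (indicator B x * S t u x) \<partial>m)"
    using Su by (intro nn_integral_eq_integral[symmetric] unit_test_integrable unit_test_indicator B)
      (auto simp: L1_nonneg_def)
  also have "\<dots> = (\<integral>\<^sup>+x. indicator B x * ennreal (S t u x) \<partial>m)"
    by (intro nn_integral_cong) (auto simp: indicator_def)
  finally show "(\<integral>\<^sup>+x. killed t (indicator B) x * ennreal (u x) \<partial>m)
      = (\<integral>\<^sup>+x. indicator B x * ennreal (S t u x) \<partial>m)" .
qed

lemma P_op: "L1_operator m P"
  using P_stochastic by (simp add: stochastic_operator_def)

text \<open>The hypotheses on \<open>P\<close> speak of densities only; scaling extends them to all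
  nonnegative functions, where a function of mass zero needs the linearity of \<open>P\<close>
  instead.\<close>

lemma P_nonneg_transition:
  assumes u: "L1_nonneg m u"
  shows "L1_nonneg m (P u) \<and> (\<forall>B\<in>sets m. (\<integral>x. measure (J x) B * u x \<partial>m) = (LINT x:B|m. P u x))"
proof -
  have ui: "integrable m u" using u by (simp add: L1_nonneg_def)
  then have Pui: "integrable m (P u)" using P_op by (auto simp: L1_operator_def)
  have scale: "AE x in m. P (\<lambda>y. c * u y) x = c * P u x" for c
    using P_op ui by (auto simp: L1_operator_def)
  have cong: "AE x in m. P v x = P u x" if "integrable m v" "AE x in m. v x = u x" for v
    using P_op ui that by (auto simp: L1_operator_def)
  define c where "c = L1_norm m u"
  show ?thesis
  proof (cases "c = 0")
    case True
    then have u0: "AE x in m. u x = 0"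
      using integral_nonneg_eq_0_iff_AE[of m "\<lambda>x. \<bar>u x\<bar>"] ui by (simp add: c_def L1_norm_def)
    have "AE x in m. P (\<lambda>y. 0 * u y) x = P u x"
      using ui u0 by (intro cong) auto
    with scale[of 0] have P0: "AE x in m. P u x = 0" by auto
    have "(\<integral>x. measure (J x) B * u x \<partial>m) = (LINT x:B|m. P u x)" if "B \<in> sets m" for B
    proof -
      have "(\<integral>x. measure (J x) B * u x \<partial>m) = 0"
        using u0 by (intro integral_eq_zero_AE) auto
      moreover have "(LINT x:B|m. P u x) = 0"
        unfolding set_lebesgue_integral_def using P0 by (intro integral_eq_zero_AE) auto
      ultimately show ?thesis by simp
    qed
    then show ?thesis using P0 Pui by (auto simp: L1_nonneg_def)
  next
    case False
    then have c: "0 < c" using L1_norm_nonneg[of m u] by (simp add: c_def)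
    let ?v = "\<lambda>y. (1 / c) * u y"
    have v: "L1_density m ?v"
      using u c by (auto simp: L1_density_def L1_nonneg_def L1_norm_def c_def abs_mult)
    then have Pv: "L1_nonneg m (P ?v)"
      using P_stochastic by (auto simp: stochastic_operator_def L1_density_def)
    have eq: "AE x in m. P u x = c * P ?v x"
      using scale[of "1 / c"] c by auto
    have "AE x in m. 0 \<le> P u x"
      using eq Pv c by (auto simp: L1_nonneg_def elim: eventually_elim2)
    moreover have "(\<integral>x. measure (J x) B * u x \<partial>m) = (LINT x:B|m. P u x)" if B: "B \<in> sets m" for B
    proof -
      have "(\<integral>x. measure (J x) B * u x \<partial>m) = (\<integral>x. c * (measure (J x) B * ?v x) \<partial>m)"
        using c by (intro Bochner_Integration.integral_cong) auto
      also have "\<dots> = c * (\<integral>x. measure (J x) B * ?v x \<partial>m)"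
        by (rule integral_mult_right_zero)
      also have "(\<integral>x. measure (J x) B * ?v x \<partial>m) = (LINT x:B|m. P ?v x)"
        using P_transition v B unfolding transition_operator_def by blast
      also have "c * (LINT x:B|m. P ?v x) = (LINT x:B|m. c * P ?v x)" by simp
      also have "\<dots> = (LINT x:B|m. P u x)"
        unfolding set_lebesgue_integral_def using eq B Pui Pv
        by (intro integral_cong_AE) (auto simp: L1_nonneg_def)
      finally show ?thesis .
    qed
    ultimately show ?thesis using Pui by (auto simp: L1_nonneg_def)
  qed
qed

lemma adjoint_average: "adjoint_kernel m (\<lambda>f x. \<integral>\<^sup>+y. f y \<partial>J x) P"
proof (rule adjoint_kernelI[OF sub_markov_average P_op])
  fix u B assume u: "L1_nonneg m u" and B: "B \<in> sets m"
  have Pu: "L1_nonneg m (P u)" using P_nonneg_transition[OF u] by simp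
  have ui: "integrable m u" using u by (simp add: L1_nonneg_def)
  have fin: "emeasure (J x) B = ennreal (measure (J x) B)" if "x \<in> space m" for x
    using prob_space.finite_measure[OF prob_space_jump[OF that]] by (rule finite_measure.emeasure_eq_measure)
  have "(\<lambda>x. emeasure (J x) B) \<in> borel_measurable m"
    using measurable_emeasure_kernel[OF jump_subprob B] .
  then have [measurable]: "(\<lambda>x. measure (J x) B) \<in> borel_measurable m"
    unfolding measure_def by measurable
  have i: "integrable m (\<lambda>x. measure (J x) B * u x)"
  proof (rule Bochner_Integration.integrable_bound[OF ui])
    show "(\<lambda>x. measure (J x) B * u x) \<in> borel_measurable m" using ui by measurable
    show "AE x in m. norm (measure (J x) B * u x) \<le> norm (u x)"
      using prob_space.prob_le_1[OF prob_space_jump]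
      by (intro AE_I2) (auto simp: abs_mult intro!: mult_left_le_one_le)
  qed
  have "(\<integral>\<^sup>+x. (\<integral>\<^sup>+y. indicator B y \<partial>J x) * ennreal (u x) \<partial>m)
      = (\<integral>\<^sup>+x. ennreal (measure (J x) B * u x) \<partial>m)"
    using B fin by (intro nn_integral_cong) (simp add: sets_jump ennreal_mult')
  also have "\<dots> = ennreal (\<integral>x. measure (J x) B * u x \<partial>m)"
    using u by (intro nn_integral_eq_integral i) (auto simp: L1_nonneg_def)
  also have "\<dots> = ennreal (\<integral>x. indicator B x * P u x \<partial>m)"
    using P_nonneg_transition[OF u] B by (simp add: set_lebesgue_integral_def)
  also have "\<dots> = (\<integral>\<^sup>+x. ennreal (indicator B x * P u x) \<partial>m)"
    using Pu by (intro nn_integral_eq_integral[symmetric] unit_test_integrable unit_test_indicator B)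
      (auto simp: L1_nonneg_def)
  also have "\<dots> = (\<integral>\<^sup>+x. indicator B x * ennreal (P u x) \<partial>m)"
    by (intro nn_integral_cong) (auto simp: indicator_def)
  finally show "(\<integral>\<^sup>+x. (\<integral>\<^sup>+y. indicator B y \<partial>J x) * ennreal (u x) \<partial>m)
      = (\<integral>\<^sup>+x. indicator B x * ennreal (P u x) \<partial>m)" .
qed (use P_nonneg_transition in auto)

lemma positive_weight: "\<exists>h :: 'a \<Rightarrow> real. integrable m h \<and> (\<forall>x\<in>space m. 0 < h x)"
proof -
  obtain h where h: "h \<in> borel_measurable m" "integral\<^sup>N m h \<noteq> \<infinity>" "\<forall>x\<in>space m. 0 < h x \<and> h x < \<infinity>"
    using Ex_finite_integrable_function by auto
  have "integrable m (\<lambda>x. enn2real (h x))"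
  proof (rule integrableI_nonneg)
    have "(\<integral>\<^sup>+x. ennreal (enn2real (h x)) \<partial>m) = integral\<^sup>N m h"
      using h(3) by (intro nn_integral_cong) auto
    then show "(\<integral>\<^sup>+x. ennreal (enn2real (h x)) \<partial>m) < \<infinity>" using h(2) by (simp add: top.not_eq_extremum)
  qed (use h(1) in auto)
  then show ?thesis
    using h(3) by (intro exI[of _ "\<lambda>x. enn2real (h x)"]) (auto simp: enn2real_positive_iff)
qed

section \<open>Null functions stay null\<close>

text \<open>Integrate \<open>W f\<close> against a strictly positive weight \<open>h\<close> and move
  \<open>W\<close> to the other side, where \<open>f\<close> appears and is null.\<close>

lemma adjoint_null:
  assumes W: "sub_markov m W" and T: "adjoint_kernel m W T"
    and f [measurable]: "f \<in> borel_measurable m" and f0: "AE x in m. f x = 0"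
  shows "AE x in m. W f x = 0"
proof -
  obtain h :: "'a \<Rightarrow> real" where h: "integrable m h" "\<And>x. x \<in> space m \<Longrightarrow> 0 < h x"
    using positive_weight by auto
  have hn: "L1_nonneg m h" using h less_imp_le by (auto simp: L1_nonneg_def)
  have [measurable]: "W f \<in> borel_measurable m" "h \<in> borel_measurable m"
    using kernel_operator_measurable[of m W f] W h by (auto simp: sub_markov_def)
  have "(\<integral>\<^sup>+x. W f x * ennreal (h x) \<partial>m) = (\<integral>\<^sup>+x. f x * ennreal (T h x) \<partial>m)"
    by (rule adjoint_kernel_nn_integral[OF sigma_finite_measure_axioms W T hn f])
  also have "\<dots> = (\<integral>\<^sup>+x. 0 \<partial>m)"
    using f0 by (intro nn_integral_cong_AE) auto
  finally have "AE x in m. W f x * ennreal (h x) = 0"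
    by (simp add: nn_integral_0_iff_AE)
  with AE_space show ?thesis
    by eventually_elim (use h(2) in \<open>force simp: ennreal_eq_0_iff not_le\<close>)
qed

lemma killed_null:
  assumes "f \<in> borel_measurable m" "AE x in m. f x = 0"
  shows "AE x in m. killed t f x = 0"
  using adjoint_null[OF sub_markov_killed adjoint_killed assms, of t] killed_neg[of t f]
  by (cases "t < 0") auto

lemma jump_null:
  assumes "f \<in> borel_measurable m" "AE x in m. f x = 0"
  shows "AE x in m. jump f x = 0"
  using adjoint_null[OF sub_markov_average adjoint_average assms] by (auto simp: jump_def)

lemma null_time_integral:
  fixes W :: "real \<Rightarrow> 'a \<Rightarrow> ennreal"
  assumes [measurable]: "(\<lambda>(x, r). W r x) \<in> borel_measurable (m \<Otimes>\<^sub>M lborel)"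
    and null: "\<And>r. AE x in m. W r x = 0"
  shows "AE x in m. (\<integral>\<^sup>+r. W r x \<partial>lborel) = 0"
proof -
  interpret pair_sigma_finite m lborel ..
  have "(\<integral>\<^sup>+x. (\<integral>\<^sup>+r. W r x \<partial>lborel) \<partial>m) = (\<integral>\<^sup>+r. (\<integral>\<^sup>+x. W r x \<partial>m) \<partial>lborel)"
    by (rule Fubini'[symmetric]) (use assms(1) in \<open>simp add: split_beta'\<close>)
  also have "\<dots> = (\<integral>\<^sup>+r. 0 \<partial>(lborel :: real measure))"
  proof (intro nn_integral_cong)
    fix r
    have "(\<integral>\<^sup>+x. W r x \<partial>m) = (\<integral>\<^sup>+x. 0 \<partial>m)" by (intro nn_integral_cong_AE null)
    then show "(\<integral>\<^sup>+x. W r x \<partial>m) = 0" by simp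
  qed
  finally have "(\<integral>\<^sup>+x. (\<integral>\<^sup>+r. W r x \<partial>lborel) \<partial>m) = 0" by simp
  moreover have "(\<lambda>x. \<integral>\<^sup>+r. W r x \<partial>lborel) \<in> borel_measurable m"
    by (rule lborel.borel_measurable_nn_integral) (use assms(1) in \<open>simp add: split_beta'\<close>)
  ultimately show ?thesis by (simp add: nn_integral_0_iff_AE)
qed

lemma after_jumps_null:
  assumes f [measurable]: "f \<in> borel_measurable m" and f0: "AE x in m. f x = 0"
  shows "AE x in m. after_jumps n t f x = 0"
proof (induction n arbitrary: t)
  case 0
  show ?case using killed_null[OF assms] by simp
next
  case (Suc n)
  have "AE x in m. killed r (jump (after_jumps n (t - r) f)) x = 0" for r
    by (intro killed_null jump_null Suc kernel_operator_measurable[OF kernel_operator_jump]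
        kernel_operator_measurable[OF kernel_operator_after_jumps] f)
  moreover have "(\<lambda>(x, r). killed r (jump (after_jumps n (t - r) f)) x) \<in> borel_measurable (m \<Otimes>\<^sub>M lborel)"
    by measurable
  ultimately show ?case
    unfolding after_jumps.simps by (intro null_time_integral)
qed

lemma transition_null:
  assumes "f \<in> borel_measurable m" "AE x in m. f x = 0"
  shows "AE x in m. transition t f x = 0"
proof -
  have "AE x in m. \<forall>n. after_jumps n t f x = 0"
    using after_jumps_null[OF assms] by (simp add: AE_all_countable)
  then show ?thesis by (auto simp: transition_def elim!: eventually_mono)
qed

lemma killed_resolvent_null:
  assumes f [measurable]: "f \<in> borel_measurable m" and f0: "AE x in m. f x = 0"
  shows "AE x in m. killed_resolvent f x = 0"
  unfolding killed_resolvent_def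
proof (rule null_time_integral)
  show "(\<lambda>(x, r). ennreal (exp (- r)) * killed r f x) \<in> borel_measurable (m \<Otimes>\<^sub>M lborel)"
    by measurable
  show "AE x in m. ennreal (exp (- r)) * killed r f x = 0" for r
    using killed_null[OF f f0, of r] by auto
qed

section \<open>The pre-adjoint of the transition operators\<close>

text \<open>The pre-adjoint of the transition operators, which \<open>minimal_semigroup_eq\<close>
  identifies with the minimal semigroup.\<close>

definition minimal :: "real \<Rightarrow> ('a \<Rightarrow> real) \<Rightarrow> 'a \<Rightarrow> real" where
  "minimal t = dual_operator m (transition t)"

lemma adjoint_minimal: "adjoint_kernel m (transition t) (minimal t)"
  unfolding minimal_def
  by (rule adjoint_dual_operator[OF sigma_finite_measure_axioms sub_markov_transition])
    (auto intro!: transition_null null_set_indicator)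

lemma minimal_contraction: "positive_contraction m (minimal t)"
  by (rule positive_contraction_adjoint[OF sigma_finite_measure_axioms sub_markov_transition adjoint_minimal])

lemma minimal_op: "L1_operator m (minimal t)"
  using minimal_contraction by (simp add: positive_contraction_def)

lemma minimal_integrable: "integrable m u \<Longrightarrow> integrable m (minimal t u)"
  using minimal_op by (simp add: L1_operator_def)

lemma minimal_nonneg: "L1_nonneg m u \<Longrightarrow> L1_nonneg m (minimal t u)"
  using minimal_contraction by (simp add: positive_contraction_def)

lemma minimal_integral:
  "integrable m u \<Longrightarrow> unit_test m f \<Longrightarrow>
    (\<integral>x. f x * minimal t u x \<partial>m) = (\<integral>x. real_kernel m (transition t) f x * u x \<partial>m)"
  using adjoint_minimal by (simp add: adjoint_kernel_def)

text \<open>A path with a jump before time \<open>0\<close> would have to jump exactly at time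
  \<open>0\<close>, a null set in the integral over the jump time.\<close>

lemma transition_zero:
  assumes x: "x \<in> space m" shows "transition 0 f x = f x"
proof -
  have "after_jumps (Suc n) 0 f x = 0" for n
  proof -
    have "killed r (jump (after_jumps n (0 - r) f)) x = 0" if "r \<noteq> 0" for r
    proof (cases "r < 0")
      case False
      with that have "killed r (jump (after_jumps n (0 - r) f)) x = killed r (jump (\<lambda>_. 0)) x"
        by (intro kernel_operator_cong[OF kernel_operator_killed_jump _ x] after_jumps_neg) auto
      then show ?thesis by (simp add: kernel_operator_zero[OF kernel_operator_killed_jump x])
    qed (simp add: killed_neg)
    then have "AE r in lborel. killed r (jump (after_jumps n (0 - r) f)) x = 0"
      using AE_lborel_singleton[of "0::real"] by (auto elim!: eventually_mono)
    from nn_integral_cong_AE[OF this] show ?thesis by simp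
  qed
  then have "transition 0 f x = (\<Sum>n<1. after_jumps n 0 f x)"
    unfolding transition_def by (intro suminf_finite) (auto simp: gr0_conv_Suc)
  then show ?thesis
    using x by (simp add: killed_def cumulative_rate_zero flow_zero)
qed

lemma real_kernel_transition_add:
  assumes "0 \<le> s" "0 \<le> t" and f: "unit_test m f" and x: "x \<in> space m"
  shows "real_kernel m (transition (s + t)) f x
    = real_kernel m (transition s) (real_kernel m (transition t) f) x"
proof -
  have fm: "(\<lambda>y. ennreal (f y)) \<in> borel_measurable m" using f by (auto simp: unit_test_def)
  have "transition s (\<lambda>y. ennreal (real_kernel m (transition t) f y)) x
      = transition s (transition t (\<lambda>y. ennreal (f y))) x"
    by (intro kernel_operator_cong[OF kernel_operator_transition _ x]
        ennreal_real_kernel[OF sub_markov_transition f])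
  also have "\<dots> = transition (s + t) (\<lambda>y. ennreal (f y)) x"
    by (rule transition_add[OF assms(1,2) x fm, symmetric])
  finally show ?thesis by (simp add: real_kernel_def)
qed

lemma minimal_semigroup_law:
  assumes st: "0 \<le> s" "0 \<le> t" and u: "integrable m u"
  shows "AE x in m. minimal (s + t) u x = minimal s (minimal t u) x"
proof (rule AE_eq_by_tests)
  fix f assume f: "unit_test m f"
  have "(\<integral>x. f x * minimal s (minimal t u) x \<partial>m)
      = (\<integral>x. real_kernel m (transition t) (real_kernel m (transition s) f) x * u x \<partial>m)"
    using f u by (simp add: minimal_integral minimal_integrable
        unit_test_real_kernel[OF sub_markov_transition])
  also have "\<dots> = (\<integral>x. real_kernel m (transition (s + t)) f x * u x \<partial>m)"
    using real_kernel_transition_add[OF st(2,1) f]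
    by (intro Bochner_Integration.integral_cong) (simp_all add: add.commute)
  finally show "(\<integral>x. f x * minimal (s + t) u x \<partial>m) = (\<integral>x. f x * minimal s (minimal t u) x \<partial>m)"
    using f u by (simp add: minimal_integral)
qed (intro minimal_integrable u)+

lemma minimal_start: "integrable m u \<Longrightarrow> AE x in m. minimal 0 u x = u x"
  by (rule AE_eq_by_tests)
    (auto simp: minimal_integral minimal_integrable real_kernel_def transition_zero unit_test_def
      intro!: Bochner_Integration.integral_cong)

lemma S_le_minimal:
  assumes t: "0 \<le> t" and u: "L1_nonneg m u"
  shows "AE x in m. S t u x \<le> minimal t u x"
proof -
  have ui: "integrable m u" using u by (simp add: L1_nonneg_def)
  have i: "integrable m (S t u)" "integrable m (minimal t u)"
    using ui t by (auto intro: S.integrable minimal_integrable)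
  have "AE x in m. 0 \<le> minimal t u x - S t u x"
  proof (rule density_nonneg)
    show "integrable m (\<lambda>x. minimal t u x - S t u x)" using i by simp
    fix B assume B: "B \<in> sets m"
    note tB = unit_test_indicator[OF B]
    let ?K = "\<lambda>W. real_kernel m W (indicator B)"
    have "(LINT x:B|m. minimal t u x - S t u x)
        = (\<integral>x. indicator B x * minimal t u x \<partial>m) - (\<integral>x. indicator B x * S t u x \<partial>m)"
      unfolding set_lebesgue_integral_def real_scaleR_def right_diff_distrib
      by (intro Bochner_Integration.integral_diff unit_test_integrable tB i)
    also have "\<dots> = (\<integral>x. ?K (transition t) x * u x \<partial>m) - (\<integral>x. ?K (killed t) x * u x \<partial>m)"
      using minimal_integral[OF ui tB] adjoint_killed[OF t] ui tB by (simp add: adjoint_kernel_def)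
    also have "\<dots> = (\<integral>x. ?K (transition t) x * u x - ?K (killed t) x * u x \<partial>m)"
      by (intro Bochner_Integration.integral_diff[symmetric] unit_test_integrable ui
          unit_test_real_kernel[OF _ tB] sub_markov_transition sub_markov_killed)
    also have "0 \<le> \<dots>"
    proof (rule integral_nonneg_AE)
      have le: "?K (killed t) x \<le> ?K (transition t) x" if "x \<in> space m" for x
        unfolding real_kernel_def using sub_markov_le_1[OF sub_markov_transition tB that, of t]
        by (intro mult_left_mono enn2real_mono killed_le_transition) (auto intro: le_less_trans)
      have "AE x in m. 0 \<le> u x" using u by (simp add: L1_nonneg_def)
      with AE_space show "AE x in m. 0 \<le> ?K (transition t) x * u x - ?K (killed t) x * u x"
        by eventually_elim (simp add: le mult_right_mono)
    qed
    finally show "0 \<le> (LINT x:B|m. minimal t u x - S t u x)" .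
  qed
  then show ?thesis by simp
qed

text \<open>The transition semigroup dominates \<open>S\<close> and does not increase mass, so its
  distance from \<open>S\<close> is at most the mass that \<open>S\<close> has lost. Strong
  continuity is thereby inherited from \<open>S\<close>.\<close>

lemma minimal_near_start:
  assumes t: "0 \<le> t" and u: "L1_nonneg m u"
  shows "L1_norm m (\<lambda>x. minimal t u x - u x) \<le> 2 * L1_norm m (\<lambda>x. S t u x - u x)"
proof -
  have ui: "integrable m u" using u by (simp add: L1_nonneg_def)
  have i: "integrable m (S t u)" "integrable m (minimal t u)"
    using ui t by (auto intro: S.integrable minimal_integrable)
  have "L1_norm m (\<lambda>x. minimal t u x - u x)
      = L1_norm m (\<lambda>x. (minimal t u x - S t u x) + (S t u x - u x))" by simp
  also have "\<dots> \<le> L1_norm m (\<lambda>x. minimal t u x - S t u x) + L1_norm m (\<lambda>x. S t u x - u x)"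
    using i ui by (intro L1_norm_triangle) auto
  also have "L1_norm m (\<lambda>x. minimal t u x - S t u x) = (\<integral>x. minimal t u x - S t u x \<partial>m)"
    using S_le_minimal[OF t u] i by (intro L1_norm_nonneg_eq) (auto simp: L1_nonneg_def)
  also have "\<dots> \<le> (\<integral>x. u x - S t u x \<partial>m)"
  proof -
    have "(\<integral>x. minimal t u x \<partial>m) \<le> (\<integral>x. u x \<partial>m)"
      unfolding L1_norm_nonneg_eq[OF u, symmetric] L1_norm_nonneg_eq[OF minimal_nonneg[OF u, of t], symmetric]
      using minimal_contraction[of t] ui by (simp add: positive_contraction_def)
    then show ?thesis using i ui by simp
  qed
  also have "\<dots> \<le> (\<integral>x. \<bar>S t u x - u x\<bar> \<partial>m)"
    using i ui by (intro integral_mono) auto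
  finally show ?thesis by (simp add: L1_norm_def)
qed

lemma minimal_substochastic: "substochastic_semigroup m minimal"
  unfolding substochastic_semigroup_def strongly_continuous_semigroup_def
proof (intro conjI allI impI minimal_start minimal_semigroup_law minimal_contraction)
  fix u :: "'a \<Rightarrow> real" assume u: "integrable m u"
  let ?p = "\<lambda>x. max 0 (u x)" and ?n = "\<lambda>x. max 0 (- u x)"
  have pn: "L1_nonneg m ?p" "L1_nonneg m ?n" using u by (auto simp: L1_nonneg_def)
  then have pni: "integrable m ?p" "integrable m ?n" by (auto simp: L1_nonneg_def)
  let ?b = "\<lambda>t. 2 * L1_norm m (\<lambda>x. S t ?p x - ?p x) + 2 * L1_norm m (\<lambda>x. S t ?n x - ?n x)"
  have bound: "L1_norm m (\<lambda>x. minimal t u x - u x) \<le> ?b t" if t: "0 \<le> t" for t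
  proof -
    have "AE x in m. minimal t u x = minimal t ?p x - minimal t ?n x"
    proof (rule AE_eq_by_tests)
      fix f assume f: "unit_test m f"
      have k: "unit_test m (real_kernel m (transition t) f)"
        by (rule unit_test_real_kernel[OF sub_markov_transition f])
      have "(\<integral>x. f x * (minimal t ?p x - minimal t ?n x) \<partial>m)
          = (\<integral>x. real_kernel m (transition t) f x * ?p x - real_kernel m (transition t) f x * ?n x \<partial>m)"
        using f k pni by (simp add: right_diff_distrib unit_test_integrable minimal_integrable minimal_integral)
      also have "\<dots> = (\<integral>x. real_kernel m (transition t) f x * u x \<partial>m)"
        by (intro Bochner_Integration.integral_cong) (auto simp: max_def)
      finally show "(\<integral>x. f x * minimal t u x \<partial>m) = (\<integral>x. f x * (minimal t ?p x - minimal t ?n x) \<partial>m)"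
        using f u by (simp add: minimal_integral)
    qed (intro Bochner_Integration.integrable_diff minimal_integrable u pni)+
    then have "L1_norm m (\<lambda>x. minimal t u x - u x)
        = L1_norm m (\<lambda>x. (minimal t ?p x - ?p x) + (?n x - minimal t ?n x))"
      using u pni by (intro L1_norm_cong_AE) (auto intro!: minimal_integrable elim!: eventually_mono simp: max_def)
    also have "\<dots> \<le> L1_norm m (\<lambda>x. minimal t ?p x - ?p x) + L1_norm m (\<lambda>x. ?n x - minimal t ?n x)"
      using pni by (intro L1_norm_triangle) (auto intro: minimal_integrable)
    also have "L1_norm m (\<lambda>x. ?n x - minimal t ?n x) = L1_norm m (\<lambda>x. minimal t ?n x - ?n x)"
      by (simp add: L1_norm_def abs_minus_commute)
    finally show ?thesis
      using minimal_near_start[OF t pn(1)] minimal_near_start[OF t pn(2)] by linarith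
  qed
  have "(?b \<longlongrightarrow> 2 * 0 + 2 * 0) (at_right 0)"
    by (intro tendsto_add tendsto_mult tendsto_const S.strong_continuity pni)
  then have b0: "(?b \<longlongrightarrow> 0) (at_right 0)" by simp
  show "((\<lambda>t. L1_norm m (\<lambda>x. minimal t u x - u x)) \<longlongrightarrow> 0) (at_right 0)"
  proof (rule Lim_null_comparison[OF _ b0])
    show "\<forall>\<^sub>F t in at_right 0. norm (L1_norm m (\<lambda>x. minimal t u x - u x)) \<le> ?b t"
      using bound by (auto simp: eventually_at_right_field L1_norm_nonneg intro!: exI[of _ 1])
  qed
qed

sublocale T: L1_semigroup m minimal
  by unfold_locales (rule minimal_substochastic)

section \<open>The generator of the transition semigroup extends the perturbed generator\<close>

text \<open>The resolvent \<open>w\<close> of the killed semigroup at \<open>g\<close>. That it lies in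
  the domain of \<open>A\<close> makes \<open>\<phi> w\<close> integrable, so that \<open>P\<close>
  can be applied to it.\<close>

lemma killed_resolvent_in_generator:
  assumes g: "L1_nonneg m g"
  shows "\<exists>w. dual_density m killed_resolvent g w \<and> (w, \<lambda>x. w x - g x) \<in> generator m S \<and>
    integrable m (\<lambda>x. \<phi> x * w x)"
proof -
  have gi: "integrable m g" using g by (simp add: L1_nonneg_def)
  obtain w where w: "dual_density m killed_resolvent g w"
    using dual_density_exists[OF sigma_finite_measure_axioms kernel_operator_killed_resolvent _ _ gi]
      killed_resolvent_null[OF borel_measurable_indicator[OF null_setsD2] null_set_indicator]
      sub_markov_killed_resolvent
    by (auto simp: sub_markov_def)
  then have wi: "integrable m w" and w0: "\<And>x. 0 \<le> w x" by (auto simp: dual_density_def)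
  have gen: "(w, \<lambda>x. w x - g x) \<in> generator m S"
  proof (rule S.resolvent_imp_generator[OF wi gi])
    fix h :: real and f assume "0 \<le> h" "unit_test m f"
    then show "\<exists>f'. unit_test m f' \<and>
        (\<forall>w. integrable m w \<longrightarrow> (\<integral>x. f x * S h w x \<partial>m) = (\<integral>x. f' x * w x \<partial>m))"
      using adjoint_killed[of h] unit_test_real_kernel[OF sub_markov_killed, of f h]
      by (auto simp: adjoint_kernel_def)
  next
    fix f assume f: "unit_test m f"
    have "damped_integral {0..} (S.orbit f g) = (\<integral>x. real_kernel m killed_resolvent f x * g x \<partial>m)"
      unfolding killed_resolvent_def[abs_def]
      by (rule S.damped_orbit_eq_resolvent[OF sigma_finite_measure_axioms sub_markov_killed adjoint_killed _ _ f gi])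
        (auto simp: killed_neg)
    also have "\<dots> = (\<integral>x. real_kernel m killed_resolvent f x * max 0 (g x) \<partial>m)"
      using g unit_test_real_kernel[OF sub_markov_killed_resolvent f]
      by (intro integral_cong_AE) (auto simp: L1_nonneg_def unit_test_def elim!: eventually_mono)
    also have "\<dots> = (\<integral>x. f x * w x \<partial>m)"
      by (rule integral_dual_density[OF sub_markov_killed_resolvent f gi w, symmetric])
    finally show "damped_integral {0..} (S.orbit f g) = (\<integral>x. f x * w x \<partial>m)" .
  qed
  then have "w \<in> L1_weighted m \<phi>"
    using S_killed by (auto simp: killed_flow_semigroup_def)
  then show ?thesis
    using w gen w0 by (auto simp: L1_weighted_def)
qed

text \<open>The resolvent equation, with \<open>R\<close> moved from the test to \<open>g\<close>, where
  it produces \<open>w\<close>.\<close>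

lemma resolvent_integral_split:
  assumes f: "unit_test m f" and g: "L1_nonneg m g"
    and w: "dual_density m killed_resolvent g w" and \<phi>w: "integrable m (\<lambda>x. \<phi> x * w x)"
  shows "(\<integral>x. real_kernel m resolvent f x * g x \<partial>m) = (\<integral>x. f x * w x \<partial>m)
    + (\<integral>x. real_kernel m (\<lambda>f x. \<integral>\<^sup>+y. f y \<partial>J x) (real_kernel m resolvent f) x * (\<phi> x * w x) \<partial>m)"
proof -
  let ?f = "\<lambda>x. ennreal (f x)" and ?G = "real_kernel m resolvent f"
  let ?A = "real_kernel m (\<lambda>f x. \<integral>\<^sup>+y. f y \<partial>J x) ?G"
  have fm: "?f \<in> borel_measurable m" using f by (auto simp: unit_test_def)
  have G: "unit_test m ?G" by (rule unit_test_real_kernel[OF sub_markov_resolvent f])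
  have A: "unit_test m ?A" by (rule unit_test_real_kernel[OF sub_markov_average G])
  have gi: "integrable m g" and g0: "AE x in m. 0 \<le> g x" using g by (auto simp: L1_nonneg_def)
  have wi: "integrable m w" and w0: "\<And>x. 0 \<le> w x"
    and dual: "\<And>f. f \<in> borel_measurable m \<Longrightarrow>
      (\<integral>\<^sup>+x. f x * ennreal (w x) \<partial>m) = (\<integral>\<^sup>+x. killed_resolvent f x * ennreal (g x) \<partial>m)"
    using w by (auto simp: dual_density_def)
  have [measurable]: "resolvent ?f \<in> borel_measurable m"
    by (rule kernel_operator_measurable[OF kernel_operator_resolvent fm])
  have jm: "jump (resolvent ?f) \<in> borel_measurable m"
    by (rule kernel_operator_measurable[OF kernel_operator_jump]) measurable
  have [measurable]: "killed_resolvent ?f \<in> borel_measurable m" "killed_resolvent (jump (resolvent ?f)) \<in> borel_measurable m"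
    "g \<in> borel_measurable m"
    using gi by (auto intro!: kernel_operator_measurable[OF kernel_operator_killed_resolvent] fm jm)
  have jump_G: "jump (resolvent ?f) x = ennreal (\<phi> x * ?A x)" if x: "x \<in> space m" for x
  proof -
    have "(\<integral>\<^sup>+y. resolvent ?f y \<partial>J x) = (\<integral>\<^sup>+y. ennreal (?G y) \<partial>J x)"
      by (intro kernel_operator_cong[OF kernel_operator_average _ x] ennreal_real_kernel[OF sub_markov_resolvent f, symmetric])
    also have "\<dots> = ennreal (?A x)"
      by (rule ennreal_real_kernel[OF sub_markov_average G x, symmetric])
    finally show ?thesis using rate_nonneg[OF x] by (simp add: jump_def ennreal_mult')
  qed
  have "ennreal (\<integral>x. ?G x * g x \<partial>m) = (\<integral>\<^sup>+x. ennreal (?G x * g x) \<partial>m)"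
    using G g0 by (intro nn_integral_eq_integral[symmetric] unit_test_integrable gi) (auto simp: unit_test_def)
  also have "\<dots> = (\<integral>\<^sup>+x. killed_resolvent ?f x * ennreal (g x)
      + killed_resolvent (jump (resolvent ?f)) x * ennreal (g x) \<partial>m)"
  proof (intro nn_integral_cong)
    fix x assume x: "x \<in> space m"
    have "ennreal (?G x * g x) = resolvent ?f x * ennreal (g x)"
      unfolding ennreal_real_kernel[OF sub_markov_resolvent f x, symmetric]
      by (rule ennreal_mult') (simp add: real_kernel_def)
    then show "ennreal (?G x * g x) = killed_resolvent ?f x * ennreal (g x)
        + killed_resolvent (jump (resolvent ?f)) x * ennreal (g x)"
      by (simp add: resolvent_fixed_point[OF fm x] distrib_right)
  qed
  also have "\<dots> = (\<integral>\<^sup>+x. ?f x * ennreal (w x) \<partial>m) + (\<integral>\<^sup>+x. jump (resolvent ?f) x * ennreal (w x) \<partial>m)"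
    by (subst nn_integral_add) (auto simp: dual[OF fm] dual[OF jm])
  also have "(\<integral>\<^sup>+x. jump (resolvent ?f) x * ennreal (w x) \<partial>m) = (\<integral>\<^sup>+x. ennreal (?A x * (\<phi> x * w x)) \<partial>m)"
    using w0 A rate_nonneg
    by (intro nn_integral_cong) (simp add: jump_G ennreal_mult[symmetric] unit_test_def ac_simps)
  also have "\<dots> = ennreal (\<integral>x. ?A x * (\<phi> x * w x) \<partial>m)"
    using A w0 rate_nonneg
    by (intro nn_integral_eq_integral unit_test_integrable \<phi>w) (auto simp: unit_test_def intro!: AE_I2)
  also have "(\<integral>\<^sup>+x. ?f x * ennreal (w x) \<partial>m) = (\<integral>\<^sup>+x. ennreal (f x * w x) \<partial>m)"
    using f w0 by (intro nn_integral_cong) (simp add: ennreal_mult unit_test_def)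
  also have "\<dots> = ennreal (\<integral>x. f x * w x \<partial>m)"
    using f w0 by (intro nn_integral_eq_integral unit_test_integrable wi) (auto simp: unit_test_def)
  also have "ennreal (\<integral>x. f x * w x \<partial>m) + ennreal (\<integral>x. ?A x * (\<phi> x * w x) \<partial>m)
      = ennreal ((\<integral>x. f x * w x \<partial>m) + (\<integral>x. ?A x * (\<phi> x * w x) \<partial>m))"
    using f A w0 rate_nonneg
    by (intro ennreal_plus[symmetric] integral_nonneg_AE AE_I2) (auto simp: unit_test_def)
  finally show ?thesis
    using f A G w0 g0 rate_nonneg
    by (subst (asm) ennreal_inj)
      (auto simp: unit_test_def intro!: integral_nonneg_AE add_nonneg_nonneg AE_I2 elim!: eventually_mono)
qed

lemma minimal_orbit_resolvent:
  assumes f: "unit_test m f" and u: "integrable m u"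
  shows "damped_integral {0..} (T.orbit f u) = (\<integral>x. real_kernel m resolvent f x * u x \<partial>m)"
  unfolding resolvent_def[abs_def]
  by (rule T.damped_orbit_eq_resolvent[OF sigma_finite_measure_axioms sub_markov_transition adjoint_minimal _ _ f u])
    (auto simp: transition_neg)

text \<open>Put \<open>g = u - v\<close>, so that \<open>u\<close> is the resolvent of
  \<open>S\<close> at \<open>g\<close>. It has to be shown that \<open>u\<close> is also the
  resolvent of the transition semigroup at \<open>g - P (\<phi> u)\<close>, that is,
  \<open>\<langle>G f, g\<rangle> - \<langle>G f, P (\<phi> u)\<rangle> = \<langle>f,
  u\<rangle>\<close>. The lemma \<open>resolvent_integral_split\<close> gives \<open>\<langle>G f,
  g\<rangle> = \<langle>f, u\<rangle> + \<langle>J G f, \<phi> u\<rangle>\<close>, and the last term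
  is \<open>\<langle>G f, P (\<phi> u)\<rangle>\<close>. As \<open>g\<close> may change sign, it
  is applied to both parts of \<open>g\<close>; this splits \<open>u\<close> into two nonnegative
  elements of the domain.\<close>

lemma minimal_extends: "generator_extends_perturbation m \<phi> P S minimal"
  unfolding generator_extends_perturbation_def
proof safe
  fix u v assume uv: "(u, v) \<in> generator m S"
  then have u: "integrable m u" and v: "integrable m v" by (auto simp: generator_def)
  have "u \<in> L1_weighted m \<phi>" using uv S_killed by (auto simp: killed_flow_semigroup_def)
  then have "integrable m (\<lambda>x. \<phi> x * \<bar>u x\<bar>)" by (simp add: L1_weighted_def)
  then have \<phi>u: "integrable m (\<lambda>x. \<phi> x * u x)"
  proof (rule Bochner_Integration.integrable_bound)
    show "(\<lambda>x. \<phi> x * u x) \<in> borel_measurable m" using u by measurable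
    show "AE x in m. norm (\<phi> x * u x) \<le> norm (\<phi> x * \<bar>u x\<bar>)"
      by (intro AE_I2) (simp add: abs_mult)
  qed
  let ?p = "P (\<lambda>x. \<phi> x * u x)"
  have p: "integrable m ?p" using P_op \<phi>u by (auto simp: L1_operator_def)
  let ?g = "\<lambda>x. u x - v x"
  let ?gp = "\<lambda>x. max 0 (?g x)" and ?gn = "\<lambda>x. max 0 (- ?g x)"
  have g: "integrable m ?g" using u v by simp
  have gpn: "L1_nonneg m ?gp" "L1_nonneg m ?gn" using u v by (auto simp: L1_nonneg_def)
  then have gpni: "integrable m ?gp" "integrable m ?gn" by (auto simp: L1_nonneg_def)
  obtain wp wn where wp: "dual_density m killed_resolvent ?gp wp" "integrable m (\<lambda>x. \<phi> x * wp x)"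
    and wn: "dual_density m killed_resolvent ?gn wn" "integrable m (\<lambda>x. \<phi> x * wn x)"
    using killed_resolvent_in_generator gpn by meson
  have wi: "integrable m wp" "integrable m wn" using wp wn by (auto simp: dual_density_def)
  have u_eq: "AE x in m. u x = wp x - wn x"
  proof (rule AE_eq_by_tests)
    fix f assume f: "unit_test m f"
    let ?R = "real_kernel m killed_resolvent f"
    have R: "unit_test m ?R" by (rule unit_test_real_kernel[OF sub_markov_killed_resolvent f])
    have "(\<integral>x. f x * u x \<partial>m) = damped_integral {0..} (S.orbit f ?g)"
      by (rule S.generator_imp_resolvent[OF uv f, symmetric])
    also have "\<dots> = (\<integral>x. ?R x * ?g x \<partial>m)"
      unfolding killed_resolvent_def[abs_def]
      by (rule S.damped_orbit_eq_resolvent[OF sigma_finite_measure_axioms sub_markov_killed adjoint_killed _ _ f g])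
        (auto simp: killed_neg)
    also have "\<dots> = (\<integral>x. ?R x * ?gp x - ?R x * ?gn x \<partial>m)"
      by (intro Bochner_Integration.integral_cong) (auto simp: max_def algebra_simps)
    also have "\<dots> = (\<integral>x. ?R x * ?gp x \<partial>m) - (\<integral>x. ?R x * ?gn x \<partial>m)"
      by (intro Bochner_Integration.integral_diff unit_test_integrable R gpni)
    also have "\<dots> = (\<integral>x. f x * wp x \<partial>m) - (\<integral>x. f x * wn x \<partial>m)"
      using integral_dual_density[OF sub_markov_killed_resolvent f gpni(1) wp(1)]
        integral_dual_density[OF sub_markov_killed_resolvent f gpni(2) wn(1)] by simp
    also have "\<dots> = (\<integral>x. f x * (wp x - wn x) \<partial>m)"
      using f wi by (simp add: right_diff_distrib unit_test_integrable)
    finally show "(\<integral>x. f x * u x \<partial>m) = (\<integral>x. f x * (wp x - wn x) \<partial>m)" .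
  qed (use u wi in auto)
  let ?h = "\<lambda>x. ?g x - ?p x"
  have h: "integrable m ?h" using g p by simp
  have "(u, \<lambda>x. u x - ?h x) \<in> generator m minimal"
  proof (rule T.resolvent_imp_generator[OF u h])
    fix t :: real and f assume "0 \<le> t" "unit_test m f"
    then show "\<exists>f'. unit_test m f' \<and>
        (\<forall>w. integrable m w \<longrightarrow> (\<integral>x. f x * minimal t w x \<partial>m) = (\<integral>x. f' x * w x \<partial>m))"
      using minimal_integral unit_test_real_kernel[OF sub_markov_transition] by blast
  next
    fix f assume f: "unit_test m f"
    let ?G = "real_kernel m resolvent f"
    let ?A = "real_kernel m (\<lambda>f x. \<integral>\<^sup>+y. f y \<partial>J x) ?G"
    have G: "unit_test m ?G" by (rule unit_test_real_kernel[OF sub_markov_resolvent f])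
    have A: "unit_test m ?A" by (rule unit_test_real_kernel[OF sub_markov_average G])
    have "damped_integral {0..} (T.orbit f ?h) = (\<integral>x. ?G x * ?h x \<partial>m)"
      by (rule minimal_orbit_resolvent[OF f h])
    also have "\<dots> = (\<integral>x. (?G x * ?gp x - ?G x * ?gn x) - ?G x * ?p x \<partial>m)"
      by (intro Bochner_Integration.integral_cong) (auto simp: max_def algebra_simps)
    also have "\<dots> = (\<integral>x. ?G x * ?gp x \<partial>m) - (\<integral>x. ?G x * ?gn x \<partial>m) - (\<integral>x. ?G x * ?p x \<partial>m)"
      using unit_test_integrable[OF G gpni(1)] unit_test_integrable[OF G gpni(2)] unit_test_integrable[OF G p]
      by simp
    also have "(\<integral>x. ?G x * ?p x \<partial>m) = (\<integral>x. ?A x * (\<phi> x * u x) \<partial>m)"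
      using adjoint_average \<phi>u G by (simp add: adjoint_kernel_def)
    also have "(\<integral>x. ?G x * ?gp x \<partial>m) = (\<integral>x. f x * wp x \<partial>m) + (\<integral>x. ?A x * (\<phi> x * wp x) \<partial>m)"
      by (rule resolvent_integral_split[OF f gpn(1) wp])
    also have "(\<integral>x. ?G x * ?gn x \<partial>m) = (\<integral>x. f x * wn x \<partial>m) + (\<integral>x. ?A x * (\<phi> x * wn x) \<partial>m)"
      by (rule resolvent_integral_split[OF f gpn(2) wn])
    also have "(\<integral>x. ?A x * (\<phi> x * u x) \<partial>m) = (\<integral>x. ?A x * (\<phi> x * wp x) \<partial>m) - (\<integral>x. ?A x * (\<phi> x * wn x) \<partial>m)"
    proof -
      have "(\<integral>x. ?A x * (\<phi> x * u x) \<partial>m) = (\<integral>x. ?A x * (\<phi> x * wp x) - ?A x * (\<phi> x * wn x) \<partial>m)"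
        using u_eq unit_test_integrable[OF A \<phi>u] unit_test_integrable[OF A wp(2)] unit_test_integrable[OF A wn(2)]
        by (intro integral_cong_AE) (auto simp: right_diff_distrib elim!: eventually_mono)
      then show ?thesis
        using unit_test_integrable[OF A wp(2)] unit_test_integrable[OF A wn(2)] by simp
    qed
    finally have "damped_integral {0..} (T.orbit f ?h) = (\<integral>x. f x * wp x \<partial>m) - (\<integral>x. f x * wn x \<partial>m)"
      by simp
    also have "\<dots> = (\<integral>x. f x * wp x - f x * wn x \<partial>m)"
      using f wi by (simp add: unit_test_integrable)
    also have "\<dots> = (\<integral>x. f x * u x \<partial>m)"
      using u_eq unit_test_integrable[OF f u] unit_test_integrable[OF f wi(1)] unit_test_integrable[OF f wi(2)]
      by (intro integral_cong_AE) (auto simp: right_diff_distrib elim!: eventually_mono)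
    finally show "damped_integral {0..} (T.orbit f ?h) = (\<integral>x. f x * u x \<partial>m)" .
  qed
  then show "(u, \<lambda>x. v x + ?p x) \<in> generator m minimal" by (simp add: algebra_simps)
qed

section \<open>Identification of the minimal semigroup\<close>

text \<open>Let \<open>\<rho>(g)\<close> be the Laplace transform of the mass of \<open>Z(t)g\<close>, and
  \<open>w\<close> the resolvent of \<open>S\<close> at \<open>g\<close>. Since \<open>w\<close> is
  also the resolvent of \<open>Z\<close> at \<open>g - P (\<phi> w)\<close>, one has
  \<open>\<rho>(g) = \<integral> w dm + \<rho>(P (\<phi> w))\<close>. The terms of the
  series obey the same recursion: the first one is \<open>\<integral> w dm\<close>, and the next
  ones for \<open>g\<close> are those for \<open>P (\<phi> w)\<close>. Induction on the number of
  terms for all \<open>g\<close> at once leaves a remainder \<open>\<rho> \<ge> 0\<close>.\<close>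

lemma mass_lower_bound:
  assumes Z: "substochastic_semigroup m Z" and ext: "generator_extends_perturbation m \<phi> P S Z"
    and g: "L1_nonneg m g"
  shows "(\<Sum>n<N. \<integral>\<^sup>+x. after_jumps_resolvent n (\<lambda>_. 1) x * ennreal (g x) \<partial>m)
    \<le> ennreal (damped_integral {0..} (L1_semigroup.orbit m Z (\<lambda>_. 1) g))"
  using g
proof (induction N arbitrary: g)
  case (Suc N)
  interpret Z: L1_semigroup m Z by unfold_locales (rule Z)
  note g = Suc.prems
  have gi: "integrable m g" using g by (simp add: L1_nonneg_def)
  obtain w where w: "dual_density m killed_resolvent g w"
    and gen: "(w, \<lambda>x. w x - g x) \<in> generator m S" and \<phi>w: "integrable m (\<lambda>x. \<phi> x * w x)"
    using killed_resolvent_in_generator[OF g] by auto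
  have wi: "integrable m w" and w0: "\<And>x. 0 \<le> w x"
    and dual: "\<And>f. f \<in> borel_measurable m \<Longrightarrow>
      (\<integral>\<^sup>+x. killed_resolvent f x * ennreal (g x) \<partial>m) = (\<integral>\<^sup>+x. f x * ennreal (w x) \<partial>m)"
    using w by (auto simp: dual_density_def)
  let ?p = "P (\<lambda>x. \<phi> x * w x)" and ?one = "\<lambda>_::'a. 1 :: ennreal" and ?o = "\<lambda>_::'a. 1 :: real"
  have \<phi>wn: "L1_nonneg m (\<lambda>x. \<phi> x * w x)"
    using \<phi>w w0 rate_nonneg by (auto simp: L1_nonneg_def intro!: AE_I2)
  have p: "L1_nonneg m ?p" using P_nonneg_transition[OF \<phi>wn] by simp
  then have pi: "integrable m ?p" by (simp add: L1_nonneg_def)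
  have "(w, \<lambda>x. (w x - g x) + ?p x) \<in> generator m Z"
    using ext gen by (auto simp: generator_extends_perturbation_def)
  from Z.generator_imp_resolvent[OF this unit_test_one]
  have "damped_integral {0..} (Z.orbit ?o (\<lambda>x. g x - ?p x)) = (\<integral>x. w x \<partial>m)"
    by (simp add: algebra_simps)
  moreover have "damped_integral {0..} (Z.orbit ?o (\<lambda>x. g x - ?p x))
      = damped_integral {0..} (Z.orbit ?o g) - damped_integral {0..} (Z.orbit ?o ?p)"
  proof -
    have i: "set_integrable lborel {0..} (\<lambda>t. exp (- t) * Z.orbit ?o a t)" if "integrable m a" for a
      using Z.orbit_continuous[OF unit_test_one that] Z.orbit_bound[OF unit_test_one that]
      by (rule damped_integrable) auto
    have "damped_integral {0..} (Z.orbit ?o (\<lambda>x. g x - ?p x))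
        = (LINT t:{0..}|lborel. exp (- t) * Z.orbit ?o g t - exp (- t) * Z.orbit ?o ?p t)"
      unfolding damped_integral_def
      by (intro set_lebesgue_integral_cong)
        (auto simp: Z.orbit_diff[OF unit_test_one gi pi] right_diff_distrib)
    then show ?thesis
      unfolding damped_integral_def using i[OF gi] i[OF pi] by (simp add: set_integral_diff)
  qed
  ultimately have rho: "damped_integral {0..} (Z.orbit ?o g)
      = (\<integral>x. w x \<partial>m) + damped_integral {0..} (Z.orbit ?o ?p)" by simp
  have p_damped: "0 \<le> damped_integral {0..} (Z.orbit ?o ?p)"
    unfolding damped_integral_def set_lebesgue_integral_def
  proof (rule integral_nonneg_AE, intro AE_I2)
    fix s :: real
    show "0 \<le> indicator {0..} s *\<^sub>R (exp (- s) * Z.orbit ?o ?p s)"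
      using Z.nonneg[OF _ p, of s] by (auto simp: indicator_def Z.orbit_def L1_nonneg_def intro!: mult_nonneg_nonneg integral_nonneg_AE)
  qed
  have first: "(\<integral>\<^sup>+x. after_jumps_resolvent 0 ?one x * ennreal (g x) \<partial>m) = ennreal (\<integral>x. w x \<partial>m)"
  proof -
    have "(\<integral>\<^sup>+x. after_jumps_resolvent 0 ?one x * ennreal (g x) \<partial>m) = (\<integral>\<^sup>+x. ennreal (w x) \<partial>m)"
      using dual[of ?one] by (simp add: after_jumps_resolvent_def killed_resolvent_def)
    then show ?thesis using wi w0 by (simp add: nn_integral_eq_integral)
  qed
  have later: "(\<integral>\<^sup>+x. after_jumps_resolvent (Suc n) ?one x * ennreal (g x) \<partial>m)
      = (\<integral>\<^sup>+x. after_jumps_resolvent n ?one x * ennreal (?p x) \<partial>m)" for n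
  proof -
    let ?a = "after_jumps_resolvent n ?one"
    have a: "?a \<in> borel_measurable m"
      by (intro kernel_operator_measurable[OF kernel_operator_after_jumps_resolvent]) simp
    have "(\<integral>\<^sup>+x. after_jumps_resolvent (Suc n) ?one x * ennreal (g x) \<partial>m)
        = (\<integral>\<^sup>+x. killed_resolvent (jump ?a) x * ennreal (g x) \<partial>m)"
      by (intro nn_integral_cong) (simp add: after_jumps_resolvent_Suc)
    also have "\<dots> = (\<integral>\<^sup>+x. jump ?a x * ennreal (w x) \<partial>m)"
      by (intro dual kernel_operator_measurable[OF kernel_operator_jump] a)
    also have "\<dots> = (\<integral>\<^sup>+x. (\<integral>\<^sup>+y. ?a y \<partial>J x) * ennreal (\<phi> x * w x) \<partial>m)"
      using w0 rate_nonneg by (intro nn_integral_cong) (simp add: jump_def ennreal_mult ac_simps)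
    also have "\<dots> = (\<integral>\<^sup>+x. ?a x * ennreal (?p x) \<partial>m)"
      by (rule adjoint_kernel_nn_integral[OF sigma_finite_measure_axioms sub_markov_average adjoint_average \<phi>wn a])
    finally show ?thesis .
  qed
  have "(\<Sum>n<Suc N. \<integral>\<^sup>+x. after_jumps_resolvent n ?one x * ennreal (g x) \<partial>m)
      = ennreal (\<integral>x. w x \<partial>m) + (\<Sum>n<N. \<integral>\<^sup>+x. after_jumps_resolvent n ?one x * ennreal (?p x) \<partial>m)"
    unfolding sum.lessThan_Suc_shift by (simp only: first later)
  also have "\<dots> \<le> ennreal (\<integral>x. w x \<partial>m) + ennreal (damped_integral {0..} (Z.orbit ?o ?p))"
    by (intro add_left_mono Suc.IH p)
  also have "\<dots> = ennreal (damped_integral {0..} (Z.orbit ?o g))"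
    unfolding rho using w0 p_damped by (intro ennreal_plus[symmetric] integral_nonneg_AE) auto
  finally show ?case .
qed simp

text \<open>Minimality and \<open>minimal_extends\<close> give \<open>Z(t)u \<le> T(t)u\<close>;
  \<open>mass_lower_bound\<close> gives the opposite inequality for the transformed masses. So the
  masses agree for every \<open>t\<close>, and ordered functions of equal integral agree.\<close>

theorem minimal_semigroup_eq:
  assumes Z: "minimal_semigroup m \<phi> P S Z" and t: "0 \<le> t" and u: "L1_nonneg m u"
  shows "AE x in m. Z t u x = minimal t u x"
proof -
  have sub: "substochastic_semigroup m Z" and ext: "generator_extends_perturbation m \<phi> P S Z"
    using Z by (auto simp: minimal_semigroup_def)
  have le: "AE x in m. Z s u x \<le> minimal s u x" if "0 \<le> s" for s
    using Z minimal_substochastic minimal_extends that u unfolding minimal_semigroup_def by blast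
  interpret Z: L1_semigroup m Z by unfold_locales (rule sub)
  let ?o = "\<lambda>_::'a. 1 :: real" and ?one = "\<lambda>_::'a. 1 :: ennreal"
  have ui: "integrable m u" and u0: "AE x in m. 0 \<le> u x" using u by (auto simp: L1_nonneg_def)
  let ?a = "T.orbit ?o u" and ?b = "Z.orbit ?o u"
  have "ennreal (damped_integral {0..} ?a) \<le> ennreal (damped_integral {0..} ?b)"
  proof -
    have R: "unit_test m (real_kernel m resolvent ?o)"
      by (rule unit_test_real_kernel[OF sub_markov_resolvent unit_test_one])
    have [measurable]: "after_jumps_resolvent n ?one \<in> borel_measurable m" for n
      by (intro kernel_operator_measurable[OF kernel_operator_after_jumps_resolvent]) simp
    have "ennreal (damped_integral {0..} ?a) = (\<integral>\<^sup>+x. ennreal (real_kernel m resolvent ?o x * u x) \<partial>m)"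
      unfolding minimal_orbit_resolvent[OF unit_test_one ui] using R u0
      by (intro nn_integral_eq_integral[symmetric] unit_test_integrable ui) (auto simp: unit_test_def)
    also have "\<dots> = (\<integral>\<^sup>+x. (\<Sum>n. after_jumps_resolvent n ?one x * ennreal (u x)) \<partial>m)"
    proof (intro nn_integral_cong)
      fix x assume x: "x \<in> space m"
      have "ennreal (real_kernel m resolvent ?o x * u x) = resolvent ?one x * ennreal (u x)"
        using ennreal_real_kernel[OF sub_markov_resolvent unit_test_one x]
        by (simp add: ennreal_mult' real_kernel_def)
      then show "ennreal (real_kernel m resolvent ?o x * u x)
          = (\<Sum>n. after_jumps_resolvent n ?one x * ennreal (u x))"
        using x by (simp add: resolvent_series)
    qed
    also have "\<dots> = (\<Sum>n. \<integral>\<^sup>+x. after_jumps_resolvent n ?one x * ennreal (u x) \<partial>m)"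
      using borel_measurable_integrable[OF ui] by (intro nn_integral_suminf) measurable
    also have "\<dots> \<le> ennreal (damped_integral {0..} ?b)"
      unfolding suminf_eq_SUP by (intro SUP_least mass_lower_bound[OF sub ext u])
    finally show ?thesis .
  qed
  moreover have "0 \<le> damped_integral {0..} ?b"
    unfolding damped_integral_def set_lebesgue_integral_def
  proof (rule integral_nonneg_AE, intro AE_I2)
    fix s :: real
    show "0 \<le> indicator {0..} s *\<^sub>R (exp (- s) * ?b s)"
      using Z.nonneg[OF _ u, of s] by (auto simp: indicator_def Z.orbit_def L1_nonneg_def intro!: mult_nonneg_nonneg integral_nonneg_AE)
  qed
  ultimately have ab: "damped_integral {0..} ?a \<le> damped_integral {0..} ?b"
    by (simp add: ennreal_le_iff)
  have c0: "?a s - ?b s = 0" if "0 \<le> s" for s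
  proof (rule damped_integral_eq_0[of "\<lambda>s. ?a s - ?b s" "L1_norm m u + L1_norm m u"])
    show "continuous_on {0..} (\<lambda>s. ?a s - ?b s)"
      by (intro continuous_on_diff T.orbit_continuous Z.orbit_continuous unit_test_one ui)
    show "\<bar>?a s - ?b s\<bar> \<le> L1_norm m u + L1_norm m u" if "0 \<le> s" for s
      using T.orbit_bound[OF unit_test_one ui that] Z.orbit_bound[OF unit_test_one ui that] by linarith
    show "0 \<le> ?a s - ?b s" if "0 \<le> s" for s
      using le[OF that] that ui
      by (auto simp: T.orbit_def Z.orbit_def intro!: integral_mono_AE minimal_integrable Z.integrable)
    have i: "set_integrable lborel {0..} (\<lambda>t. exp (- t) * ?a t)" "set_integrable lborel {0..} (\<lambda>t. exp (- t) * ?b t)"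
      using damped_integrable[OF T.orbit_continuous[OF unit_test_one ui] T.orbit_bound[OF unit_test_one ui]]
        damped_integrable[OF Z.orbit_continuous[OF unit_test_one ui] Z.orbit_bound[OF unit_test_one ui]] by auto
    then show "damped_integral {0..} (\<lambda>s. ?a s - ?b s) \<le> 0"
      using ab by (simp add: damped_integral_def right_diff_distrib set_integral_diff)
  qed (rule that)
  have i: "integrable m (minimal t u)" "integrable m (Z t u)"
    using ui t by (auto intro: minimal_integrable Z.integrable)
  have "(\<integral>x. minimal t u x - Z t u x \<partial>m) = 0"
    using c0[OF t] i by (simp add: T.orbit_def Z.orbit_def)
  then have "AE x in m. minimal t u x - Z t u x = 0"
    using integral_nonneg_eq_0_iff_AE[of m "\<lambda>x. minimal t u x - Z t u x"] i le[OF t] by auto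
  then show ?thesis by auto
qed

lemma minimal_semigroup_nn_integral:
  assumes Z: "minimal_semigroup m \<phi> P S Z" and t: "0 \<le> t" and u: "L1_nonneg m u"
    and f: "f \<in> borel_measurable m"
  shows "(\<integral>\<^sup>+x. f x * ennreal (Z t u x) \<partial>m) = (\<integral>\<^sup>+x. transition t f x * ennreal (u x) \<partial>m)"
proof -
  have "(\<integral>\<^sup>+x. f x * ennreal (Z t u x) \<partial>m) = (\<integral>\<^sup>+x. f x * ennreal (minimal t u x) \<partial>m)"
    using minimal_semigroup_eq[OF Z t u] by (intro nn_integral_cong_AE) auto
  also have "\<dots> = (\<integral>\<^sup>+x. transition t f x * ennreal (u x) \<partial>m)"
    by (rule adjoint_kernel_nn_integral[OF sigma_finite_measure_axioms sub_markov_transition adjoint_minimal u f, symmetric])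
  finally show ?thesis .
qed

text \<open>For the forward direction one density that is positive everywhere is enough:
  \<open>V(t) 1 \<le> 1\<close>, and equality of the integrals against it forces equality almost
  everywhere.\<close>

theorem stochastic_iff_conservative:
  assumes Z: "minimal_semigroup m \<phi> P S Z"
  shows "stochastic_semigroup m Z \<longleftrightarrow> (\<forall>t\<ge>0. AE x in m. transition t (\<lambda>_. 1) x = 1)"
proof -
  have sub: "substochastic_semigroup m Z" using Z by (simp add: minimal_semigroup_def)
  interpret Z: L1_semigroup m Z by unfold_locales (rule sub)
  let ?one = "\<lambda>_::'a. 1 :: ennreal"
  have mass: "ennreal (L1_norm m (Z t u)) = (\<integral>\<^sup>+x. transition t ?one x * ennreal (u x) \<partial>m)"
    if t: "0 \<le> t" and u: "L1_nonneg m u" for t u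
  proof -
    have Zu: "L1_nonneg m (Z t u)" by (rule Z.nonneg[OF t u])
    then have "ennreal (L1_norm m (Z t u)) = (\<integral>\<^sup>+x. ennreal (Z t u x) \<partial>m)"
      unfolding L1_norm_nonneg_eq[OF Zu] by (intro nn_integral_eq_integral[symmetric]) (auto simp: L1_nonneg_def)
    then show ?thesis using minimal_semigroup_nn_integral[OF Z t u, of ?one] by simp
  qed
  have norm: "ennreal (L1_norm m u) = (\<integral>\<^sup>+x. ennreal (u x) \<partial>m)" if u: "L1_nonneg m u" for u
    unfolding L1_norm_nonneg_eq[OF u] using u
    by (intro nn_integral_eq_integral[symmetric]) (auto simp: L1_nonneg_def)
  show ?thesis
  proof
    assume st: "stochastic_semigroup m Z"
    show "\<forall>t\<ge>0. AE x in m. transition t ?one x = 1"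
    proof (intro allI impI)
      fix t :: real assume t: "0 \<le> t"
      obtain h :: "'a \<Rightarrow> real" where h: "integrable m h" "\<And>x. x \<in> space m \<Longrightarrow> 0 < h x"
        using positive_weight by auto
      have hn: "L1_nonneg m h" using h less_imp_le by (auto simp: L1_nonneg_def)
      define c where "c = L1_norm m h"
      have [measurable]: "transition t ?one \<in> borel_measurable m" "h \<in> borel_measurable m"
        using h by (auto intro!: kernel_operator_measurable[OF kernel_operator_transition])
      show "AE x in m. transition t ?one x = 1"
      proof (cases "c = 0")
        case True
        then have "AE x in m. h x = 0"
          using integral_nonneg_eq_0_iff_AE[of m "\<lambda>x. \<bar>h x\<bar>"] h by (simp add: c_def L1_norm_def)
        with AE_space show ?thesis by eventually_elim (use h(2) in force)
      next
        case False
        then have c: "0 < c" using L1_norm_nonneg[of m h] by (simp add: c_def)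
        let ?v = "\<lambda>x. h x / c"
        have v: "L1_density m ?v"
          using hn c by (auto simp: L1_density_def L1_nonneg_def L1_norm_def c_def abs_divide)
        then have vn: "L1_nonneg m ?v" by (simp add: L1_density_def)
        have "L1_norm m (Z t ?v) = 1"
          using st v t by (auto simp: stochastic_semigroup_def stochastic_operator_def L1_density_def)
        then have eq: "(\<integral>\<^sup>+x. transition t ?one x * ennreal (?v x) \<partial>m) = (\<integral>\<^sup>+x. ennreal (?v x) \<partial>m)"
          using mass[OF t vn] norm[OF vn] v by (simp add: L1_density_def)
        have fin: "(\<integral>\<^sup>+x. ennreal (?v x) \<partial>m) \<noteq> \<infinity>"
          using norm[OF vn] by (metis ennreal_neq_top infinity_ennreal_def)
        have le: "transition t ?one x * ennreal (?v x) \<le> ennreal (?v x)" if "x \<in> space m" for x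
          using mult_right_mono[OF transition_le_1[OF that, of t], of "ennreal (?v x)"] by simp
        have "(\<integral>\<^sup>+x. ennreal (?v x) - transition t ?one x * ennreal (?v x) \<partial>m) = 0"
          using fin le eq by (subst nn_integral_diff) auto
        then have "AE x in m. ennreal (?v x) - transition t ?one x * ennreal (?v x) = 0"
          by (simp add: nn_integral_0_iff_AE)
        with AE_space show ?thesis
        proof eventually_elim
          case (elim x)
          obtain r where r: "0 \<le> r" "transition t ?one x = ennreal r" "r \<le> 1"
            using transition_le_1[OF elim(1), of t] by (cases "transition t ?one x") (auto simp: top_unique)
          have v0: "0 < ?v x" using h(2)[OF elim(1)] c by simp
          have "ennreal (?v x) \<le> ennreal (r * ?v x)"
            unfolding ennreal_mult'[OF r(1)] using elim(2) r by (simp add: diff_eq_0_iff_ennreal)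
          then have "1 * ?v x \<le> r * ?v x"
            using mult_nonneg_nonneg[OF r(1) less_imp_le[OF v0]] by (subst (asm) ennreal_le_iff) auto
          then have "1 \<le> r" using \<open>0 < ?v x\<close> by (rule mult_right_le_imp_le)
          then show ?case using r by simp
        qed
      qed
    qed
  next
    assume V: "\<forall>t\<ge>0. AE x in m. transition t ?one x = 1"
    show "stochastic_semigroup m Z"
      unfolding stochastic_semigroup_def stochastic_operator_def
    proof (intro conjI allI impI Z.op)
      show "strongly_continuous_semigroup m Z" using sub by (simp add: substochastic_semigroup_def)
      fix t :: real and u assume t: "0 \<le> t" and u: "L1_density m u"
      then have un: "L1_nonneg m u" by (simp add: L1_density_def)
      have "ennreal (L1_norm m (Z t u)) = (\<integral>\<^sup>+x. ennreal (u x) \<partial>m)"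
        unfolding mass[OF t un] using V t by (intro nn_integral_cong_AE) auto
      also have "\<dots> = ennreal (L1_norm m u)" by (rule norm[OF un, symmetric])
      finally show "L1_density m (Z t u)"
        using u Z.nonneg[OF t un] by (simp add: L1_density_def L1_norm_nonneg)
    qed
  qed
qed

end

section \<open>The jump chain and its driving noise\<close>

text \<open>As for the flow, \<open>\<kappa>\<close> is taken to be measurable in an arbitrary real
  argument.\<close>

locale pdmp_process = pdmp_flow m \<pi> \<phi> J + prob_space M
  for m :: "'a measure" and \<pi> :: "real \<Rightarrow> 'a \<Rightarrow> 'a" and \<phi> :: "'a \<Rightarrow> real" and J :: "'a \<Rightarrow> 'a measure"
    and M :: "'w measure" +
  fixes \<kappa> :: "real \<Rightarrow> 'a \<Rightarrow> 'a" and \<epsilon> \<theta> :: "nat \<Rightarrow> 'w \<Rightarrow> real"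
  assumes \<kappa>_measurable: "(\<lambda>(q, x). \<kappa> q x) \<in> borel \<Otimes>\<^sub>M m \<rightarrow>\<^sub>M m"
    and \<kappa>_law: "x \<in> space m \<Longrightarrow> B \<in> sets m \<Longrightarrow> emeasure (J x) B = emeasure lborel {q\<in>{0..1}. \<kappa> q x \<in> B}"
    and noise: "driving_noise M \<epsilon> \<theta>"
begin

abbreviation "exp_law \<equiv> density lborel (\<lambda>e. ennreal (exponential_density 1 e))"
abbreviation "unif_law \<equiv> uniform_measure lborel {0<..<1::real}"

lemma \<kappa>_measurable' [measurable (raw)]:
  "g \<in> borel_measurable Q \<Longrightarrow> k \<in> Q \<rightarrow>\<^sub>M m \<Longrightarrow> (\<lambda>p. \<kappa> (g p) (k p)) \<in> Q \<rightarrow>\<^sub>M m"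
  using measurable_compose[OF measurable_Pair \<kappa>_measurable, of g Q k] by simp

lemma \<kappa>_in_space: "x \<in> space m \<Longrightarrow> \<kappa> q x \<in> space m"
  by (rule measurable_space[OF \<kappa>_measurable'[of "\<lambda>_. q" m "\<lambda>x. x"]]) auto

lemma jump_law:
  assumes x: "x \<in> space m" and f [measurable]: "f \<in> borel_measurable m"
  shows "(\<integral>\<^sup>+q. f (\<kappa> q x) \<partial>unif_law) = (\<integral>\<^sup>+y. f y \<partial>J x)"
proof -
  have [measurable]: "x \<in> space m" by fact
  have J_eq: "J x = distr (density lborel (indicator {0..1})) m (\<lambda>q. \<kappa> q x)"
  proof (rule measure_eqI)
    fix B assume "B \<in> sets (J x)"
    then have B [measurable]: "B \<in> sets m" using sets_jump[OF x] by simp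
    have [measurable]: "(\<lambda>q. \<kappa> q x) -` B \<in> sets borel"
      using measurable_sets[of "\<lambda>q. \<kappa> q x" borel m B] by simp
    have "emeasure (distr (density lborel (indicator {0..1})) m (\<lambda>q. \<kappa> q x)) B
        = (\<integral>\<^sup>+q. indicator {0..1} q * indicator ((\<lambda>q. \<kappa> q x) -` B) q \<partial>lborel)"
      by (subst emeasure_distr) (auto simp: emeasure_density)
    also have "\<dots> = (\<integral>\<^sup>+q. indicator {q\<in>{0..1}. \<kappa> q x \<in> B} q \<partial>lborel)"
      by (intro nn_integral_cong) (auto simp: indicator_def)
    also have "\<dots> = emeasure (J x) B"
      unfolding \<kappa>_law[OF x B] by (rule nn_integral_indicator) measurable
    finally show "emeasure (J x) B = emeasure (distr (density lborel (indicator {0..1})) m (\<lambda>q. \<kappa> q x)) B" ..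
  qed (simp add: sets_jump[OF x])
  have "(\<integral>\<^sup>+q. f (\<kappa> q x) \<partial>unif_law) = (\<integral>\<^sup>+q. f (\<kappa> q x) * indicator {0<..<1} q \<partial>lborel)"
    by (subst nn_integral_uniform_measure) (auto simp: divide_ennreal_def)
  also have "\<dots> = (\<integral>\<^sup>+q. indicator {0..1} q * f (\<kappa> q x) \<partial>lborel)"
    using AE_lborel_singleton[of "0::real"] AE_lborel_singleton[of "1::real"]
    by (intro nn_integral_cong_AE) (auto elim!: eventually_elim2 simp: indicator_def)
  also have "\<dots> = (\<integral>\<^sup>+y. f y \<partial>J x)"
    unfolding J_eq by (simp add: nn_integral_distr nn_integral_density)
  finally show ?thesis .
qed

lemma prob_space_exp_law: "prob_space exp_law"
  by (rule prob_space_exponential_density) simp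

lemma prob_space_unif_law: "prob_space unif_law"
  by (rule prob_space_uniform_measure) auto

lemma exp_law_tail:
  assumes "0 \<le> a" shows "(\<integral>\<^sup>+e. indicator {a<..} e \<partial>exp_law) = ennreal (exp (- a))"
proof -
  have "(\<integral>\<^sup>+e. indicator {a<..} e \<partial>exp_law) = (\<integral>\<^sup>+e. ennreal (exp (- e)) * indicator {a<..} e \<partial>lborel)"
    using assms by (subst nn_integral_density)
      (auto intro!: nn_integral_cong simp: exponential_density_def indicator_def)
  then show ?thesis by (simp add: exp_tail)
qed

text \<open>Two laws on the line are compared through their tails: that of the holding time at
  \<open>t\<close> is the probability that an exponential variable exceeds
  \<open>\<Phi> x t\<close>, that of the density is \<open>hazard_tail\<close>.\<close>

lemma holding_time_law:
  assumes x: "x \<in> space m" and h [measurable]: "h \<in> borel_measurable borel"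
  shows "(\<integral>\<^sup>+e. h (\<tau> x e) \<partial>exp_law)
    = (\<integral>\<^sup>+r. ennreal (exp (- \<Phi> x r)) * ennreal (\<phi> (\<pi> r x)) * indicator {0..} r * h r \<partial>lborel)"
proof -
  have [measurable]: "x \<in> space m" by fact
  let ?d = "\<lambda>r. ennreal (exp (- \<Phi> x r)) * ennreal (\<phi> (\<pi> r x)) * indicator {0..} r"
  let ?M1 = "distr exp_law borel (\<tau> x)" and ?M2 = "density lborel ?d"
  have tau [measurable]: "\<tau> x \<in> borel_measurable borel"
    using inverse_measurable[of "\<lambda>e. e" borel "\<lambda>_. x"] by simp
  interpret M1: real_distribution ?M1
    by (intro real_distribution.intro prob_space.prob_space_distr prob_space_exp_law real_distribution_axioms.intro)
      auto
  interpret M2: prob_space ?M2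
    by (rule prob_spaceI) (use hazard_tail[OF x, of 0] in \<open>simp add: emeasure_density cumulative_rate_zero\<close>)
  interpret M2: real_distribution ?M2 by unfold_locales auto
  have "emeasure ?M1 {t<..} = emeasure ?M2 {t<..}" for t
  proof (cases "0 \<le> t")
    case True
    have "emeasure ?M1 {t<..} = (\<integral>\<^sup>+e. indicator {t<..} (\<tau> x e) \<partial>exp_law)"
      using nn_integral_distr[of "\<tau> x" exp_law borel "indicator {t<..}"] by simp
    also have "\<dots> = (\<integral>\<^sup>+e. indicator {\<Phi> x t<..} e \<partial>exp_law)"
      using less_inverse_iff[OF x True] by (intro nn_integral_cong) (auto simp: indicator_def)
    also have "\<dots> = ennreal (exp (- \<Phi> x t))"
      by (rule exp_law_tail[OF cumulative_rate_nonneg[OF x]])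
    also have "\<dots> = (\<integral>\<^sup>+r. ennreal (exp (- \<Phi> x r)) * ennreal (\<phi> (\<pi> r x)) * indicator {t..} r \<partial>lborel)"
      by (rule hazard_tail[OF x True, symmetric])
    also have "\<dots> = (\<integral>\<^sup>+r. ?d r * indicator {t<..} r \<partial>lborel)"
      using AE_lborel_singleton[of t] True
      by (intro nn_integral_cong_AE) (auto elim!: eventually_mono simp: indicator_def)
    also have "\<dots> = emeasure ?M2 {t<..}" by (simp add: emeasure_density)
    finally show ?thesis .
  next
    case False
    have "t < \<tau> x e" for e
      using False inverse_nonneg[OF x, of e] by linarith
    then have "\<tau> x -` {t<..} = UNIV" by auto
    then have "emeasure ?M1 {t<..} = emeasure ?M1 (space ?M1)"
      by (simp add: emeasure_distr)
    moreover have "emeasure ?M2 {t<..} = emeasure ?M2 (space ?M2)"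
      using False by (auto simp: emeasure_density indicator_def intro!: nn_integral_cong)
    ultimately show ?thesis
      using M1.emeasure_space_1 M2.emeasure_space_1 by simp
  qed
  then have "measure ?M1 {t<..} = measure ?M2 {t<..}" for t by (simp add: measure_def)
  moreover have "measure ?M1 {..t} = 1 - measure ?M1 {t<..}" "measure ?M2 {..t} = 1 - measure ?M2 {t<..}" for t
    using M1.prob_compl[of "{t<..}"] M2.prob_compl[of "{t<..}"]
    by (simp_all add: Compl_eq_Diff_UNIV[symmetric])
  ultimately have "?M1 = ?M2"
    by (intro cdf_unique M1.real_distribution_axioms M2.real_distribution_axioms ext) (simp add: cdf_def)
  then have "(\<integral>\<^sup>+r. h r \<partial>?M1) = (\<integral>\<^sup>+r. h r \<partial>?M2)" by simp
  then show ?thesis by (simp add: nn_integral_distr nn_integral_density)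
qed

text \<open>The transition operator of the Markov chain \<open>(t\<^sub>n, \<xi>\<^sub>n)\<close> of jump
  times and post-jump states.\<close>

definition step :: "(real \<times> 'a \<Rightarrow> ennreal) \<Rightarrow> real \<times> 'a \<Rightarrow> ennreal" where
  "step F = (\<lambda>(s, y). \<integral>\<^sup>+r. killed r (jump (\<lambda>z. F (s + r, z))) y \<partial>lborel)"

lemma step_measurable [measurable]:
  assumes F: "F \<in> borel_measurable (borel \<Otimes>\<^sub>M m)"
  shows "step F \<in> borel_measurable (borel \<Otimes>\<^sub>M m)"
proof -
  have "(\<lambda>q. F (fst (fst (fst (fst q))) + snd (fst (fst q)), snd q))
      \<in> borel_measurable ((((borel \<Otimes>\<^sub>M m) \<Otimes>\<^sub>M lborel) \<Otimes>\<^sub>M m) \<Otimes>\<^sub>M m)"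
    using F by measurable
  then have "(\<lambda>q. jump (\<lambda>z. F (fst (fst (fst q)) + snd (fst q), z)) (snd q))
      \<in> borel_measurable (((borel \<Otimes>\<^sub>M m) \<Otimes>\<^sub>M lborel) \<Otimes>\<^sub>M m)"
    by (intro jump_op_measurable) (simp_all add: split_beta')
  then have "(\<lambda>q. killed (snd q) (jump (\<lambda>z. F (fst (fst q) + snd q, z))) (snd (fst q)))
      \<in> borel_measurable ((borel \<Otimes>\<^sub>M m) \<Otimes>\<^sub>M lborel)"
    by (intro killed_measurable) (simp_all add: split_beta')
  then show ?thesis
    unfolding step_def split_beta'
    by (intro lborel.borel_measurable_nn_integral) (simp add: split_beta')
qed

lemma step_law:
  assumes F [measurable]: "F \<in> borel_measurable (borel \<Otimes>\<^sub>M m)" and y: "y \<in> space m"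
  shows "(\<integral>\<^sup>+e. (\<integral>\<^sup>+q. F (s + \<tau> y e, \<kappa> q (\<pi> (\<tau> y e) y)) \<partial>unif_law) \<partial>exp_law) = step F (s, y)"
proof -
  have [measurable]: "y \<in> space m" by fact
  let ?h = "\<lambda>r. \<integral>\<^sup>+z. F (s + r, z) \<partial>J (\<pi> r y)"
  have h: "?h \<in> borel_measurable borel"
  proof (rule nn_integral_measurable_subprob_algebra2)
    show "(\<lambda>(r, z). F (s + r, z)) \<in> borel_measurable (borel \<Otimes>\<^sub>M m)" by measurable
    show "(\<lambda>r. J (\<pi> r y)) \<in> borel \<rightarrow>\<^sub>M subprob_algebra m"
      by (rule measurable_compose[OF _ jump_subprob]) measurable
  qed
  have "(\<integral>\<^sup>+e. (\<integral>\<^sup>+q. F (s + \<tau> y e, \<kappa> q (\<pi> (\<tau> y e) y)) \<partial>unif_law) \<partial>exp_law) = (\<integral>\<^sup>+e. ?h (\<tau> y e) \<partial>exp_law)"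
    by (intro nn_integral_cong jump_law[of _ "\<lambda>z. F (_, z)"] flow_in_space y) measurable
  also have "\<dots> = step F (s, y)"
    unfolding holding_time_law[OF y h] step_def prod.case killed_def jump_def
    by (intro nn_integral_cong) (simp add: ac_simps)
  finally show ?thesis .
qed

text \<open>This connects the forward iteration along the chain with the recursion over the first jump:
  adding a jump in front shifts the elapsed time \<open>s\<close>.\<close>

lemma step_power_after_jumps:
  assumes f: "f \<in> borel_measurable m" and y: "y \<in> space m"
  shows "(step ^^ n) (\<lambda>(s, y). killed (t - s) f y) (s, y) = after_jumps n (t - s) f y"
  using y
proof (induction n arbitrary: s y)
  case (Suc n)
  show ?case
    unfolding funpow.simps o_apply step_def[of "(step ^^ n) _"] prod.case after_jumps.simps
    by (intro nn_integral_cong kernel_operator_cong[OF kernel_operator_killed_jump _ Suc.prems])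
      (simp add: Suc.IH diff_diff_eq)
qed simp

section \<open>The law of the chain\<close>

lemma post_jump_state_cong:
  assumes "\<And>i. 1 \<le> i \<Longrightarrow> i \<le> n \<Longrightarrow> e i = e' i \<and> q i = q' i"
  shows "post_jump_state \<pi> \<phi> \<kappa> x e q n = post_jump_state \<pi> \<phi> \<kappa> x e' q' n"
  using assms by (induction n) (auto simp: Let_def)

lemma jump_time_Suc:
  "jump_time \<pi> \<phi> \<kappa> x e q (Suc n)
    = jump_time \<pi> \<phi> \<kappa> x e q n + \<tau> (post_jump_state \<pi> \<phi> \<kappa> x e q n) (e (Suc n))"
  by (simp add: jump_time_def holding_time_def)

lemma jump_time_cong:
  assumes "\<And>i. 1 \<le> i \<Longrightarrow> i \<le> n \<Longrightarrow> e i = e' i \<and> q i = q' i"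
  shows "jump_time \<pi> \<phi> \<kappa> x e q n = jump_time \<pi> \<phi> \<kappa> x e' q' n"
  unfolding jump_time_def holding_time_def
  using assms by (intro sum.cong refl) (auto intro!: arg_cong2[where f="\<tau>"] post_jump_state_cong)

lemma post_jump_state_in_space: "x \<in> space m \<Longrightarrow> post_jump_state \<pi> \<phi> \<kappa> x e q n \<in> space m"
  by (induction n) (auto simp: Let_def intro: \<kappa>_in_space flow_in_space)

text \<open>The noise is one vector, whose left summand carries the exponential and whose right summand
  the uniform variables; this matches the index set of the independence assumption.\<close>

definition chain :: "'a \<Rightarrow> (nat + nat \<Rightarrow> real) \<Rightarrow> nat \<Rightarrow> real \<times> 'a" where
  "chain x z n = (jump_time \<pi> \<phi> \<kappa> x (\<lambda>i. z (Inl i)) (\<lambda>i. z (Inr i)) n,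
     post_jump_state \<pi> \<phi> \<kappa> x (\<lambda>i. z (Inl i)) (\<lambda>i. z (Inr i)) n)"

lemma chain_0: "chain x z 0 = (0, x)"
  by (simp add: chain_def jump_time_def)

lemma chain_Suc:
  "chain x z (Suc n) = (case chain x z n of (s, y) \<Rightarrow>
    (s + \<tau> y (z (Inl (Suc n))), \<kappa> (z (Inr (Suc n))) (\<pi> (\<tau> y (z (Inl (Suc n)))) y)))"
  by (simp add: chain_def jump_time_Suc Let_def)

lemma chain_cong:
  assumes "\<And>i. i \<in> {1..n} <+> {1..n} \<Longrightarrow> z i = z' i"
  shows "chain x z n = chain x z' n"
proof -
  have "z (Inl i) = z' (Inl i) \<and> z (Inr i) = z' (Inr i)" if "1 \<le> i" "i \<le> n" for i
    using that by (intro conjI assms) auto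
  then show ?thesis
    unfolding chain_def by (intro arg_cong2[where f=Pair] jump_time_cong post_jump_state_cong) auto
qed

text \<open>The index set \<open>A\<close> is left open: finite sets are needed for the independence of a
  step from the past, and the full index set for random starting points.\<close>

lemma chain_measurable:
  assumes "{1..n} <+> {1..n} \<subseteq> A"
  shows "(\<lambda>p. chain (fst p) (snd p) n) \<in> m \<Otimes>\<^sub>M PiM A (\<lambda>_. borel) \<rightarrow>\<^sub>M borel \<Otimes>\<^sub>M m"
  using assms
proof (induction n)
  case 0
  show ?case by (simp add: chain_0)
next
  case (Suc n)
  have "{1..n} <+> {1..n} \<subseteq> A" using Suc.prems by (auto simp: Plus_def)
  note [measurable] = Suc.IH[OF this]
  have [measurable]: "(\<lambda>p. snd p (Inl (Suc n))) \<in> borel_measurable (m \<Otimes>\<^sub>M PiM A (\<lambda>_. borel))"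
    "(\<lambda>p. snd p (Inr (Suc n))) \<in> borel_measurable (m \<Otimes>\<^sub>M PiM A (\<lambda>_. borel))"
    using Suc.prems by (auto intro!: measurable_compose[OF measurable_snd] measurable_component_singleton)
  show ?case unfolding chain_Suc split_beta' by measurable
qed

definition noise_vector :: "'w \<Rightarrow> nat + nat \<Rightarrow> real" where
  "noise_vector \<omega> = (\<lambda>i\<in>{1..} <+> {1..}. case_sum \<epsilon> \<theta> i \<omega>)"

lemma chain_noise: "chain x (noise_vector \<omega>) n
  = (jump_time \<pi> \<phi> \<kappa> x (\<lambda>i. \<epsilon> i \<omega>) (\<lambda>i. \<theta> i \<omega>) n, post_jump_state \<pi> \<phi> \<kappa> x (\<lambda>i. \<epsilon> i \<omega>) (\<lambda>i. \<theta> i \<omega>) n)"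
  unfolding chain_def noise_vector_def
  by (intro arg_cong2[where f=Pair] jump_time_cong post_jump_state_cong) auto

lemma noise_vector_Suc:
  "noise_vector \<omega> (Inl (Suc n)) = \<epsilon> (Suc n) \<omega>" "noise_vector \<omega> (Inr (Suc n)) = \<theta> (Suc n) \<omega>"
  by (auto simp: noise_vector_def)

lemma noise_indep: "indep_vars (\<lambda>_. borel) (case_sum \<epsilon> \<theta>) ({1..} <+> {1..})"
  using noise by (simp add: driving_noise_def)

lemma noise_measurable: "i \<in> {1..} <+> {1..} \<Longrightarrow> random_variable borel (case_sum \<epsilon> \<theta> i)"
  using noise_indep by (auto simp: indep_vars_def)

lemma noise_vector_measurable [measurable]:
  "noise_vector \<in> M \<rightarrow>\<^sub>M PiM ({1..} <+> {1..}) (\<lambda>_. borel)"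
  unfolding noise_vector_def[abs_def] by (intro measurable_restrict noise_measurable)

lemma noise_pair_law:
  "distr M (borel \<Otimes>\<^sub>M borel) (\<lambda>\<omega>. (\<epsilon> (Suc n) \<omega>, \<theta> (Suc n) \<omega>)) = exp_law \<Otimes>\<^sub>M unif_law"
proof -
  have "indep_var (PiM {Inl (Suc n)} (\<lambda>_. borel)) (\<lambda>\<omega>. restrict (\<lambda>i. case_sum \<epsilon> \<theta> i \<omega>) {Inl (Suc n)})
      (PiM {Inr (Suc n)} (\<lambda>_. borel)) (\<lambda>\<omega>. restrict (\<lambda>i. case_sum \<epsilon> \<theta> i \<omega>) {Inr (Suc n)})"
    by (rule indep_var_restrict[OF noise_indep]) auto
  from indep_var_compose[OF this, of "\<lambda>z. z (Inl (Suc n))" borel "\<lambda>z. z (Inr (Suc n))" borel]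
  have "indep_var borel (\<epsilon> (Suc n)) borel (\<theta> (Suc n))"
    by (simp add: o_def measurable_component_singleton)
  then have "distr M (borel \<Otimes>\<^sub>M borel) (\<lambda>\<omega>. (\<epsilon> (Suc n) \<omega>, \<theta> (Suc n) \<omega>))
      = distr M borel (\<epsilon> (Suc n)) \<Otimes>\<^sub>M distr M borel (\<theta> (Suc n))"
    by (simp add: indep_var_distribution_eq)
  also have "distr M borel (\<epsilon> (Suc n)) = distr M lborel (\<epsilon> (Suc n))"
    by (rule distr_cong) auto
  also have "\<dots> = exp_law"
    using noise by (intro distributed_distr_eq_density) (auto simp: driving_noise_def)
  also have "distr M borel (\<theta> (Suc n)) = unif_law"
    using noise by (auto simp: driving_noise_def)
  finally show ?thesis .
qed

text \<open>The chain up to step \<open>n\<close> is a function of the noise with indices at most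
  \<open>n\<close>, which is independent of the noise with index \<open>n + 1\<close>.
  Independence is used for the two subfamilies as vectors of reals; the chain and the pair are
  substituted afterwards.\<close>

lemma chain_step_independent:
  assumes x: "x \<in> space m"
    and H [measurable]: "H \<in> borel_measurable ((borel \<Otimes>\<^sub>M m) \<Otimes>\<^sub>M (borel \<Otimes>\<^sub>M borel))"
  shows "(\<integral>\<^sup>+\<omega>. H (chain x (noise_vector \<omega>) n, (\<epsilon> (Suc n) \<omega>, \<theta> (Suc n) \<omega>)) \<partial>M)
    = (\<integral>\<^sup>+\<omega>. (\<integral>\<^sup>+e. (\<integral>\<^sup>+q. H (chain x (noise_vector \<omega>) n, (e, q)) \<partial>unif_law) \<partial>exp_law) \<partial>M)"
proof -
  let ?A = "{1..n} <+> {1..n}" and ?B = "{Inl (Suc n), Inr (Suc n)} :: (nat + nat) set"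
  let ?X = "\<lambda>\<omega>. chain x (noise_vector \<omega>) n" and ?W = "\<lambda>\<omega>. (\<epsilon> (Suc n) \<omega>, \<theta> (Suc n) \<omega>)"
  interpret E: prob_space exp_law by (rule prob_space_exp_law)
  interpret U: prob_space unif_law by (rule prob_space_unif_law)
  interpret EU: pair_prob_space exp_law unif_law ..
  let ?PA = "PiM ?A (\<lambda>_. borel) :: (nat + nat \<Rightarrow> real) measure" and ?PB = "PiM ?B (\<lambda>_. borel) :: (nat + nat \<Rightarrow> real) measure"
  let ?RA = "\<lambda>\<omega>. restrict (\<lambda>i. case_sum \<epsilon> \<theta> i \<omega>) ?A" and ?RB = "\<lambda>\<omega>. restrict (\<lambda>i. case_sum \<epsilon> \<theta> i \<omega>) ?B"
  let ?Y = "\<lambda>z. (z (Inl (Suc n)), z (Inr (Suc n))) :: real \<times> real"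
  have "indep_var ?PA ?RA ?PB ?RB"
    by (rule indep_var_restrict[OF noise_indep]) auto
  then have [measurable]: "random_variable ?PA ?RA" "random_variable ?PB ?RB"
    and law: "distr M (?PA \<Otimes>\<^sub>M ?PB) (\<lambda>\<omega>. (?RA \<omega>, ?RB \<omega>)) = distr M ?PA ?RA \<Otimes>\<^sub>M distr M ?PB ?RB"
    by (simp_all add: indep_var_distribution_eq)
  interpret RB: prob_space "distr M ?PB ?RB" by (rule prob_space_distr) measurable
  have chain_PA [measurable]: "(\<lambda>z. chain x z n) \<in> ?PA \<rightarrow>\<^sub>M borel \<Otimes>\<^sub>M m"
    using measurable_Pair2[OF chain_measurable[of n ?A] x] by simp
  have [measurable]: "?Y \<in> ?PB \<rightarrow>\<^sub>M borel \<Otimes>\<^sub>M borel"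
    by (intro measurable_Pair measurable_component_singleton) auto
  have chain_A: "chain x (?RA \<omega>) n = ?X \<omega>" for \<omega>
    unfolding noise_vector_def by (intro chain_cong) auto
  have law_B: "distr (distr M ?PB ?RB) (borel \<Otimes>\<^sub>M borel) ?Y = exp_law \<Otimes>\<^sub>M unif_law"
    unfolding noise_pair_law[of n, symmetric] by (subst distr_distr) (auto simp: o_def)
  have s: "sets (exp_law \<Otimes>\<^sub>M unif_law) = sets (borel \<Otimes>\<^sub>M borel)"
    by (intro sets_pair_measure_cong) auto
  let ?G = "\<lambda>v. \<integral>\<^sup>+e. (\<integral>\<^sup>+q. H (v, (e, q)) \<partial>unif_law) \<partial>exp_law"
  have G [measurable]: "?G \<in> borel_measurable (borel \<Otimes>\<^sub>M m)"
  proof (intro E.borel_measurable_nn_integral)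
    have 1: "(\<lambda>w. H (fst (fst w), (snd (fst w), snd w))) \<in> borel_measurable (((borel \<Otimes>\<^sub>M m) \<Otimes>\<^sub>M exp_law) \<Otimes>\<^sub>M unif_law)"
      by (rule measurable_compose[OF _ H]) measurable
    show "(\<lambda>(v, e). \<integral>\<^sup>+q. H (v, (e, q)) \<partial>unif_law) \<in> borel_measurable ((borel \<Otimes>\<^sub>M m) \<Otimes>\<^sub>M exp_law)"
      unfolding split_beta' by (intro U.borel_measurable_nn_integral) (use 1 in \<open>simp add: split_beta'\<close>)
  qed
  have "(\<integral>\<^sup>+\<omega>. H (?X \<omega>, ?W \<omega>) \<partial>M) = (\<integral>\<^sup>+\<omega>. H (chain x (?RA \<omega>) n, ?Y (?RB \<omega>)) \<partial>M)"
    unfolding chain_A by simp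
  also have "\<dots> = (\<integral>\<^sup>+p. H (chain x (fst p) n, ?Y (snd p)) \<partial>(distr M ?PA ?RA \<Otimes>\<^sub>M distr M ?PB ?RB))"
  proof -
    have "(\<integral>\<^sup>+p. H (chain x (fst p) n, ?Y (snd p)) \<partial>distr M (?PA \<Otimes>\<^sub>M ?PB) (\<lambda>\<omega>. (?RA \<omega>, ?RB \<omega>)))
        = (\<integral>\<^sup>+\<omega>. H (chain x (fst (?RA \<omega>, ?RB \<omega>)) n, ?Y (snd (?RA \<omega>, ?RB \<omega>))) \<partial>M)"
      by (rule nn_integral_distr) measurable
    then show ?thesis unfolding law by (simp only: fst_conv snd_conv)
  qed
  also have "\<dots> = (\<integral>\<^sup>+v. (\<integral>\<^sup>+w. H (chain x v n, ?Y w) \<partial>distr M ?PB ?RB) \<partial>distr M ?PA ?RA)"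
  proof -
    have "(\<lambda>p. H (chain x (fst p) n, ?Y (snd p))) \<in> borel_measurable (?PA \<Otimes>\<^sub>M ?PB)" by measurable
    then have "(\<lambda>p. H (chain x (fst p) n, ?Y (snd p))) \<in> borel_measurable (distr M ?PA ?RA \<Otimes>\<^sub>M distr M ?PB ?RB)"
      using measurable_cong_sets[OF sets_pair_measure_cong[OF sets_distr sets_distr] refl] by blast
    from RB.nn_integral_fst[OF this] show ?thesis by (simp only: fst_conv snd_conv)
  qed
  also have "\<dots> = (\<integral>\<^sup>+v. ?G (chain x v n) \<partial>distr M ?PA ?RA)"
  proof (intro nn_integral_cong)
    fix v assume "v \<in> space (distr M ?PA ?RA)"
    then have "chain x v n \<in> space (borel \<Otimes>\<^sub>M m)"
      unfolding space_distr by (rule measurable_space[OF chain_PA])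
    from measurable_Pair2[OF H this]
    have Hv [measurable]: "(\<lambda>p. H (chain x v n, p)) \<in> borel_measurable (borel \<Otimes>\<^sub>M borel)" .
    have "(\<integral>\<^sup>+w. H (chain x v n, ?Y w) \<partial>distr M ?PB ?RB) = (\<integral>\<^sup>+p. H (chain x v n, p) \<partial>(exp_law \<Otimes>\<^sub>M unif_law))"
      unfolding law_B[symmetric] by (subst nn_integral_distr) auto
    also have "\<dots> = ?G (chain x v n)"
    proof (rule U.nn_integral_fst[symmetric])
      show "(\<lambda>p. H (chain x v n, p)) \<in> borel_measurable (exp_law \<Otimes>\<^sub>M unif_law)"
        using Hv measurable_cong_sets[OF s refl] by blast
    qed
    finally show "(\<integral>\<^sup>+w. H (chain x v n, ?Y w) \<partial>distr M ?PB ?RB) = ?G (chain x v n)" .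
  qed
  also have "\<dots> = (\<integral>\<^sup>+\<omega>. ?G (?X \<omega>) \<partial>M)"
    unfolding chain_A[symmetric]
  proof (rule nn_integral_distr)
    show "random_variable ?PA ?RA" by measurable
    show "(\<lambda>v. ?G (chain x v n)) \<in> borel_measurable (distr M ?PA ?RA)"
      unfolding measurable_distr_eq1 by (rule measurable_compose[OF chain_PA G])
  qed
  finally show ?thesis .
qed

lemma chain_in_space: "x \<in> space m \<Longrightarrow> snd (chain x z n) \<in> space m"
  by (simp add: chain_def post_jump_state_in_space)

text \<open>The Markov property of the chain: the last step is integrated out first, which replaces
  \<open>F\<close> by \<open>step F\<close>.\<close>

theorem chain_law:
  assumes x: "x \<in> space m" and F: "F \<in> borel_measurable (borel \<Otimes>\<^sub>M m)"
  shows "(\<integral>\<^sup>+\<omega>. F (chain x (noise_vector \<omega>) n) \<partial>M) = (step ^^ n) F (0, x)"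
  using F
proof (induction n arbitrary: F)
  case 0
  show ?case by (simp add: chain_0 emeasure_space_1)
next
  case (Suc n)
  note [measurable] = Suc.prems
  let ?H = "\<lambda>w. F (fst (fst w) + \<tau> (snd (fst w)) (fst (snd w)),
    \<kappa> (snd (snd w)) (\<pi> (\<tau> (snd (fst w)) (fst (snd w))) (snd (fst w))))"
  have H: "?H \<in> borel_measurable ((borel \<Otimes>\<^sub>M m) \<Otimes>\<^sub>M (borel \<Otimes>\<^sub>M borel))" by measurable
  have "(\<integral>\<^sup>+\<omega>. F (chain x (noise_vector \<omega>) (Suc n)) \<partial>M)
      = (\<integral>\<^sup>+\<omega>. ?H (chain x (noise_vector \<omega>) n, (\<epsilon> (Suc n) \<omega>, \<theta> (Suc n) \<omega>)) \<partial>M)"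
    by (intro nn_integral_cong) (simp add: chain_Suc split_beta' noise_vector_Suc)
  also have "\<dots> = (\<integral>\<^sup>+\<omega>. step F (chain x (noise_vector \<omega>) n) \<partial>M)"
    unfolding chain_step_independent[OF x H]
  proof (intro nn_integral_cong)
    fix \<omega>
    obtain s y where sy: "chain x (noise_vector \<omega>) n = (s, y)" by force
    have "y \<in> space m" using chain_in_space[OF x, of "noise_vector \<omega>" n] sy by simp
    from step_law[OF Suc.prems this, of s]
    show "(\<integral>\<^sup>+e. (\<integral>\<^sup>+q. ?H (chain x (noise_vector \<omega>) n, (e, q)) \<partial>unif_law) \<partial>exp_law)
        = step F (chain x (noise_vector \<omega>) n)" by (simp add: sy)
  qed
  also have "\<dots> = (step ^^ Suc n) F (0, x)"
    by (subst Suc.IH) (simp_all add: funpow_swap1)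
  finally show ?case .
qed

text \<open>Given \<open>(t\<^sub>n, \<xi>\<^sub>n) = (s, y)\<close> with \<open>s \<le> t\<close>,
  the next jump comes after \<open>t\<close> with probability
  \<open>exp (- \<Phi> y (t - s))\<close>; so the conditional expectation is the killed flow
  at \<open>(t - s, y)\<close>, and the law of the chain does the rest.\<close>

lemma after_jumps_law:
  assumes x: "x \<in> space m" and f [measurable]: "f \<in> borel_measurable m"
  shows "(\<integral>\<^sup>+\<omega>. (if fst (chain x (noise_vector \<omega>) n) \<le> t \<and> t < fst (chain x (noise_vector \<omega>) (Suc n))
      then f (\<pi> (t - fst (chain x (noise_vector \<omega>) n)) (snd (chain x (noise_vector \<omega>) n))) else 0) \<partial>M)
    = after_jumps n t f x"
proof -
  let ?H = "\<lambda>w. if fst (fst w) \<le> t \<and> t < fst (fst w) + \<tau> (snd (fst w)) (fst (snd w))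
    then f (\<pi> (t - fst (fst w)) (snd (fst w))) else 0"
  have H: "?H \<in> borel_measurable ((borel \<Otimes>\<^sub>M m) \<Otimes>\<^sub>M (borel \<Otimes>\<^sub>M borel))" by measurable
  let ?F = "\<lambda>(s, y). killed (t - s) f y"
  have F: "?F \<in> borel_measurable (borel \<Otimes>\<^sub>M m)" unfolding split_beta' by measurable
  have "(\<integral>\<^sup>+\<omega>. (if fst (chain x (noise_vector \<omega>) n) \<le> t \<and> t < fst (chain x (noise_vector \<omega>) (Suc n))
      then f (\<pi> (t - fst (chain x (noise_vector \<omega>) n)) (snd (chain x (noise_vector \<omega>) n))) else 0) \<partial>M)
    = (\<integral>\<^sup>+\<omega>. ?H (chain x (noise_vector \<omega>) n, (\<epsilon> (Suc n) \<omega>, \<theta> (Suc n) \<omega>)) \<partial>M)"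
    by (intro nn_integral_cong) (simp add: chain_Suc split_beta' noise_vector_Suc)
  also have "\<dots> = (\<integral>\<^sup>+\<omega>. ?F (chain x (noise_vector \<omega>) n) \<partial>M)"
    unfolding chain_step_independent[OF x H]
  proof (intro nn_integral_cong)
    fix \<omega>
    obtain s y where sy: "chain x (noise_vector \<omega>) n = (s, y)" by force
    have y: "y \<in> space m" using chain_in_space[OF x, of "noise_vector \<omega>" n] sy by simp
    have "(\<integral>\<^sup>+e. (\<integral>\<^sup>+q. ?H ((s, y), (e, q)) \<partial>unif_law) \<partial>exp_law) = killed (t - s) f y"
    proof (cases "s \<le> t")
      case True
      have "(\<integral>\<^sup>+e. (\<integral>\<^sup>+q. ?H ((s, y), (e, q)) \<partial>unif_law) \<partial>exp_law)
          = (\<integral>\<^sup>+e. indicator {\<Phi> y (t - s)<..} e * f (\<pi> (t - s) y) \<partial>exp_law)"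
        using True less_inverse_iff[OF y, of "t - s"] prob_space.emeasure_space_1[OF prob_space_unif_law]
        by (intro nn_integral_cong) (auto simp: indicator_def less_diff_eq algebra_simps)
      also have "\<dots> = ennreal (exp (- \<Phi> y (t - s))) * f (\<pi> (t - s) y)"
      proof -
        have "(\<integral>\<^sup>+e. indicator {\<Phi> y (t - s)<..} e * f (\<pi> (t - s) y) \<partial>exp_law)
            = (\<integral>\<^sup>+e. indicator {\<Phi> y (t - s)<..} e \<partial>exp_law) * f (\<pi> (t - s) y)"
          by (rule nn_integral_multc) simp
        then show ?thesis by (simp only: exp_law_tail[OF cumulative_rate_nonneg[OF y]])
      qed
      finally show ?thesis using True by (simp add: killed_def)
    qed (simp add: killed_def)
    then show "(\<integral>\<^sup>+e. (\<integral>\<^sup>+q. ?H (chain x (noise_vector \<omega>) n, (e, q)) \<partial>unif_law) \<partial>exp_law)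
        = ?F (chain x (noise_vector \<omega>) n)" by (simp only: sy prod.case)
  qed
  also have "\<dots> = after_jumps n t f x"
    unfolding chain_law[OF x F] using step_power_after_jumps[OF f x, where s=0] by simp
  finally show ?thesis .
qed

end

section \<open>Paths of the minimal process\<close>

lemma less_explosion_time_iff:
  assumes inc: "incseq (jump_time \<pi> \<phi> \<kappa> x e q)"
  shows "ereal t < explosion_time \<pi> \<phi> \<kappa> x e q \<longleftrightarrow> (\<exists>n. t < jump_time \<pi> \<phi> \<kappa> x e q n)"
proof -
  have "incseq (\<lambda>n. ereal (jump_time \<pi> \<phi> \<kappa> x e q n))"
    using inc by (auto simp: incseq_def)
  from limI[OF LIMSEQ_SUP[OF this]] show ?thesis
    by (simp add: explosion_time_def less_SUP_iff)
qed

lemma jump_interval_exists: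
  fixes T :: "nat \<Rightarrow> real"
  assumes T0: "T 0 \<le> t" and n: "t < T n"
  shows "\<exists>k. T k \<le> t \<and> t < T (Suc k)"
proof -
  define k where "k = (LEAST n. t < T n)"
  have k: "t < T k" unfolding k_def using n by (rule LeastI)
  then have "k \<noteq> 0" using T0 by (metis not_less)
  then obtain j where j: "k = Suc j" by (cases k) auto
  have "\<not> t < T j" using not_less_Least[of j "\<lambda>n. t < T n"] j by (simp add: k_def)
  then show ?thesis using k j by (intro exI[of _ j]) (simp add: not_less)
qed

lemma jump_interval_unique:
  fixes T :: "nat \<Rightarrow> real"
  assumes inc: "incseq T" and "T n \<le> t" "t < T (Suc n)" "T k \<le> t" "t < T (Suc k)"
  shows "n = k"
proof (rule ccontr)
  assume "n \<noteq> k"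
  then consider "Suc n \<le> k" | "Suc k \<le> n" by linarith
  then show False
    by cases (use assms incseqD[OF inc, of "Suc n" k] incseqD[OF inc, of "Suc k" n] in auto)
qed

lemma minimal_pdmp_in_iff:
  assumes inc: "incseq (jump_time \<pi> \<phi> \<kappa> x e q)" and t: "0 \<le> t"
  shows "minimal_pdmp \<pi> \<phi> \<kappa> x e q t \<in> Some ` B \<longleftrightarrow>
    (\<exists>n. jump_time \<pi> \<phi> \<kappa> x e q n \<le> t \<and> t < jump_time \<pi> \<phi> \<kappa> x e q (Suc n) \<and>
       \<pi> (t - jump_time \<pi> \<phi> \<kappa> x e q n) (post_jump_state \<pi> \<phi> \<kappa> x e q n) \<in> B)"
    (is "_ \<longleftrightarrow> (\<exists>n. ?T n \<le> t \<and> t < ?T (Suc n) \<and> ?X n \<in> B)")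
proof (cases "ereal t < explosion_time \<pi> \<phi> \<kappa> x e q")
  case True
  have "?T 0 \<le> t" using t by (simp add: jump_time_def)
  with True obtain k where k: "?T k \<le> t" "t < ?T (Suc k)"
    using less_explosion_time_iff[OF inc] jump_interval_exists[of ?T t] by auto
  have uniq: "n = k" if "?T n \<le> t" "t < ?T (Suc n)" for n
    by (rule jump_interval_unique[OF inc that k])
  have "(THE n. ?T n \<le> t \<and> t < ?T (Suc n)) = k"
    using k uniq by (intro the_equality conjI) blast+
  then have "minimal_pdmp \<pi> \<phi> \<kappa> x e q t = Some (?X k)"
    using True by (simp add: minimal_pdmp_def)
  moreover have "(\<exists>n. ?T n \<le> t \<and> t < ?T (Suc n) \<and> ?X n \<in> B) \<longleftrightarrow> ?X k \<in> B"
    using k uniq by blast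
  ultimately show ?thesis by (simp add: inj_image_mem_iff)
next
  case False
  then show ?thesis
    using less_explosion_time_iff[OF inc] by (auto simp: minimal_pdmp_def)
qed

context pdmp_process
begin

lemma jump_time_incseq: "x \<in> space m \<Longrightarrow> incseq (jump_time \<pi> \<phi> \<kappa> x e q)"
  by (intro incseq_SucI) (simp add: jump_time_Suc inverse_nonneg post_jump_state_in_space)

text \<open>The event that the process started at \<open>x\<close> is in \<open>B\<close> at time
  \<open>t\<close>, as a condition on the noise vector; see \<open>visits_iff_minimal_pdmp\<close>.\<close>

definition visits :: "real \<Rightarrow> 'a set \<Rightarrow> 'a \<Rightarrow> (nat + nat \<Rightarrow> real) \<Rightarrow> bool" where
  "visits t B x z \<longleftrightarrow> (\<exists>n. fst (chain x z n) \<le> t \<and> t < fst (chain x z (Suc n)) \<and>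
     \<pi> (t - fst (chain x z n)) (snd (chain x z n)) \<in> B)"

abbreviation "noise_space \<equiv> PiM ({1..} <+> {1..}) (\<lambda>_. borel) :: (nat + nat \<Rightarrow> real) measure"

lemma visits_measurable:
  assumes [measurable]: "B \<in> sets m"
  shows "Measurable.pred (m \<Otimes>\<^sub>M noise_space) (\<lambda>p. visits t B (fst p) (snd p))"
proof -
  have [measurable]: "(\<lambda>p. chain (fst p) (snd p) n) \<in> m \<Otimes>\<^sub>M noise_space \<rightarrow>\<^sub>M borel \<Otimes>\<^sub>M m" for n
    by (rule chain_measurable) auto
  show ?thesis unfolding visits_def by measurable
qed

lemma visits_measurable':
  assumes B: "B \<in> sets m" and \<xi>: "\<xi> \<in> M \<rightarrow>\<^sub>M m"
  shows "Measurable.pred M (\<lambda>\<omega>. visits t B (\<xi> \<omega>) (noise_vector \<omega>))"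
  using measurable_compose[OF measurable_Pair[OF \<xi> noise_vector_measurable] visits_measurable[OF B]]
  by simp

text \<open>The intervals between successive jump times are disjoint, so the probability is a sum over the
  number of jumps.\<close>

lemma visits_prob:
  assumes x: "x \<in> space m" and B [measurable]: "B \<in> sets m"
  shows "(\<integral>\<^sup>+\<omega>. indicator {\<omega>. visits t B x (noise_vector \<omega>)} \<omega> \<partial>M) = transition t (indicator B) x"
proof -
  let ?c = "\<lambda>\<omega> n. chain x (noise_vector \<omega>) n"
  let ?g = "\<lambda>n \<omega>. (if fst (?c \<omega> n) \<le> t \<and> t < fst (?c \<omega> (Suc n))
      then indicator B (\<pi> (t - fst (?c \<omega> n)) (snd (?c \<omega> n))) else 0) :: ennreal"
  have [measurable]: "(\<lambda>\<omega>. ?c \<omega> n) \<in> M \<rightarrow>\<^sub>M borel \<Otimes>\<^sub>M m" for n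
  proof -
    have "(\<lambda>p. chain (fst p) (snd p) n) \<in> m \<Otimes>\<^sub>M noise_space \<rightarrow>\<^sub>M borel \<Otimes>\<^sub>M m"
      by (rule chain_measurable) auto
    from measurable_compose[OF measurable_Pair[OF measurable_const[OF x] noise_vector_measurable] this]
    show ?thesis by simp
  qed
  have "(\<integral>\<^sup>+\<omega>. indicator {\<omega>. visits t B x (noise_vector \<omega>)} \<omega> \<partial>M) = (\<integral>\<^sup>+\<omega>. (\<Sum>n. ?g n \<omega>) \<partial>M)"
  proof (intro nn_integral_cong)
    fix \<omega>
    have inc: "incseq (\<lambda>n. fst (?c \<omega> n))"
      using jump_time_incseq[OF x] by (simp add: chain_def)
    show "indicator {\<omega>. visits t B x (noise_vector \<omega>)} \<omega> = (\<Sum>n. ?g n \<omega>)"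
    proof (cases "\<exists>k. fst (?c \<omega> k) \<le> t \<and> t < fst (?c \<omega> (Suc k))")
      case True
      then obtain k where k: "fst (?c \<omega> k) \<le> t" "t < fst (?c \<omega> (Suc k))" by auto
      have uniq: "n = k" if "fst (?c \<omega> n) \<le> t" "t < fst (?c \<omega> (Suc n))" for n
        by (rule jump_interval_unique[OF inc that k])
      have "(\<Sum>n. ?g n \<omega>) = (\<Sum>n\<in>{k}. ?g n \<omega>)"
      proof (intro suminf_finite)
        fix n assume "n \<notin> {k}"
        then have "\<not> (fst (?c \<omega> n) \<le> t \<and> t < fst (?c \<omega> (Suc n)))" using uniq by blast
        then show "?g n \<omega> = 0" by (rule if_not_P)
      qed simp
      moreover have "visits t B x (noise_vector \<omega>) \<longleftrightarrow> \<pi> (t - fst (?c \<omega> k)) (snd (?c \<omega> k)) \<in> B"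
        unfolding visits_def using k uniq by blast
      ultimately show ?thesis using k by (simp add: indicator_def)
    next
      case False
      then have "\<not> visits t B x (noise_vector \<omega>)" by (auto simp: visits_def)
      moreover have "?g n \<omega> = 0" for n using False by auto
      ultimately show ?thesis by simp
    qed
  qed
  also have "\<dots> = (\<Sum>n. \<integral>\<^sup>+\<omega>. ?g n \<omega> \<partial>M)"
    by (intro nn_integral_suminf) measurable
  also have "\<dots> = transition t (indicator B) x"
    unfolding transition_def by (intro suminf_cong after_jumps_law[OF x]) simp
  finally show ?thesis .
qed

text \<open>Independence makes the joint law of starting point and noise a product; integrate out the
  noise first.\<close>

lemma visits_prob_random_start:
  assumes \<xi> [measurable]: "\<xi> \<in> M \<rightarrow>\<^sub>M m" and ind: "independent_of_noise M m \<xi> \<epsilon> \<theta>" and B: "B \<in> sets m"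
  shows "emeasure M {\<omega>\<in>space M. visits t B (\<xi> \<omega>) (noise_vector \<omega>)}
    = (\<integral>\<^sup>+x. transition t (indicator B) x \<partial>distr M m \<xi>)"
proof -
  interpret X: prob_space "distr M m \<xi>" by (rule prob_space_distr) measurable
  interpret N: prob_space "distr M noise_space noise_vector" by (rule prob_space_distr) measurable
  have law: "distr M m \<xi> \<Otimes>\<^sub>M distr M noise_space noise_vector
      = distr M (m \<Otimes>\<^sub>M noise_space) (\<lambda>\<omega>. (\<xi> \<omega>, noise_vector \<omega>))"
  proof (rule pair_measure_eqI[OF X.sigma_finite_measure_axioms N.sigma_finite_measure_axioms])
    fix A C assume "A \<in> sets (distr M m \<xi>)" "C \<in> sets (distr M noise_space noise_vector)"
    then have A [measurable]: "A \<in> sets m" and C [measurable]: "C \<in> sets noise_space" by auto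
    have "\<xi> -` A \<inter> space M \<in> sets (vimage_algebra (space M) \<xi> m)"
      "noise_vector -` C \<inter> space M \<in> sets (vimage_algebra (space M) noise_vector noise_space)"
      using A C by (auto intro: in_vimage_algebra)
    then have *: "prob ((\<xi> -` A \<inter> space M) \<inter> (noise_vector -` C \<inter> space M))
        = prob (\<xi> -` A \<inter> space M) * prob (noise_vector -` C \<inter> space M)"
      using ind unfolding independent_of_noise_def noise_vector_def[abs_def] by (intro indep_setD)
    have **: "(\<lambda>\<omega>. (\<xi> \<omega>, noise_vector \<omega>)) -` (A \<times> C) \<inter> space M
        = (\<xi> -` A \<inter> space M) \<inter> (noise_vector -` C \<inter> space M)" by auto
    show "emeasure (distr M m \<xi>) A * emeasure (distr M noise_space noise_vector) C
        = emeasure (distr M (m \<Otimes>\<^sub>M noise_space) (\<lambda>\<omega>. (\<xi> \<omega>, noise_vector \<omega>))) (A \<times> C)"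
    proof -
      have "emeasure (distr M m \<xi>) A = emeasure M (\<xi> -` A \<inter> space M)"
        by (rule emeasure_distr[OF \<xi> A])
      moreover have "emeasure (distr M noise_space noise_vector) C = emeasure M (noise_vector -` C \<inter> space M)"
        by (rule emeasure_distr[OF noise_vector_measurable C])
      moreover have "emeasure (distr M (m \<Otimes>\<^sub>M noise_space) (\<lambda>\<omega>. (\<xi> \<omega>, noise_vector \<omega>))) (A \<times> C)
          = emeasure M ((\<lambda>\<omega>. (\<xi> \<omega>, noise_vector \<omega>)) -` (A \<times> C) \<inter> space M)"
        by (rule emeasure_distr[OF measurable_Pair[OF \<xi> noise_vector_measurable] pair_measureI[OF A C]])
      ultimately show ?thesis
        using * unfolding ** by (simp only: emeasure_eq_measure ennreal_mult measure_nonneg)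
    qed
  qed (auto intro!: sets_pair_measure_cong)
  let ?v = "\<lambda>p. indicator {p. visits t B (fst p) (snd p)} p :: ennreal"
  have v: "?v \<in> borel_measurable (m \<Otimes>\<^sub>M noise_space)"
    using visits_measurable[OF B, of t] by (simp add: indicator_def)
  have s: "sets (distr M m \<xi> \<Otimes>\<^sub>M distr M noise_space noise_vector) = sets (m \<Otimes>\<^sub>M noise_space)"
    by (intro sets_pair_measure_cong) auto
  have "emeasure M {\<omega>\<in>space M. visits t B (\<xi> \<omega>) (noise_vector \<omega>)}
      = (\<integral>\<^sup>+\<omega>. indicator {\<omega>\<in>space M. visits t B (\<xi> \<omega>) (noise_vector \<omega>)} \<omega> \<partial>M)"
    using visits_measurable'[OF B \<xi>, of t] by simp
  also have "\<dots> = (\<integral>\<^sup>+\<omega>. ?v (\<xi> \<omega>, noise_vector \<omega>) \<partial>M)"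
    by (intro nn_integral_cong) (auto simp: indicator_def)
  also have "\<dots> = (\<integral>\<^sup>+p. ?v p \<partial>(distr M m \<xi> \<Otimes>\<^sub>M distr M noise_space noise_vector))"
    unfolding law     by (rule nn_integral_distr[symmetric, OF measurable_Pair[OF \<xi> noise_vector_measurable]])
      (unfold measurable_distr_eq1, rule v)
  also have "\<dots> = (\<integral>\<^sup>+x. (\<integral>\<^sup>+z. ?v (x, z) \<partial>distr M noise_space noise_vector) \<partial>distr M m \<xi>)"
    by (rule N.nn_integral_fst[symmetric]) (use v measurable_cong_sets[OF s refl] in blast)
  also have "\<dots> = (\<integral>\<^sup>+x. transition t (indicator B) x \<partial>distr M m \<xi>)"
  proof (intro nn_integral_cong)
    fix x assume "x \<in> space (distr M m \<xi>)"
    then have x: "x \<in> space m" by simp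
    have "(\<integral>\<^sup>+z. ?v (x, z) \<partial>distr M noise_space noise_vector) = (\<integral>\<^sup>+\<omega>. ?v (x, noise_vector \<omega>) \<partial>M)"
      by (rule nn_integral_distr[OF noise_vector_measurable])
        (unfold measurable_distr_eq1, rule measurable_Pair2[OF v x])
    also have "\<dots> = (\<integral>\<^sup>+\<omega>. indicator {\<omega>. visits t B x (noise_vector \<omega>)} \<omega> \<partial>M)"
      by (intro nn_integral_cong) (simp add: indicator_def)
    also have "\<dots> = transition t (indicator B) x" by (rule visits_prob[OF x B])
    finally show "(\<integral>\<^sup>+z. ?v (x, z) \<partial>distr M noise_space noise_vector) = transition t (indicator B) x" .
  qed
  finally show ?thesis .
qed

lemma visits_iff_minimal_pdmp:
  assumes x: "x \<in> space m" and t: "0 \<le> t"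
  shows "visits t B x (noise_vector \<omega>) \<longleftrightarrow>
    minimal_pdmp \<pi> \<phi> \<kappa> x (\<lambda>n. \<epsilon> n \<omega>) (\<lambda>n. \<theta> n \<omega>) t \<in> Some ` B"
  unfolding minimal_pdmp_in_iff[OF jump_time_incseq[OF x] t] visits_def chain_noise by simp

text \<open>The event of explosion is the increasing union over \<open>k\<close> of the events of
  explosion up to time \<open>k\<close>, whose probabilities are \<open>1 - V(k) 1(x)\<close>.\<close>

lemma explosion_prob_pos_iff:
  assumes x: "x \<in> space m"
  shows "0 < measure M {\<omega>\<in>space M. explosion_time \<pi> \<phi> \<kappa> x (\<lambda>n. \<epsilon> n \<omega>) (\<lambda>n. \<theta> n \<omega>) < \<infinity>}
    \<longleftrightarrow> (\<exists>k::nat. transition (real k) (\<lambda>_. 1) x \<noteq> 1)"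
proof -
  let ?ex = "\<lambda>\<omega>. explosion_time \<pi> \<phi> \<kappa> x (\<lambda>n. \<epsilon> n \<omega>) (\<lambda>n. \<theta> n \<omega>)"
  let ?A = "\<lambda>k::nat. {\<omega>\<in>space M. visits (real k) (space m) x (noise_vector \<omega>)}"
  let ?D = "\<lambda>k::nat. space M - ?A k"
  have alive: "visits t (space m) x (noise_vector \<omega>) \<longleftrightarrow> ereal t < ?ex \<omega>" if t: "0 \<le> t" for t \<omega>
  proof -
    let ?T = "jump_time \<pi> \<phi> \<kappa> x (\<lambda>n. \<epsilon> n \<omega>) (\<lambda>n. \<theta> n \<omega>)"
    have "visits t (space m) x (noise_vector \<omega>) \<longleftrightarrow> (\<exists>n. ?T n \<le> t \<and> t < ?T (Suc n))"
      by (simp add: visits_def chain_noise flow_in_space post_jump_state_in_space x)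
    also have "\<dots> \<longleftrightarrow> (\<exists>n. t < ?T n)"
    proof -
      have "?T 0 \<le> t" using t by (simp add: jump_time_def)
      then show ?thesis using jump_interval_exists[of ?T t] by blast
    qed
    also have "\<dots> \<longleftrightarrow> ereal t < ?ex \<omega>"
      by (rule less_explosion_time_iff[OF jump_time_incseq[OF x], symmetric])
    finally show ?thesis .
  qed
  have A [measurable]: "?A k \<in> events" for k
    using visits_measurable'[OF sets.top measurable_const[OF x], of "real k"] by simp
  have D: "emeasure M (?D k) = 0 \<longleftrightarrow> transition (real k) (\<lambda>_. 1) x = 1" for k
  proof -
    have "emeasure M (?A k) = (\<integral>\<^sup>+\<omega>. indicator (?A k) \<omega> \<partial>M)"
      by (rule nn_integral_indicator[OF A, symmetric])
    also have "\<dots> = (\<integral>\<^sup>+\<omega>. indicator {\<omega>. visits (real k) (space m) x (noise_vector \<omega>)} \<omega> \<partial>M)"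
      by (intro nn_integral_cong) (auto simp: indicator_def)
    also have "\<dots> = transition (real k) (indicator (space m)) x"
      by (rule visits_prob[OF x sets.top])
    also have "\<dots> = transition (real k) (\<lambda>_. 1) x"
      by (intro kernel_operator_cong[OF kernel_operator_transition _ x]) simp
    finally have "emeasure M (?A k) = transition (real k) (\<lambda>_. 1) x" .
    moreover have "emeasure M (?D k) = 0 \<longleftrightarrow> emeasure M (?A k) = 1"
      using prob_compl[OF A[of k]] by (simp add: emeasure_eq_measure)
    ultimately show ?thesis by simp
  qed
  have eq: "{\<omega>\<in>space M. ?ex \<omega> < \<infinity>} = (\<Union>k. ?D k)"
  proof (intro set_eqI iffI)
    fix \<omega> assume w: "\<omega> \<in> {\<omega>\<in>space M. ?ex \<omega> < \<infinity>}"
    then obtain r where r: "?ex \<omega> \<le> ereal r" by (cases "?ex \<omega>") auto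
    obtain k where "r \<le> real k" using real_arch_simple by blast
    then have "?ex \<omega> \<le> ereal (real k)" using r order_trans by fastforce
    then have "\<not> visits (real k) (space m) x (noise_vector \<omega>)" using alive[of "real k" \<omega>] by simp
    then show "\<omega> \<in> (\<Union>k. ?D k)" using w by auto
  next
    fix \<omega> assume "\<omega> \<in> (\<Union>k. ?D k)"
    then obtain k where k: "\<omega> \<in> space M" "\<not> visits (real k) (space m) x (noise_vector \<omega>)" by auto
    then have "?ex \<omega> \<le> ereal (real k)" using alive[of "real k" \<omega>] by simp
    then show "\<omega> \<in> {\<omega>\<in>space M. ?ex \<omega> < \<infinity>}" using k(1) by (auto intro: le_less_trans)
  qed
  have "0 < measure M (\<Union>k. ?D k) \<longleftrightarrow> emeasure M (\<Union>k. ?D k) \<noteq> 0"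
    by (simp add: emeasure_eq_measure less_le measure_nonneg)
  also have "emeasure M (\<Union>k. ?D k) \<noteq> 0 \<longleftrightarrow> (\<exists>k. emeasure M (?D k) \<noteq> 0)"
  proof -
    have "emeasure M (\<Union>k. ?D k) = 0 \<longleftrightarrow> (\<forall>k. emeasure M (?D k) = 0)"
    proof
      assume z: "emeasure M (\<Union>k. ?D k) = 0"
      show "\<forall>k. emeasure M (?D k) = 0"
        by (intro allI emeasure_eq_0[OF _ z]) auto
    next
      assume "\<forall>k. emeasure M (?D k) = 0"
      then show "emeasure M (\<Union>k. ?D k) = 0"
        by (intro emeasure_UN_eq_0) auto
    qed
    then show ?thesis by blast
  qed
  finally show ?thesis unfolding eq D by simp
qed

end

section \<open>The state space as a Borel subset\<close>

text \<open>Joint continuity on \<open>[0,\<infinity>) \<times> E\<close> gives joint measurability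
  there; freezing the flow at negative times extends it to the whole line.\<close>

lemma flow_extension_measurable:
  assumes E: "E \<in> sets borel" and flow: "semidynamical_system E \<pi>" and m: "sets m = sets (borel_on E)"
  shows "(\<lambda>(t, x). \<pi> (max 0 t) x) \<in> borel \<Otimes>\<^sub>M m \<rightarrow>\<^sub>M m"
proof -
  have sp: "space m = E" using sets_eq_imp_space_eq[OF m] by (simp add: space_restrict_space)
  have c: "(\<lambda>(t, x). \<pi> t x) \<in> borel_measurable (restrict_space borel ({0..} \<times> E))"
    using flow by (intro borel_measurable_continuous_on_restrict) (simp add: semidynamical_system_def)
  have "(\<lambda>x. x) \<in> restrict_space borel E \<rightarrow>\<^sub>M borel" by (rule measurable_restrict_space1) simp
  then have [measurable]: "(\<lambda>x. x) \<in> m \<rightarrow>\<^sub>M borel"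
    using measurable_cong_sets[OF m refl] by blast
  have id: "(\<lambda>p. snd p) \<in> borel \<Otimes>\<^sub>M m \<rightarrow>\<^sub>M borel"
    by (rule measurable_compose[OF measurable_snd]) measurable
  have "(\<lambda>p. (max (0::real) (fst p), snd p)) \<in> borel \<Otimes>\<^sub>M m \<rightarrow>\<^sub>M borel \<Otimes>\<^sub>M borel"
    by (intro measurable_Pair id) measurable
  then have "(\<lambda>p. (max (0::real) (fst p), snd p)) \<in> borel \<Otimes>\<^sub>M m \<rightarrow>\<^sub>M restrict_space borel ({0..} \<times> E)"
    unfolding borel_prod by (intro measurable_restrict_space2) (auto simp: space_pair_measure sp)
  from measurable_compose[OF this c]
  have "(\<lambda>(t, x). \<pi> (max 0 t) x) \<in> borel_measurable (borel \<Otimes>\<^sub>M m)" by (simp add: split_beta')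
  then have "(\<lambda>(t, x). \<pi> (max 0 t) x) \<in> borel \<Otimes>\<^sub>M m \<rightarrow>\<^sub>M restrict_space borel E"
    using flow by (intro measurable_restrict_space2) (auto simp: space_pair_measure sp semidynamical_system_def)
  then show ?thesis using measurable_cong_sets[OF refl m] by blast
qed

lemma kernel_extension_measurable:
  assumes rep: "kernel_representation E J \<kappa>" and m: "sets m = sets (borel_on E)"
  shows "(\<lambda>(q, x). \<kappa> (max 0 (min 1 q)) x) \<in> borel \<Otimes>\<^sub>M m \<rightarrow>\<^sub>M m"
proof -
  have k: "(\<lambda>(q, x). \<kappa> q x) \<in> borel_on {0..1} \<Otimes>\<^sub>M m \<rightarrow>\<^sub>M m"
    using rep measurable_cong_sets[OF sets_pair_measure_cong[OF refl m] m]
    by (auto simp: kernel_representation_def)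
  have "(\<lambda>p. max 0 (min 1 (fst p))) \<in> borel \<Otimes>\<^sub>M m \<rightarrow>\<^sub>M borel_on {0..1::real}"
    by (intro measurable_restrict_space2) auto
  then have "(\<lambda>p. (max 0 (min 1 (fst p)), snd p)) \<in> borel \<Otimes>\<^sub>M m \<rightarrow>\<^sub>M borel_on {0..1::real} \<Otimes>\<^sub>M m"
    by (intro measurable_Pair) auto
  from measurable_compose[OF this k] show ?thesis by (simp add: split_beta')
qed

lemma cumulative_rate_extension: "cumulative_rate (\<lambda>t. \<pi> (max 0 t)) \<phi> = cumulative_rate \<pi> \<phi>"
  unfolding cumulative_rate_def by (intro ext set_lebesgue_integral_cong) auto

text \<open>The flow is changed at negative times only, which affects neither its semigroup property nor
  the cumulative rate.\<close>

lemma pdmp_flow_extension: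
  assumes E: "E \<in> sets borel" and flow: "semidynamical_system E \<pi>" and rate: "jump_rate E \<pi> \<phi>"
    and J: "jump_kernel E J" and m: "sets m = sets (borel_on E)"
  shows "pdmp_flow m (\<lambda>t. \<pi> (max 0 t)) \<phi> J"
proof
  have sp: "space m = E" using sets_eq_imp_space_eq[OF m] by (simp add: space_restrict_space)
  show "(\<lambda>(t, x). \<pi> (max 0 t) x) \<in> borel \<Otimes>\<^sub>M m \<rightarrow>\<^sub>M m"
    by (rule flow_extension_measurable[OF E flow m])
  show "\<phi> \<in> borel_measurable m"
    using rate measurable_cong_sets[OF m refl] by (auto simp: jump_rate_def)
  have "prob_algebra m = prob_algebra (borel_on E)"
    unfolding prob_algebra_def subprob_algebra_cong[OF m] ..
  then show "J \<in> m \<rightarrow>\<^sub>M prob_algebra m"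
    using J measurable_cong_sets[OF m refl, of "prob_algebra (borel_on E)"]
    by (auto simp: jump_kernel_def)
  fix x assume x: "x \<in> space m"
  show "\<pi> (max 0 0) x = x" using flow x sp by (simp add: semidynamical_system_def)
  show "0 \<le> \<phi> x" using rate x sp by (simp add: jump_rate_def)
  show "filterlim (cumulative_rate (\<lambda>t. \<pi> (max 0 t)) \<phi> x) at_top at_top"
    using rate x sp by (simp add: jump_rate_def cumulative_rate_extension)
  fix s t :: real
  show "\<pi> (max 0 (s + t)) x = \<pi> (max 0 t) (\<pi> (max 0 s) x)" if "0 \<le> s" "0 \<le> t"
    using flow x sp that by (simp add: semidynamical_system_def add.commute[of s])
  have "set_integrable lborel {0..<max t 0 + 1} (\<lambda>s. \<phi> (\<pi> s x))"
    using rate x sp by (simp add: jump_rate_def)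
  then have "set_integrable lborel {0..t} (\<lambda>s. \<phi> (\<pi> s x))"
    by (rule set_integrable_subset) auto
  then show "set_integrable lborel {0..t} (\<lambda>s. \<phi> (\<pi> (max 0 s) x))"
    by (rule set_integrable_cong[THEN iffD1, rotated -1]) auto
qed

theorem corollary5p3:
  fixes E :: "'a::polish_space set"
    and \<pi> :: "real \<Rightarrow> 'a \<Rightarrow> 'a" and \<phi> :: "'a \<Rightarrow> real" and J :: "'a \<Rightarrow> 'a measure"
    and \<kappa> :: "real \<Rightarrow> 'a \<Rightarrow> 'a"
    and M :: "'w measure" and \<epsilon> \<theta> :: "nat \<Rightarrow> 'w \<Rightarrow> real"
    and m :: "'a measure" and P :: "('a \<Rightarrow> real) \<Rightarrow> ('a \<Rightarrow> real)"
    and S Pt :: "real \<Rightarrow> ('a \<Rightarrow> real) \<Rightarrow> ('a \<Rightarrow> real)"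
  assumes "E \<in> sets borel"
    and "semidynamical_system E \<pi>"
    and "jump_rate E \<pi> \<phi>"
    and "jump_kernel E J"
    and "kernel_representation E J \<kappa>"
    and "driving_noise M \<epsilon> \<theta>"
    and "sets m = sets (borel_on E)" and "sigma_finite_measure m"
    and "stochastic_operator m P" and "transition_operator m J P"
    and "killed_flow_semigroup m \<pi> \<phi> S"
    and "minimal_semigroup m \<phi> P S Pt"
  shows "(stochastic_semigroup m Pt \<longleftrightarrow>
            {x\<in>E. 0 < measure M {\<omega>\<in>space M. explosion_time \<pi> \<phi> \<kappa> x (\<lambda>n. \<epsilon> n \<omega>) (\<lambda>n. \<theta> n \<omega>) < \<infinity>}}
              \<in> null_sets m) \<and>
         (stochastic_semigroup m Pt \<longrightarrow>
            (\<forall>\<xi>\<^sub>0 u\<^sub>0. \<xi>\<^sub>0 \<in> M \<rightarrow>\<^sub>M borel_on E \<longrightarrow>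
               independent_of_noise M (borel_on E) \<xi>\<^sub>0 \<epsilon> \<theta> \<longrightarrow>
               u\<^sub>0 \<in> Domain (generator m S) \<longrightarrow>
               has_density M m (\<lambda>\<omega>. Some (\<xi>\<^sub>0 \<omega>)) u\<^sub>0 \<longrightarrow>
               (\<forall>t>0. has_density M m
                  (\<lambda>\<omega>. minimal_pdmp \<pi> \<phi> \<kappa> (\<xi>\<^sub>0 \<omega>) (\<lambda>n. \<epsilon> n \<omega>) (\<lambda>n. \<theta> n \<omega>) t) (Pt t u\<^sub>0))))"
proof -
  note m = \<open>sets m = sets (borel_on E)\<close>
  have sp: "space m = E" using sets_eq_imp_space_eq[OF m] by (simp add: space_restrict_space)
  \<comment> \<open>extensions to all real arguments, which are measurable there and agree with the originals along the paths\<close>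
  define \<pi>' where "\<pi>' = (\<lambda>t. \<pi> (max 0 t))"
  define \<kappa>' where "\<kappa>' = (\<lambda>q. \<kappa> (max 0 (min 1 q)))"
  interpret flow: pdmp_flow m \<pi>' \<phi> J
    unfolding \<pi>'_def using assms by (intro pdmp_flow_extension)
  have rate_eq: "cumulative_rate \<pi>' \<phi> = cumulative_rate \<pi> \<phi>"
    unfolding \<pi>'_def by (rule cumulative_rate_extension)
  interpret sigma_finite_measure m by fact
  interpret L: pdmp_L1 m \<pi>' \<phi> J P S
  proof
    show "stochastic_operator m P" "transition_operator m J P" by fact+
    show "killed_flow_semigroup m \<pi>' \<phi> S"
      using \<open>killed_flow_semigroup m \<pi> \<phi> S\<close>
      unfolding killed_flow_semigroup_def rate_eq by (simp add: \<pi>'_def)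
  qed
  interpret prob_space M using \<open>driving_noise M \<epsilon> \<theta>\<close> by (simp add: driving_noise_def)
  interpret X: pdmp_process m \<pi>' \<phi> J M \<kappa>' \<epsilon> \<theta>
  proof
    show "(\<lambda>(q, x). \<kappa>' q x) \<in> borel \<Otimes>\<^sub>M m \<rightarrow>\<^sub>M m"
      unfolding \<kappa>'_def by (rule kernel_extension_measurable) fact+
    fix x B assume x: "x \<in> space m" and B: "B \<in> sets m"
    have "{q\<in>{0..1}. \<kappa>' q x \<in> B} = {q\<in>{0..1}. \<kappa> q x \<in> B}"
      by (auto simp: \<kappa>'_def)
    then show "emeasure (J x) B = emeasure lborel {q\<in>{0..1}. \<kappa>' q x \<in> B}"
      using \<open>kernel_representation E J \<kappa>\<close> x B m sp by (simp add: kernel_representation_def)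
  qed fact
  let ?e = "\<lambda>\<omega> n. \<epsilon> n \<omega>" and ?q = "\<lambda>\<omega> n. \<theta> n \<omega>"
  have inv_eq: "cumulative_rate_inverse \<pi> \<phi> = cumulative_rate_inverse \<pi>' \<phi>"
    by (intro ext) (simp add: cumulative_rate_inverse_def rate_eq)
  have post_eq: "post_jump_state \<pi> \<phi> \<kappa> x (?e \<omega>) (?q \<omega>) n = post_jump_state \<pi>' \<phi> \<kappa>' x (?e \<omega>) (?q \<omega>) n"
    if x: "x \<in> E" and \<omega>: "\<omega> \<in> space M" for x \<omega> n
  proof (induction n)
    case (Suc n)
    let ?y = "post_jump_state \<pi>' \<phi> \<kappa>' x (?e \<omega>) (?q \<omega>) n"
    have "?y \<in> space m" using X.post_jump_state_in_space x sp by blast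
    then have "0 \<le> cumulative_rate_inverse \<pi>' \<phi> ?y (?e \<omega> (Suc n))" by (rule flow.inverse_nonneg)
    moreover have "?q \<omega> (Suc n) \<in> {0..1}" using \<open>driving_noise M \<epsilon> \<theta>\<close> \<omega> by (auto simp: driving_noise_def)
    ultimately show ?case
      by (simp add: Suc Let_def inv_eq) (simp add: \<pi>'_def \<kappa>'_def)
  qed simp
  have jump_eq: "jump_time \<pi> \<phi> \<kappa> x (?e \<omega>) (?q \<omega>) = jump_time \<pi>' \<phi> \<kappa>' x (?e \<omega>) (?q \<omega>)"
    if "x \<in> E" "\<omega> \<in> space M" for x \<omega>
    by (intro ext) (simp add: jump_time_def holding_time_def post_eq[OF that] inv_eq)
  have explosion_eq: "explosion_time \<pi> \<phi> \<kappa> x (?e \<omega>) (?q \<omega>) = explosion_time \<pi>' \<phi> \<kappa>' x (?e \<omega>) (?q \<omega>)"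
    if "x \<in> E" "\<omega> \<in> space M" for x \<omega>
    by (simp add: explosion_time_def jump_eq[OF that])
  have visits: "minimal_pdmp \<pi> \<phi> \<kappa> x (?e \<omega>) (?q \<omega>) t \<in> Some ` B \<longleftrightarrow> X.visits t B x (X.noise_vector \<omega>)"
    if x: "x \<in> E" and \<omega>: "\<omega> \<in> space M" and t: "0 \<le> t" for x \<omega> t B
  proof -
    have xm: "x \<in> space m" using x sp by simp
    note inc = X.jump_time_incseq[OF xm, of "?e \<omega>" "?q \<omega>"]
    show ?thesis
      unfolding X.visits_iff_minimal_pdmp[OF xm t] minimal_pdmp_in_iff[OF inc t]
        minimal_pdmp_in_iff[OF inc[folded jump_eq[OF x \<omega>]] t] jump_eq[OF x \<omega>] post_eq[OF x \<omega>]
      by (auto simp: \<pi>'_def)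
  qed
  have explosive: "0 < measure M {\<omega>\<in>space M. explosion_time \<pi> \<phi> \<kappa> x (?e \<omega>) (?q \<omega>) < \<infinity>}
      \<longleftrightarrow> (\<exists>k::nat. flow.transition (real k) (\<lambda>_. 1) x \<noteq> 1)" if x: "x \<in> E" for x
  proof -
    have "{\<omega>\<in>space M. explosion_time \<pi> \<phi> \<kappa> x (?e \<omega>) (?q \<omega>) < \<infinity>}
        = {\<omega>\<in>space M. explosion_time \<pi>' \<phi> \<kappa>' x (?e \<omega>) (?q \<omega>) < \<infinity>}"
      using explosion_eq[OF x] by auto
    then show ?thesis using X.explosion_prob_pos_iff[of x] x sp by simp
  qed
  have [measurable]: "flow.transition t (\<lambda>_. 1) \<in> borel_measurable m" for t
    by (intro kernel_operator_measurable[OF flow.kernel_operator_transition]) simp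
  have "stochastic_semigroup m Pt \<longleftrightarrow> (\<forall>t\<ge>0. AE x in m. flow.transition t (\<lambda>_. 1) x = 1)"
    by (rule L.stochastic_iff_conservative) fact
  \<comment> \<open>integer times suffice because \<open>V(t) 1\<close> decreases in \<open>t\<close>, and they allow the quantifier to pass inside the null set\<close>
  also have "\<dots> \<longleftrightarrow> (AE x in m. \<forall>k::nat. flow.transition (real k) (\<lambda>_. 1) x = 1)"
  proof
    assume "\<forall>t\<ge>0. AE x in m. flow.transition t (\<lambda>_. 1) x = 1"
    then show "AE x in m. \<forall>k::nat. flow.transition (real k) (\<lambda>_. 1) x = 1"
      by (simp add: AE_all_countable)
  next
    assume a: "AE x in m. \<forall>k::nat. flow.transition (real k) (\<lambda>_. 1) x = 1"
    show "\<forall>t\<ge>0. AE x in m. flow.transition t (\<lambda>_. 1) x = 1"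
    proof (intro allI impI)
      fix t :: real assume t: "0 \<le> t"
      obtain k where k: "t \<le> real k" using real_arch_simple by blast
      from a AE_space show "AE x in m. flow.transition t (\<lambda>_. 1) x = 1"
      proof eventually_elim
        case (elim x)
        have "1 = flow.transition (t + (real k - t)) (\<lambda>_. 1) x" using elim(1) by simp
        also have "\<dots> = flow.transition t (flow.transition (real k - t) (\<lambda>_. 1)) x"
          using t k elim(2) by (intro flow.transition_add) auto
        also have "\<dots> \<le> flow.transition t (\<lambda>_. 1) x"
          by (intro kernel_operator_mono[OF flow.kernel_operator_transition] flow.transition_le_1 elim(2)) auto
        finally show ?case using flow.transition_le_1[OF elim(2), of t] by (intro antisym)
      qed
    qed
  qed
  also have "\<dots> \<longleftrightarrow> {x\<in>space m. \<not> (\<forall>k::nat. flow.transition (real k) (\<lambda>_. 1) x = 1)} \<in> null_sets m"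
    by (rule AE_iff_null) measurable
  also have "{x\<in>space m. \<not> (\<forall>k::nat. flow.transition (real k) (\<lambda>_. 1) x = 1)}
      = {x\<in>E. 0 < measure M {\<omega>\<in>space M. explosion_time \<pi> \<phi> \<kappa> x (?e \<omega>) (?q \<omega>) < \<infinity>}}"
    using explosive sp by auto
  finally have first: "stochastic_semigroup m Pt \<longleftrightarrow>
      {x\<in>E. 0 < measure M {\<omega>\<in>space M. explosion_time \<pi> \<phi> \<kappa> x (?e \<omega>) (?q \<omega>) < \<infinity>}} \<in> null_sets m" .
  have second: "has_density M m (\<lambda>\<omega>. minimal_pdmp \<pi> \<phi> \<kappa> (\<xi> \<omega>) (?e \<omega>) (?q \<omega>) t) (Pt t u)"
    if st: "stochastic_semigroup m Pt" and \<xi>: "\<xi> \<in> M \<rightarrow>\<^sub>M borel_on E"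
      and ind: "independent_of_noise M (borel_on E) \<xi> \<epsilon> \<theta>"
      and dens: "has_density M m (\<lambda>\<omega>. Some (\<xi> \<omega>)) u" and t: "0 < t" for \<xi> u t
    unfolding has_density_def
  proof (intro conjI ballI)
    have \<xi>m [measurable]: "\<xi> \<in> M \<rightarrow>\<^sub>M m" using \<xi> measurable_cong_sets[OF refl m] by blast
    have \<xi>E: "\<xi> \<omega> \<in> E" if "\<omega> \<in> space M" for \<omega> using measurable_space[OF \<xi>m that] sp by simp
    have indm: "independent_of_noise M m \<xi> \<epsilon> \<theta>"
      using ind sets_vimage_algebra_cong[OF m, of "space M" \<xi>] by (simp add: independent_of_noise_def)
    have u: "L1_density m u" using dens by (simp add: has_density_def)
    then have un: "L1_nonneg m u" by (simp add: L1_density_def)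
    then have ui: "integrable m u" and u0: "AE x in m. 0 \<le> u x" by (auto simp: L1_nonneg_def)
    have law: "distr M m \<xi> = density m (\<lambda>x. ennreal (u x))"
    proof (rule measure_eqI)
      fix B assume "B \<in> sets (distr M m \<xi>)"
      then have B [measurable]: "B \<in> sets m" by simp
      have "emeasure (distr M m \<xi>) B = ennreal (measure M {\<omega>\<in>space M. Some (\<xi> \<omega>) \<in> Some ` B})"
        by (subst emeasure_distr) (auto simp: emeasure_eq_measure intro!: arg_cong[where f="measure M"])
      also have "\<dots> = ennreal (\<integral>x. indicator B x * u x \<partial>m)"
        using dens B by (simp add: has_density_def set_lebesgue_integral_def)
      also have "\<dots> = (\<integral>\<^sup>+x. ennreal (indicator B x * u x) \<partial>m)"
        using u0 by (intro nn_integral_eq_integral[symmetric] unit_test_integrable unit_test_indicator B ui) auto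
      also have "\<dots> = emeasure (density m (\<lambda>x. ennreal (u x))) B"
        using ui by (subst emeasure_density) (auto intro!: nn_integral_cong simp: indicator_def)
      finally show "emeasure (distr M m \<xi>) B = emeasure (density m (\<lambda>x. ennreal (u x))) B" .
    qed simp
    show Pu: "L1_density m (Pt t u)"
      using st t u by (auto simp: stochastic_semigroup_def stochastic_operator_def)
    fix B assume B: "B \<in> sets m"
    have eq: "{\<omega>\<in>space M. minimal_pdmp \<pi> \<phi> \<kappa> (\<xi> \<omega>) (?e \<omega>) (?q \<omega>) t \<in> Some ` B}
        = {\<omega>\<in>space M. X.visits t B (\<xi> \<omega>) (X.noise_vector \<omega>)}"
      by (intro Collect_cong conj_cong refl visits \<xi>E) (use t in auto)
    show "{\<omega>\<in>space M. minimal_pdmp \<pi> \<phi> \<kappa> (\<xi> \<omega>) (?e \<omega>) (?q \<omega>) t \<in> Some ` B} \<in> events"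
      unfolding eq using X.visits_measurable'[OF B \<xi>m] by simp
    have Bm: "indicator B \<in> borel_measurable m" using B by simp
    have "emeasure M {\<omega>\<in>space M. minimal_pdmp \<pi> \<phi> \<kappa> (\<xi> \<omega>) (?e \<omega>) (?q \<omega>) t \<in> Some ` B}
        = (\<integral>\<^sup>+x. flow.transition t (indicator B) x \<partial>density m (\<lambda>x. ennreal (u x)))"
      unfolding eq law[symmetric] by (rule X.visits_prob_random_start[OF \<xi>m indm B])
    also have "\<dots> = (\<integral>\<^sup>+x. flow.transition t (indicator B) x * ennreal (u x) \<partial>m)"
      using ui kernel_operator_measurable[OF flow.kernel_operator_transition Bm]
      by (subst nn_integral_density) (auto simp: mult.commute)
    also have "\<dots> = (\<integral>\<^sup>+x. indicator B x * ennreal (Pt t u x) \<partial>m)"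
      using t by (intro L.minimal_semigroup_nn_integral[symmetric, OF _ _ un Bm] assms) auto
    also have "\<dots> = (\<integral>\<^sup>+x. ennreal (indicator B x * Pt t u x) \<partial>m)"
      by (intro nn_integral_cong) (auto simp: indicator_def)
    also have "\<dots> = ennreal (LINT x:B|m. Pt t u x)"
      unfolding set_lebesgue_integral_def real_scaleR_def using Pu
      by (intro nn_integral_eq_integral unit_test_integrable unit_test_indicator B)
        (auto simp: L1_density_def L1_nonneg_def)
    finally show "measure M {\<omega>\<in>space M. minimal_pdmp \<pi> \<phi> \<kappa> (\<xi> \<omega>) (?e \<omega>) (?q \<omega>) t \<in> Some ` B}
        = (LINT x:B|m. Pt t u x)"
      using Pu by (simp add: measure_def set_lebesgue_integral_def L1_density_def L1_nonneg_def)
        (subst enn2real_ennreal, auto intro!: integral_nonneg_AE)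
  qed
  show ?thesis using first second by blast
qed

end
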